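(* Let $S$ be a cut-free net that is atomically testable by a sequent $A_1,\dots,A_n$. Then $S\vdash_{\mathsf{MLL}^\maltese}A_1,\dots,A_n$ if and only if $S$ is orthogonal to $\mathsf{tests}(A_1)\parallel\cdots\parallel\mathsf{tests}(A_n)$.
   Context: **Nets.** Fix a countable set of positions. A hypergraph has a finite set $V$ of positions and a finite set $E$ of labelled links; each link has a source and a target, which are finite sequences of pairwise distinct positions, the source and the target being disjoint. The only links used are: tensor links $\langle p_1,p_2\rhd_\otimes p\rangle$ and par links $\langle p_1,p_2\rhd_\wp p\rangle$ (two inputs, one output), cut links $\langle p_1,p_2\rhd_{\mathsf{cut}}\rangle$ (two inputs, no output), and daimon links $\langle\rhd_\maltese p_1,\dots,p_n\rangle$, $n\ge 0$ (no input). ($\wp$ denotes the par connective.) The sum $H_1+H_2$ takes the union of positions and the disjoint union of links. A conclusion is a position that is in the source of no link. A (multiplicative) net $S$ is a finite sum of such links in which every position is in the target of exactly one link and in the source of at most one link, together with a total order on its conclusions; $S(i)$ is the $i$-th conclusion and $\#S$ the number of conclusions. A net is cut-free if it has no cut link. Nets are considered up to isomorphism. $S\parallel T$ is the disjoint union (after renaming positions), with the conclusions of $S$ ordered before those of $T$. $\maltese_n$ is the net made of one daimon link with $n$ outputs. Initial positions are the outputs of daimon links. **Cut elimination** $\to$ is the closure under sum with a context of the following rules (insensitive to the order of the inputs of cut links; conclusions and their order are unchanged): (i) $\langle p_1,p_2\rhd_\wp p\rangle+\langle p,q\rhd_{\mathsf{cut}}\rangle+\langle q_1,q_2\rhd_\otimes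 q\rangle\to\langle p_1,q_1\rhd_{\mathsf{cut}}\rangle+\langle p_2,q_2\rhd_{\mathsf{cut}}\rangle$; (ii) for two distinct daimon links, $\langle\rhd_\maltese\bar p\rangle+\langle p_i,q_j\rhd_{\mathsf{cut}}\rangle+\langle\rhd_\maltese\bar q\rangle\to\langle\rhd_\maltese\bar p\setminus p_i,\bar q\setminus q_j\rangle$; (iii) $\langle p_1,p_2\rhd_\otimes p\rangle+\langle p,q\rhd_{\mathsf{cut}}\rangle+\langle\rhd_\maltese\bar a,q,\bar b\rangle\to\langle p_1,q^1\rhd_{\mathsf{cut}}\rangle+\langle p_2,q^2\rhd_{\mathsf{cut}}\rangle+\langle\rhd_\maltese\bar a,q^1,q^2,\bar b\rangle$ with $q^1,q^2$ fresh; (iv) $\langle q_1,q_2\rhd_\wp q\rangle+\langle q,p\rhd_{\mathsf{cut}}\rangle+\langle\rhd_\maltese\bar a,p,\bar b\rangle\to\langle q_1,p^1\rhd_{\mathsf{cut}}\rangle+\langle q_2,p^2\rhd_{\mathsf{cut}}\rangle+\langle\rhd_\maltese\bar a',p^1,\bar b'\rangle+\langle\rhd_\maltese\bar a'',p^2,\bar b''\rangle$ with $p^1,p^2$ fresh, for any choice of sequences such that $\bar a',\bar a''$ enumerate a splitting of $\bar a$ into two (possibly empty) parts and $\bar b',\bar b''$ one of $\bar b$. In (iii) and (iv) the inputs of the connective link may themselves be outputs of the daimon link involved. Other cuts are not reducible. $\to^*$ is the reflexive transitive closure. **Orthogonality.** For nets $S,T$ with $k=\min(\#S,\#T)$, the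 interaction $S::T$ is $S+T+\sum_{1\le i\le k}\langle S(i),T(i)\rhd_{\mathsf{cut}}\rangle$ ($S,T$ made disjoint), the remaining conclusions keeping their order. $S\perp T$ iff there exists a reduction $S::T\to^*\maltese_0$. A net is orthogonal to a set of nets if it is orthogonal to each of its elements. For a set $A$ of nets, $A^\bot=\{P\mid\forall R\in A,\ P\perp R\}$. For sets of nets $\mathbf A,\mathbf B$: $\mathbf A\parallel\mathbf B=\{S\parallel T\mid S\in\mathbf A,T\in\mathbf B\}^{\bot\bot}$. **Logic.** Propositional variables form a countable set with an involution $X\mapsto X^\bot$. Formulas: $A,B::=X\mid A\wp B\mid A\otimes B$, with $(A\wp B)^\bot=A^\bot\otimes B^\bot$, $(A\otimes B)^\bot=A^\bot\wp B^\bot$. Sequents are finite sequences of formulas. $\mathsf{MLL}^\maltese$ proofs are trees built with the rules: ($\maltese$) infer any $\Gamma$ with no premise; ($\wp$) from $\Gamma,A,B$ infer $\Gamma,A\wp B$; ($\otimes$) from $\Gamma,A$ and $\Delta,B$ infer $\Gamma,\Delta,A\otimes B$; (cut) from $\Gamma,A$ and $\Delta,A^\bot$ infer $\Gamma,\Delta$; (ex) exchange of two consecutive formulas. A net $S$ represents a proof $\pi$ of $A_1,\dots,A_n$ (the $i$-th conclusion of $S$ corresponding to $A_i$), inductively: a $\maltese$-rule is represented by a single daimon link $\langle\rhd_\maltese p_1,\dots,p_n\rangle$ with conclusions ordered $p_1,\dots,p_n$; a $\wp$-rule by adding a par link with fresh output to the conclusions for $A,B$ of a net representing the premise; a $\otimes$-rule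 (resp. cut-rule) by the disjoint sum of nets representing the premises plus a tensor link with fresh output (resp. a cut link) on the conclusions for the two active formulas; exchange by exchanging the two conclusions in the order. $S\vdash_{\mathsf{MLL}^\maltese}\Gamma$ means that $S$ represents some $\mathsf{MLL}^\maltese$ proof of $\Gamma$. **Atomic testability.** A formula labelling of a cut-free net $S$ is a function $\tau$ from its positions to formulas such that $\tau(p)=\tau(p_1)\wp\tau(p_2)$ for each par link $\langle p_1,p_2\rhd_\wp p\rangle$ and $\tau(p)=\tau(p_1)\otimes\tau(p_2)$ for each tensor link $\langle p_1,p_2\rhd_\otimes p\rangle$ of $S$. It is atomic if every output of every daimon link is labelled by a propositional variable. A cut-free net $S$ with $n$ conclusions is atomically testable by $A_1,\dots,A_n$ if it has an atomic formula labelling $\tau$ with $\tau(S(i))=A_i$ for all $i$. **Natural partitions.** In such a net $S$ there is a binary tree of connective links above each conclusion; each initial position $p$ is determined by the index $i$ of the conclusion $S(i)$ below it and its address, the left/right word leading from $S(i)$ up to $p$. Order the $n$ initial positions lexicographically by (index, address), left before right. For a partition $P$ of the initial positions of $S$, $\mathbf{Nat}_S(P)$ is the corresponding partition of $\{1,\dots,n\}$. $\mathsf P_\maltese(S)$ is the partition $\{\mathrm t(d)\mid d\text{ a daimon link of }S\}$, $\mathrm t(d)$ being the set of outputs of $d$. **Switchings.** For a par link $\langle p_1,p_2\rhd_\wp p\rangle$ of a net, a left (resp. right) switching step deletes this link and replaces $p_1$ (resp. $p_2$) by $p$ in the target of the link having it as an output; $p_2$ (resp. $p_1$) becomes a new (last)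 conclusion. A switching $\sigma S$ of $S$ is a normal form of $S$ for these steps (so it has no par link). Its initial positions are identified with those of $S$ via the replacements. For cut-free $S$, $\uparrow^i\sigma S$ is the partition of the initial positions having one class for each conclusion $q$ of $\sigma S$, namely the set of initial positions above $q$ in $\sigma S$ (those from which $q$ is reached by going repeatedly from an input to an output of a link). **Tests.** A cut-free net $T$ is a test of a formula $A$ if $T$ is atomically testable by $A^\bot$ and there exist a (cut-free) net $S$ atomically testable by $A$ and a switching $\sigma S$ of $S$ such that $\mathbf{Nat}_T(\mathsf P_\maltese(T))=\mathbf{Nat}_S(\uparrow^i\sigma S)$. $\mathsf{tests}(A)$ is the set of tests of $A$. *)

theory Defs
  imports Complex_Main "HOL-Library.Multiset" "HOL-Library.Countable"
begin

section \<open>Nets\<close>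

type_synonym pos = nat

text \<open>\<^term>\<open>Tensor p\<^sub>1 p\<^sub>2 p\<close>, \<^term>\<open>Par p\<^sub>1 p\<^sub>2 p\<close>: inputs first, output last.\<close>

datatype link =
    Tensor pos pos pos
  | Par pos pos pos
  | Cut pos pos
  | Daimon "pos list"

fun source :: "link \<Rightarrow> pos list" where
  "source (Tensor p q r) = [p, q]"
| "source (Par p q r) = [p, q]"
| "source (Cut p q) = [p, q]"
| "source (Daimon ps) = []"

fun target :: "link \<Rightarrow> pos list" where
  "target (Tensor p q r) = [r]"
| "target (Par p q r) = [r]"
| "target (Cut p q) = []"
| "target (Daimon ps) = ps"

fun map_link :: "(pos \<Rightarrow> pos) \<Rightarrow> (pos \<Rightarrow> pos) \<Rightarrow> link \<Rightarrow> link" where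
  "map_link f g (Tensor p q r) = Tensor (f p) (f q) (g r)"
| "map_link f g (Par p q r) = Par (f p) (f q) (g r)"
| "map_link f g (Cut p q) = Cut (f p) (f q)"
| "map_link f g (Daimon ps) = Daimon (map g ps)"

text \<open>
  The links form a multiset, since a net may contain several copies of the daimon
  link without outputs. The set of positions is not recorded: in a net every position
  is in the target of some link. The list \<^term>\<open>concl S\<close> carries the total order on
  the conclusions; \<open>S(i)\<close> for \<open>1 \<le> i\<close> is \<^term>\<open>concl S ! (i - 1)\<close>.
  Nets are concrete representatives: everything below is invariant under
  injective renaming of positions, so no quotient by isomorphism is taken.
\<close>

datatype net = Net (links: "link multiset") (concl: "pos list")

definition positions :: "net \<Rightarrow> pos set" where
  "positions S = (\<Union>l\<in>set_mset (links S). set (source l) \<union> set (target l))"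

definition is_net :: "net \<Rightarrow> bool" where
  "is_net S \<longleftrightarrow>
     (\<forall>l\<in>#links S. distinct (source l) \<and> distinct (target l) \<and> set (source l) \<inter> set (target l) = {}) \<and>
     (\<forall>p\<in>positions S. size {#l \<in># links S. p \<in> set (target l)#} = 1 \<and>
                      size {#l \<in># links S. p \<in> set (source l)#} \<le> 1) \<and>
     distinct (concl S) \<and>
     set (concl S) = {p \<in> positions S. \<forall>l\<in>#links S. p \<notin> set (source l)}"

definition cut_free :: "net \<Rightarrow> bool" where
  "cut_free S \<longleftrightarrow> (\<forall>p q. Cut p q \<notin># links S)"

definition rename :: "(pos \<Rightarrow> pos) \<Rightarrow> net \<Rightarrow> net" where
  "rename f S = Net (image_mset (map_link f f) (links S)) (map f (concl S))"

text \<open>The two nets are made disjoint by moving them to the even and the odd positions.\<close>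

definition even_copy :: "net \<Rightarrow> net" where
  "even_copy = rename (\<lambda>p. 2 * p)"

definition odd_copy :: "net \<Rightarrow> net" where
  "odd_copy = rename (\<lambda>p. 2 * p + 1)"

definition juxtapose :: "net \<Rightarrow> net \<Rightarrow> net" where
  "juxtapose S T = Net (links (even_copy S) + links (odd_copy T))
                       (concl (even_copy S) @ concl (odd_copy T))"

definition empty_net :: net where
  "empty_net = Net {#} []"

definition daimon0 :: net where
  "daimon0 = Net {#Daimon []#} []"


section \<open>Cut elimination\<close>

definition cut_on :: "pos \<Rightarrow> pos \<Rightarrow> link set" where
  "cut_on p q = {Cut p q, Cut q p}"

text \<open>The multiset \<open>C\<close> is the context; \<open>cs\<close> is the unchanged list of conclusions.\<close>

inductive cut_step :: "net \<Rightarrow> net \<Rightarrow> bool" where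
  par_tensor:
    "c \<in> cut_on p q \<Longrightarrow>
     cut_step (Net ({#Par p1 p2 p, c, Tensor q1 q2 q#} + C) cs)
              (Net ({#Cut p1 q1, Cut p2 q2#} + C) cs)"
| daimon_daimon:
    "c \<in> cut_on p q \<Longrightarrow>
     cut_step (Net ({#Daimon (as @ [p] @ bs), c, Daimon (as' @ [q] @ bs')#} + C) cs)
              (Net ({#Daimon (as @ bs @ as' @ bs')#} + C) cs)"
| tensor_daimon:
    "c \<in> cut_on p q \<Longrightarrow>
     S = Net ({#Tensor p1 p2 p, c, Daimon (as @ [q] @ bs)#} + C) cs \<Longrightarrow>
     r1 \<notin> positions S \<Longrightarrow> r2 \<notin> positions S \<Longrightarrow> r1 \<noteq> r2 \<Longrightarrow>
     cut_step S (Net ({#Cut p1 r1, Cut p2 r2, Daimon (as @ [r1, r2] @ bs)#} + C) cs)"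
| par_daimon:
    "c \<in> cut_on q p \<Longrightarrow>
     S = Net ({#Par q1 q2 q, c, Daimon (as @ [p] @ bs)#} + C) cs \<Longrightarrow>
     r1 \<notin> positions S \<Longrightarrow> r2 \<notin> positions S \<Longrightarrow> r1 \<noteq> r2 \<Longrightarrow>
     mset as' + mset as'' = mset as \<Longrightarrow> mset bs' + mset bs'' = mset bs \<Longrightarrow>
     cut_step S (Net ({#Cut q1 r1, Cut q2 r2,
                        Daimon (as' @ [r1] @ bs'), Daimon (as'' @ [r2] @ bs'')#} + C) cs)"


section \<open>Orthogonality\<close>

text \<open>\<^term>\<open>zip\<close> stops at the shorter list, so it cuts exactly the first
  \<open>min (#S) (#T)\<close> conclusions.\<close>

definition interaction :: "net \<Rightarrow> net \<Rightarrow> net" where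
  "interaction S T =
     (let S' = even_copy S; T' = odd_copy T; k = min (length (concl S)) (length (concl T)) in
      Net (links S' + links T' + mset (map (\<lambda>(p, q). Cut p q) (zip (concl S') (concl T'))))
          (drop k (concl S') @ drop k (concl T')))"

definition orthogonal :: "net \<Rightarrow> net \<Rightarrow> bool" (infix "\<bottom>\<bottom>" 50) where
  "S \<bottom>\<bottom> T \<longleftrightarrow> cut_step\<^sup>*\<^sup>* (interaction S T) daimon0"

definition orthogonal_set :: "net \<Rightarrow> net set \<Rightarrow> bool" where
  "orthogonal_set S A \<longleftrightarrow> (\<forall>T\<in>A. S \<bottom>\<bottom> T)"

definition orth :: "net set \<Rightarrow> net set" where
  "orth A = {P. is_net P \<and> orthogonal_set P A}"

definition par_set :: "net set \<Rightarrow> net set \<Rightarrow> net set" where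
  "par_set A B = orth (orth {juxtapose S T |S T. S \<in> A \<and> T \<in> B})"

text \<open>The iterated \<open>A\<^sub>1 \<parallel> \<dots> \<parallel> A\<^sub>n\<close>, associated to the left. For \<open>n = 0\<close> it is generated by
  the empty net, the unit of juxtaposition.\<close>

fun par_sets :: "net set list \<Rightarrow> net set" where
  "par_sets [] = orth (orth {empty_net})"
| "par_sets (A # As) = foldl par_set A As"


section \<open>Formulas and proofs\<close>

datatype 'v form = Var 'v | FPar "'v form" "'v form" | FTensor "'v form" "'v form"

text \<open>The involution on propositional variables is the parameter \<open>d\<close> in the following.\<close>

primrec neg :: "('v \<Rightarrow> 'v) \<Rightarrow> 'v form \<Rightarrow> 'v form" where
  "neg d (Var X) = Var (d X)"
| "neg d (FPar A B) = FTensor (neg d A) (neg d B)"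
| "neg d (FTensor A B) = FPar (neg d A) (neg d B)"

datatype 'v mll_proof =
    DaimonR "'v form list"
  | ParR "'v mll_proof"
  | TensorR "'v mll_proof" "'v mll_proof"
  | CutR "'v mll_proof" "'v mll_proof"
  | ExR nat "'v mll_proof"

text \<open>\<^term>\<open>ExR i \<pi>\<close> exchanges the formulas at (zero-based) places \<open>i\<close> and \<open>i + 1\<close>.\<close>

inductive proof_of :: "('v \<Rightarrow> 'v) \<Rightarrow> 'v mll_proof \<Rightarrow> 'v form list \<Rightarrow> bool"
  for d :: "'v \<Rightarrow> 'v" where
  "proof_of d (DaimonR \<Gamma>) \<Gamma>"
| "proof_of d \<pi> (\<Gamma> @ [A, B]) \<Longrightarrow> proof_of d (ParR \<pi>) (\<Gamma> @ [FPar A B])"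
| "proof_of d \<pi> (\<Gamma> @ [A]) \<Longrightarrow> proof_of d \<rho> (\<Delta> @ [B]) \<Longrightarrow>
   proof_of d (TensorR \<pi> \<rho>) (\<Gamma> @ \<Delta> @ [FTensor A B])"
| "proof_of d \<pi> (\<Gamma> @ [A]) \<Longrightarrow> proof_of d \<rho> (\<Delta> @ [neg d A]) \<Longrightarrow>
   proof_of d (CutR \<pi> \<rho>) (\<Gamma> @ \<Delta>)"
| "proof_of d \<pi> (\<Gamma> @ [A, B] @ \<Delta>) \<Longrightarrow>
   proof_of d (ExR (length \<Gamma>) \<pi>) (\<Gamma> @ [B, A] @ \<Delta>)"

inductive represents :: "net \<Rightarrow> 'v mll_proof \<Rightarrow> bool" where
  "distinct ps \<Longrightarrow> length ps = length \<Gamma> \<Longrightarrow> represents (Net {#Daimon ps#} ps) (DaimonR \<Gamma>)"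
| "represents S \<pi> \<Longrightarrow> concl S = cs @ [p, q] \<Longrightarrow> r \<notin> positions S \<Longrightarrow>
   represents (Net (links S + {#Par p q r#}) (cs @ [r])) (ParR \<pi>)"
| "represents S \<pi> \<Longrightarrow> represents T \<rho> \<Longrightarrow> positions S \<inter> positions T = {} \<Longrightarrow>
   concl S = cs @ [p] \<Longrightarrow> concl T = ds @ [q] \<Longrightarrow> r \<notin> positions S \<union> positions T \<Longrightarrow>
   represents (Net (links S + links T + {#Tensor p q r#}) (cs @ ds @ [r])) (TensorR \<pi> \<rho>)"
| "represents S \<pi> \<Longrightarrow> represents T \<rho> \<Longrightarrow> positions S \<inter> positions T = {} \<Longrightarrow>
   concl S = cs @ [p] \<Longrightarrow> concl T = ds @ [q] \<Longrightarrow>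
   represents (Net (links S + links T + {#Cut p q#}) (cs @ ds)) (CutR \<pi> \<rho>)"
| "represents S \<pi> \<Longrightarrow> concl S = cs @ [p, q] @ ds \<Longrightarrow>
   represents (Net (links S) (cs @ [q, p] @ ds)) (ExR (length cs) \<pi>)"

definition derives :: "('v \<Rightarrow> 'v) \<Rightarrow> net \<Rightarrow> 'v form list \<Rightarrow> bool" where
  "derives d S \<Gamma> \<longleftrightarrow> (\<exists>\<pi>. proof_of d \<pi> \<Gamma> \<and> represents S \<pi>)"


section \<open>Atomic testability\<close>

definition formula_labelling :: "net \<Rightarrow> (pos \<Rightarrow> 'v form) \<Rightarrow> bool" where
  "formula_labelling S \<tau> \<longleftrightarrow>
     (\<forall>p1 p2 p. Par p1 p2 p \<in># links S \<longrightarrow> \<tau> p = FPar (\<tau> p1) (\<tau> p2)) \<and>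
     (\<forall>p1 p2 p. Tensor p1 p2 p \<in># links S \<longrightarrow> \<tau> p = FTensor (\<tau> p1) (\<tau> p2))"

definition initial_positions :: "net \<Rightarrow> pos set" where
  "initial_positions S = {p. \<exists>ps. Daimon ps \<in># links S \<and> p \<in> set ps}"

definition atomic_labelling :: "net \<Rightarrow> (pos \<Rightarrow> 'v form) \<Rightarrow> bool" where
  "atomic_labelling S \<tau> \<longleftrightarrow>
     formula_labelling S \<tau> \<and> (\<forall>p\<in>initial_positions S. \<exists>X. \<tau> p = Var X)"

definition atomically_testable :: "net \<Rightarrow> 'v form list \<Rightarrow> bool" where
  "atomically_testable S As \<longleftrightarrow>
     is_net S \<and> cut_free S \<and> (\<exists>\<tau>. atomic_labelling S \<tau> \<and> map \<tau> (concl S) = As)"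


section \<open>Natural partitions\<close>

text \<open>\<^term>\<open>address S q w p\<close>: the word \<open>w\<close> leads upwards from \<open>q\<close> to \<open>p\<close>
  (\<^term>\<open>False\<close> is left, \<^term>\<open>True\<close> is right).\<close>

inductive address :: "net \<Rightarrow> pos \<Rightarrow> bool list \<Rightarrow> pos \<Rightarrow> bool" for S where
  "address S q [] q"
| "Par p1 p2 q \<in># links S \<or> Tensor p1 p2 q \<in># links S \<Longrightarrow>
   address S p1 w p \<Longrightarrow> address S q (False # w) p"
| "Par p1 p2 q \<in># links S \<or> Tensor p1 p2 q \<in># links S \<Longrightarrow>
   address S p2 w p \<Longrightarrow> address S q (True # w) p"

definition located :: "net \<Rightarrow> nat \<times> bool list \<Rightarrow> pos \<Rightarrow> bool" where
  "located S iw p \<longleftrightarrow> fst iw < length (concl S) \<and> address S (concl S ! fst iw) (snd iw) p"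

definition natural_less :: "net \<Rightarrow> pos \<Rightarrow> pos \<Rightarrow> bool" where
  "natural_less S p q \<longleftrightarrow>
     (\<exists>iw jv. located S iw p \<and> located S jv q \<and>
              (iw, jv) \<in> less_than <*lex*> lexord {(False, True)})"

text \<open>The place of \<open>p\<close>, counted from 1, in the list of initial positions.\<close>

definition natural_index :: "net \<Rightarrow> pos \<Rightarrow> nat" where
  "natural_index S p = card {q \<in> initial_positions S. natural_less S q p} + 1"

definition natural_partition :: "net \<Rightarrow> pos set set \<Rightarrow> nat set set" where
  "natural_partition S P = (\<lambda>c. natural_index S ` c) ` P"

text \<open>A daimon link without outputs contributes the empty class. It must not be
  discarded: it prevents a test from having such a link.\<close>

definition daimon_partition :: "net \<Rightarrow> pos set set" where
  "daimon_partition S = {set ps |ps. Daimon ps \<in># links S}"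


section \<open>Switchings\<close>

text \<open>\<^term>\<open>switch_step S f S'\<close>: one switching step from \<open>S\<close> to \<open>S'\<close>, where \<open>f\<close> replaces the kept
  input of the deleted link by its output and is applied to targets only.\<close>

inductive switch_step :: "net \<Rightarrow> (pos \<Rightarrow> pos) \<Rightarrow> net \<Rightarrow> bool" where
  left: "f = id(p1 := p) \<Longrightarrow>
    switch_step (Net (L + {#Par p1 p2 p#}) cs) f
                (Net (image_mset (map_link id f) L) (cs @ [p2]))"
| right: "f = id(p2 := p) \<Longrightarrow>
    switch_step (Net (L + {#Par p1 p2 p#}) cs) f
                (Net (image_mset (map_link id f) L) (cs @ [p1]))"

inductive switch_steps :: "net \<Rightarrow> (pos \<Rightarrow> pos) \<Rightarrow> net \<Rightarrow> bool" where
  "switch_steps S id S"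
| "switch_steps S g S' \<Longrightarrow> switch_step S' f S'' \<Longrightarrow> switch_steps S (f \<circ> g) S''"

text \<open>In \<^term>\<open>switching S f S'\<close>, the map \<open>f\<close> identifies the initial positions of \<open>S\<close> with
  those of its switching \<open>S'\<close>.\<close>

definition switching :: "net \<Rightarrow> (pos \<Rightarrow> pos) \<Rightarrow> net \<Rightarrow> bool" where
  "switching S f S' \<longleftrightarrow> switch_steps S f S' \<and> (\<nexists>g S''. switch_step S' g S'')"

definition down :: "net \<Rightarrow> (pos \<times> pos) set" where
  "down S = {(p, q). \<exists>l\<in>#links S. p \<in> set (source l) \<and> q \<in> set (target l)}"

definition up_partition :: "net \<Rightarrow> (pos \<Rightarrow> pos) \<Rightarrow> net \<Rightarrow> pos set set" where
  "up_partition S f S' =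
     {{p \<in> initial_positions S. (f p, q) \<in> (down S')\<^sup>*} |q. q \<in> set (concl S')}"


section \<open>Tests\<close>

definition is_test :: "('v \<Rightarrow> 'v) \<Rightarrow> net \<Rightarrow> 'v form \<Rightarrow> bool" where
  "is_test d T A \<longleftrightarrow>
     atomically_testable T [neg d A] \<and>
     (\<exists>S f S'. atomically_testable S [A] \<and> switching S f S' \<and>
        natural_partition T (daimon_partition T) = natural_partition S (up_partition S f S'))"

definition tests :: "('v \<Rightarrow> 'v) \<Rightarrow> 'v form \<Rightarrow> net set" where
  "tests d A = {T. is_test d T A}"

end

theory Submission
  imports Defs
begin

text \<open>
  Cut against tests, a net labelled by atoms only meets the two logical steps par/tensor and
  daimon/daimon. The par/tensor steps match the leaves of dual syntax trees, and the daimon/daimon steps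
  then contract the edges of the graph whose vertices are the daimons of both sides and whose edges are the
  matched leaves; the outcome is the empty daimon exactly if this graph is a tree. Since the daimons
  of the tests of a formula realise exactly the classes of the switchings of its syntax tree,
  orthogonality to all tests says that all switchings of the net are trees.

  That correctness implies sequentialization is proved by contraction. Counting vertices and edges of a
  switching, a correct net has one daimon more than it has tensors. So either some tensor has two
  initial premises, or some daimon is above no tensor; in the latter case some par has both premises on
  that daimon, since otherwise a switching isolates it. Either link can be absorbed in a single daimon,
  which is replaced by its derivation once the smaller net is sequentialized.
\<close>

section \<open>Graphs as multisets of vertices\<close>

text \<open>Three obstacles shape the proof. Orthogonality provides a reduction whose steps cannot
  be chosen, and some rules expand a daimon against a connective link. As the trees of a test are
  dual to those of the net, such a cut never arises; and since being a tree is invariant under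
  contraction, the order of the steps is irrelevant. Only a cut inside one daimon would be stuck; it
  is a loop of the graph, and a tree has none.

  Next, every stage of the iterated parallel composition is closed under biorthogonality, so its
  elements are not just juxtapositions of tests. The last test is therefore moved across the
  orthogonality and cut against the net. This yields a net with cuts, so that this part deals with
  arbitrary nets.

  Finally, the definition of a net allows cycles of connective links. Only the labelling, along
  which formulas grow strictly downwards, makes a cut-free net a forest.\<close>

definition connected_graph :: "'a multiset multiset \<Rightarrow> bool" where
  "connected_graph G \<longleftrightarrow> G \<noteq> {#} \<and>
     (\<forall>M N. G = M + N \<longrightarrow> M \<noteq> {#} \<longrightarrow> N \<noteq> {#} \<longrightarrow> (\<exists>x. x \<in># \<Sum>\<^sub># M \<and> x \<in># \<Sum>\<^sub># N))"

text \<open>A vertex is the multiset of the edges that end at it, a graph the multiset of its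
  vertices. When each edge has two ends, the total size of the vertices is twice the number of
  edges, so the equation says that there is one vertex more than there are edges. For a connected
  graph this count characterises trees.\<close>

definition tree_graph :: "'a multiset multiset \<Rightarrow> bool" where
  "tree_graph G \<longleftrightarrow> connected_graph G \<and> 2 * size G = size (\<Sum>\<^sub># G) + 2"

lemma connected_graphD:
  assumes "connected_graph G" "G = M + N" "M \<noteq> {#}" "N \<noteq> {#}"
  shows "\<exists>x. x \<in># \<Sum>\<^sub># M \<and> x \<in># \<Sum>\<^sub># N"
  using assms unfolding connected_graph_def by metis

lemma connected_graphI:
  \<comment> \<open>Sharing an edge is symmetric in the two parts of a split, so the part with the
    chosen vertex can be put first; that part is then non-empty for free.\<close>
  assumes "\<And>M N. add_mset v H = add_mset v M + N \<Longrightarrow> N \<noteq> {#} \<Longrightarrow> \<exists>x. x \<in># v + \<Sum>\<^sub># M \<and> x \<in># \<Sum>\<^sub># N"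
  shows "connected_graph (add_mset v H)"
  unfolding connected_graph_def
proof (intro conjI allI impI)
  fix M N assume G: "add_mset v H = M + N" and ne: "M \<noteq> {#}" "N \<noteq> {#}"
  have "v \<in># M \<or> v \<in># N"
    by (metis G union_iff union_single_eq_member)
  then show "\<exists>x. x \<in># \<Sum>\<^sub># M \<and> x \<in># \<Sum>\<^sub># N"
  proof
    assume "v \<in># M"
    then obtain M' where M: "M = add_mset v M'" by (meson mset_add)
    from assms[of M' N] G ne(2) M show ?thesis by simp
  next
    assume "v \<in># N"
    then obtain N' where N: "N = add_mset v N'" by (meson mset_add)
    from assms[of N' M] G ne(1) N show ?thesis by (auto simp: add.commute)
  qed
qed simp

lemma connected_graph_addD:
  assumes "connected_graph (add_mset v (M + N))" "N \<noteq> {#}"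
  obtains x where "x \<in># v + \<Sum>\<^sub># M" "x \<in># \<Sum>\<^sub># N"
proof -
  have "add_mset v (M + N) = add_mset v M + N" by simp
  from connected_graphD[OF assms(1) this add_mset_not_empty assms(2)]
  obtain x where x: "x \<in># \<Sum>\<^sub># (add_mset v M)" "x \<in># \<Sum>\<^sub># N" by blast
  show ?thesis by (rule that[OF _ x(2)]) (use x(1) in \<open>simp only: sum_mset.add_mset\<close>)
qed

text \<open>By the hypothesis \<open>e\<close> has no ends other than the two shown. A split of the
  contracted graph lifts to one with both ends on the same side, where \<open>e\<close> cannot be
  the shared edge; conversely, a split that separates the two ends shares \<open>e\<close>
  itself.\<close>

lemma connected_graph_contract:
  assumes e: "e \<notin># v + w + \<Sum>\<^sub># H"
  shows "connected_graph (add_mset (add_mset e v) (add_mset (add_mset e w) H))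
    \<longleftrightarrow> connected_graph (add_mset (v + w) H)" (is "connected_graph ?G \<longleftrightarrow> connected_graph ?G'")
proof
  assume G: "connected_graph ?G"
  show "connected_graph ?G'"
  proof (rule connected_graphI)
    fix M N assume "add_mset (v + w) H = add_mset (v + w) M + N" and N: "N \<noteq> {#}"
    then have H: "H = M + N" by simp
    with G have "connected_graph (add_mset (add_mset e v) (add_mset (add_mset e w) M + N))" by simp
    from connected_graph_addD[OF this N] obtain x
      where "x \<in># add_mset e v + \<Sum>\<^sub># (add_mset (add_mset e w) M)" "x \<in># \<Sum>\<^sub># N" .
    with e H show "\<exists>x. x \<in># v + w + \<Sum>\<^sub># M \<and> x \<in># \<Sum>\<^sub># N" by auto
  qed
next
  assume G: "connected_graph ?G'"
  show "connected_graph ?G"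
  proof (rule connected_graphI)
    fix M N assume eq: "?G = add_mset (add_mset e v) M + N" and N: "N \<noteq> {#}"
    then have H: "add_mset (add_mset e w) H = M + N" by simp
    then have "add_mset e w \<in># M \<or> add_mset e w \<in># N"
      by (metis union_iff union_single_eq_member)
    then show "\<exists>x. x \<in># add_mset e v + \<Sum>\<^sub># M \<and> x \<in># \<Sum>\<^sub># N"
    proof
      assume "add_mset e w \<in># M"
      then obtain M' where M: "M = add_mset (add_mset e w) M'" by (meson mset_add)
      with H G have "connected_graph (add_mset (v + w) (M' + N))" by simp
      from connected_graph_addD[OF this N]
      obtain x where "x \<in># v + w + \<Sum>\<^sub># M'" "x \<in># \<Sum>\<^sub># N" .
      then show ?thesis unfolding M by (intro exI[of _ x]) auto
    next
      assume "add_mset e w \<in># N"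
      then show ?thesis by (metis mset_add sum_mset.add_mset union_iff union_single_eq_member)
    qed
  qed
qed

text \<open>Contraction removes one vertex and the two ends of one edge, so both sides of the
  counting equation drop by 2.\<close>

lemma tree_graph_contract:
  assumes "e \<notin># v + w + \<Sum>\<^sub># H"
  shows "tree_graph (add_mset (add_mset e v) (add_mset (add_mset e w) H))
    \<longleftrightarrow> tree_graph (add_mset (v + w) H)"
  unfolding tree_graph_def connected_graph_contract[OF assms] by auto

lemma tree_graph_single: "tree_graph {#v#} \<longleftrightarrow> v = {#}"
  unfolding tree_graph_def connected_graph_def
  by (auto simp: single_is_union)

lemma connected_graph_edge:
  assumes "connected_graph (add_mset v H)" "H \<noteq> {#}"
  obtains e v' w H' where "v = add_mset e v'" "H = add_mset (add_mset e w) H'"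
proof -
  obtain e where "e \<in># \<Sum>\<^sub># {#v#}" "e \<in># \<Sum>\<^sub># H"
    using connected_graph_addD[of v "{#}" H] assms by auto
  then obtain w where "w \<in># H" "e \<in># w" "e \<in># v" by auto
  then show ?thesis using that by (metis multi_member_split)
qed

text \<open>Induction by contracting an edge between \<open>v\<close> and another vertex: as
  multiplicities are at most 2, the two ends found for this edge are all its ends, which is what
  contraction requires.\<close>

lemma connected_graph_bound:
  assumes "connected_graph G" "\<And>x. count (\<Sum>\<^sub># G) x \<le> 2"
  shows "2 * size G \<le> size (\<Sum>\<^sub># G) + 2"
  using assms
proof (induction "size G" arbitrary: G rule: less_induct)
  case less
  then obtain v H where G: "G = add_mset v H"
    by (metis connected_graph_def multiset_cases)
  show ?case
  proof (cases "H = {#}")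
    case False
    then obtain e v' w H' where v: "v = add_mset e v'" and H: "H = add_mset (add_mset e w) H'"
      using connected_graph_edge less.prems(1) G by metis
    have e: "e \<notin># v' + w + \<Sum>\<^sub># H'"
      using less.prems(2)[of e] unfolding not_in_iff by (simp add: G v H)
    have "2 * size (add_mset (v' + w) H') \<le> size (\<Sum>\<^sub># (add_mset (v' + w) H')) + 2"
    proof (rule less.hyps)
      show "size (add_mset (v' + w) H') < size G" by (simp add: G H)
      show "connected_graph (add_mset (v' + w) H')"
        using less.prems(1) connected_graph_contract[OF e] by (simp add: G v H)
      show "count (\<Sum>\<^sub># (add_mset (v' + w) H')) x \<le> 2" for x
        using less.prems(2)[of x] by (simp add: G v H split: if_splits)
    qed
    then show ?thesis by (simp add: G v H)
  qed (simp add: G)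
qed

text \<open>Deleting a loop keeps connectedness and all vertices but removes an edge, so a tree with
  a loop would violate \<open>connected_graph_bound\<close>. This excludes cuts between two outputs
  of one daimon, and tensors with both premises on one daimon.\<close>

lemma tree_graph_no_loop:
  assumes "tree_graph (add_mset (add_mset e (add_mset e v)) H)"
    "\<And>x. count (\<Sum>\<^sub># (add_mset (add_mset e (add_mset e v)) H)) x \<le> 2"
  shows False
proof -
  have e: "e \<notin># v + \<Sum>\<^sub># H" using assms(2)[of e] unfolding not_in_iff by simp
  have "connected_graph (add_mset v H)"
  proof (rule connected_graphI)
    fix M N assume "add_mset v H = add_mset v M + N" and N: "N \<noteq> {#}"
    then have H: "H = M + N" by simp
    from assms(1) have "connected_graph (add_mset (add_mset e (add_mset e v)) H)"
      by (simp add: tree_graph_def)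
    from connected_graph_addD[OF this[unfolded H] N] obtain x
      where "x \<in># add_mset e (add_mset e v) + \<Sum>\<^sub># M" "x \<in># \<Sum>\<^sub># N" .
    with e H show "\<exists>x. x \<in># v + \<Sum>\<^sub># M \<and> x \<in># \<Sum>\<^sub># N" by auto
  qed
  moreover have "count (\<Sum>\<^sub># (add_mset v H)) x \<le> 2" for x
    using assms(2)[of x] by (simp split: if_splits)
  ultimately have "2 * size (add_mset v H) \<le> size (\<Sum>\<^sub># (add_mset v H)) + 2"
    by (rule connected_graph_bound)
  then show False using assms(1) by (simp add: tree_graph_def)
qed

text \<open>Riesz refinement: two decompositions of a multiset have a common one. The witnesses give
  \<open>M\<close> as much of \<open>H\<close> as possible.\<close>

lemma multiset_refine:
  fixes H :: "'a multiset"
  assumes "H + K = M + N"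
  obtains M1 M2 N1 N2 where "M = M1 + M2" "N = N1 + N2" "H = M1 + N1" "K = M2 + N2"
proof -
  have *: "count H x + count K x = count M x + count N x" for x
    using assms by (metis count_union)
  show ?thesis
  proof (rule that[of "M \<inter># H" "M - H" "H - M" "N - (H - M)"])
    have "count N x = count H x - count M x + (count N x - (count H x - count M x))"
      "count K x = count M x - count H x + (count N x - (count H x - count M x))" for x
      using *[of x] by linarith+
    then show "N = H - M + (N - (H - M))" "K = M - H + (N - (H - M))"
      unfolding multiset_eq_iff count_union count_diff by blast+
  qed (auto simp: multiset_eq_iff)
qed

text \<open>This gluing at a vertex is the effect of a tensor. The part \<open>N\<close> of a split
  that avoids the glued vertex is non-empty, so it meets one of the two graphs, and connectedness of
  that graph supplies the shared edge.\<close>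

lemma tree_graph_join:
  assumes "tree_graph (add_mset v H)" "tree_graph (add_mset w K)"
  shows "tree_graph (add_mset (v + w) (H + K))"
proof -
  have "connected_graph (add_mset (v + w) (H + K))"
  proof (rule connected_graphI)
    fix M N assume "add_mset (v + w) (H + K) = add_mset (v + w) M + N" and N: "N \<noteq> {#}"
    then have "H + K = M + N" by simp
    then obtain M1 M2 N1 N2 where MN: "M = M1 + M2" "N = N1 + N2" "H = M1 + N1" "K = M2 + N2"
      using multiset_refine by metis
    show "\<exists>x. x \<in># v + w + \<Sum>\<^sub># M \<and> x \<in># \<Sum>\<^sub># N"
    proof (cases "N1 = {#}")
      case False
      from connected_graph_addD[of v M1 N1] assms(1) this
      obtain x where "x \<in># v + \<Sum>\<^sub># M1" "x \<in># \<Sum>\<^sub># N1"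
        unfolding MN tree_graph_def by blast
      then show ?thesis unfolding MN by (intro exI[of _ x]) auto
    next
      case True
      with N have "N2 \<noteq> {#}" by (simp add: MN)
      from connected_graph_addD[of w M2 N2] assms(2) this
      obtain x where "x \<in># w + \<Sum>\<^sub># M2" "x \<in># \<Sum>\<^sub># N2"
        unfolding MN tree_graph_def by blast
      then show ?thesis unfolding MN by (intro exI[of _ x]) auto
    qed
  qed
  then show ?thesis using assms by (simp add: tree_graph_def)
qed

section \<open>Switchings of syntax trees\<close>

text \<open>Simplicity of a sum combines simplicity of the summands with their disjointness, so a
  single hypothesis on a whole net can say that all its positions differ.\<close>

definition simple :: "'a multiset \<Rightarrow> bool" where
  "simple M \<longleftrightarrow> (\<forall>x. count M x \<le> 1)"

lemma simple_empty [simp]: "simple {#}"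
  by (simp add: simple_def)

lemma simple_add_mset [simp]: "simple (add_mset x M) \<longleftrightarrow> x \<notin># M \<and> simple M"
proof -
  have "count (add_mset x M) y \<le> 1 \<longleftrightarrow> (y = x \<longrightarrow> count M x = 0) \<and> count M y \<le> 1" for y
    by auto
  then show ?thesis unfolding simple_def not_in_iff by blast
qed

lemma simple_union: "simple (M + N) \<longleftrightarrow> simple M \<and> simple N \<and> (\<forall>x. x \<in># M \<longrightarrow> x \<notin># N)"
proof -
  have "count M x + count N x \<le> 1 \<longleftrightarrow>
      count M x \<le> 1 \<and> count N x \<le> 1 \<and> (0 < count M x \<longrightarrow> count N x = 0)" for x
    by linarith
  then show ?thesis
    unfolding simple_def count_union not_in_iff count_greater_zero_iff[symmetric] by blast
qed

lemma simple_mset [simp]: "simple (mset xs) \<longleftrightarrow> distinct xs"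
  by (induction xs) auto

lemma simple_subset: "simple N \<Longrightarrow> M \<subseteq># N \<Longrightarrow> simple M"
  unfolding simple_def by (meson le_trans mset_subset_eq_count)

text \<open>The flag of a node tells pars (\<^term>\<open>True\<close>) from tensors.\<close>

datatype 'a tree = Leaf 'a | Node bool 'a "'a tree" "'a tree"

fun root :: "'a tree \<Rightarrow> 'a" where
  "root (Leaf x) = x"
| "root (Node k p a b) = p"

fun leaves :: "'a tree \<Rightarrow> 'a list" where
  "leaves (Leaf x) = [x]"
| "leaves (Node k p a b) = leaves a @ leaves b"

fun inner :: "'a tree \<Rightarrow> 'a multiset" where
  "inner (Leaf x) = {#}"
| "inner (Node k p a b) = add_mset p (inner a + inner b)"

definition nodes :: "'a tree \<Rightarrow> 'a multiset" where
  "nodes t = inner t + mset (leaves t)"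

lemma nodes_simps [simp]:
  "nodes (Leaf x) = {#x#}"
  "nodes (Node k p a b) = add_mset p (nodes a + nodes b)"
  by (simp_all add: nodes_def)

lemma root_in_nodes [simp]: "root t \<in># nodes t"
  by (cases t) auto

text \<open>\<^term>\<open>sw t r M\<close>: some switching of \<open>t\<close> has the class \<open>r\<close> of leaves above the root and
  the classes \<open>M\<close> above the premises that have been detached.\<close>

inductive sw :: "'a tree \<Rightarrow> 'a multiset \<Rightarrow> 'a multiset multiset \<Rightarrow> bool" where
  sw_leaf: "sw (Leaf x) {#x#} {#}"
| sw_tensor: "sw a r M \<Longrightarrow> sw b s N \<Longrightarrow> sw (Node False p a b) (r + s) (M + N)"
| sw_left: "sw a r M \<Longrightarrow> sw b s N \<Longrightarrow> sw (Node True p a b) r (add_mset s (M + N))"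
| sw_right: "sw a r M \<Longrightarrow> sw b s N \<Longrightarrow> sw (Node True p a b) s (add_mset r (M + N))"

inductive_cases sw_LeafE: "sw (Leaf x) r M"

text \<open>Which class belongs to the root can be forgotten: in the graph, the conclusion and the
  detached premises are vertices alike.\<close>

definition switched :: "'a tree \<Rightarrow> 'a multiset multiset \<Rightarrow> bool" where
  "switched t C \<longleftrightarrow> (\<exists>r M. sw t r M \<and> C = add_mset r M)"

fun pars :: "'a tree \<Rightarrow> nat" where
  "pars (Leaf x) = 0"
| "pars (Node k p a b) = (if k then 1 else 0) + pars a + pars b"

fun tensors :: "'a tree \<Rightarrow> nat" where
  "tensors (Leaf x) = 0"
| "tensors (Node k p a b) = (if k then 0 else 1) + tensors a + tensors b"

lemma length_leaves: "length (leaves t) = pars t + tensors t + 1"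
  by (induction t) auto

lemma sw_union: "sw t r M \<Longrightarrow> r + \<Sum>\<^sub># M = mset (leaves t)"
proof (induction rule: sw.induct)
  case (sw_tensor a r M b s N p)
  have "r + s + \<Sum>\<^sub># (M + N) = (r + \<Sum>\<^sub># M) + (s + \<Sum>\<^sub># N)" by (simp add: ac_simps)
  then show ?case by (simp add: sw_tensor.IH)
next
  case (sw_left a r M b s N p)
  have "r + \<Sum>\<^sub># (add_mset s (M + N)) = (r + \<Sum>\<^sub># M) + (s + \<Sum>\<^sub># N)" by (simp add: ac_simps)
  then show ?case by (simp add: sw_left.IH)
next
  case (sw_right a r M b s N p)
  have "s + \<Sum>\<^sub># (add_mset r (M + N)) = (r + \<Sum>\<^sub># M) + (s + \<Sum>\<^sub># N)" by (simp add: ac_simps)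
  then show ?case by (simp add: sw_right.IH)
qed simp

lemma switched_union: "switched t C \<Longrightarrow> \<Sum>\<^sub># C = mset (leaves t)"
  using sw_union unfolding switched_def by fastforce

lemma sw_size: "sw t r M \<Longrightarrow> size M = pars t"
  by (induction rule: sw.induct) auto

lemma switched_size: "switched t C \<Longrightarrow> size C = pars t + 1"
  using sw_size unfolding switched_def by fastforce

lemma sw_nonempty: "sw t r M \<Longrightarrow> r \<noteq> {#} \<and> {#} \<notin># M"
  by (induction rule: sw.induct) auto

lemma switched_nonempty: "switched t C \<Longrightarrow> {#} \<notin># C"
  using sw_nonempty unfolding switched_def by fastforce

lemma sw_exists: "\<exists>r M. sw t r M"
proof (induction t)
  case (Node k p a b)
  then obtain r M s N where "sw a r M" "sw b s N" by blast
  then have "sw (Node False p a b) (r + s) (M + N)" "sw (Node True p a b) r (add_mset s (M + N))"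
    by (auto intro: sw.intros)
  then show ?case by (cases k) auto
qed (blast intro: sw.intros)

text \<open>With \<open>d = False\<close> corresponding nodes have the same connective, with
  \<open>d = True\<close> dual ones. The names at the nodes may differ.\<close>

fun similar :: "bool \<Rightarrow> 'a tree \<Rightarrow> 'b tree \<Rightarrow> bool" where
  "similar d (Leaf x) (Leaf y) \<longleftrightarrow> True"
| "similar d (Node k p a b) (Node k' p' a' b') \<longleftrightarrow> (k' \<longleftrightarrow> k \<noteq> d) \<and> similar d a a' \<and> similar d b b'"
| "similar d _ _ \<longleftrightarrow> False"

lemma similar_length: "similar d t u \<Longrightarrow> length (leaves t) = length (leaves u)"
  by (induction d t u rule: similar.induct) auto

lemma similar_sym: "similar d t u \<longleftrightarrow> similar d u t"
  by (induction d t u rule: similar.induct) auto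

lemma similar_map [simp]:
  "similar d (map_tree f t) u \<longleftrightarrow> similar d t u"
  "similar d t (map_tree f u) \<longleftrightarrow> similar d t u"
  by (induction d t u rule: similar.induct) auto

lemma leaves_map [simp]: "leaves (map_tree f t) = map f (leaves t)"
  by (induction t) auto

lemma inner_map [simp]: "inner (map_tree f t) = image_mset f (inner t)"
  by (induction t) auto

lemma nodes_map [simp]: "nodes (map_tree f t) = image_mset f (nodes t)"
  by (simp add: nodes_def)

lemma root_map [simp]: "root (map_tree f t) = f (root t)"
  by (cases t) auto

text \<open>A switching chooses a premise at each par, and similar trees have their pars at the same
  places. Since \<open>f\<close> carries leaves to leaves in order, it carries classes to
  classes.\<close>

lemma sw_similar:
  assumes "sw t r M" "similar False t u" "map f (leaves t) = leaves u"
  shows "sw u (image_mset f r) (image_mset (image_mset f) M)"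
  using assms
proof (induction arbitrary: u rule: sw.induct)
  case (sw_leaf x)
  then show ?case by (cases u) (auto intro: sw.intros)
next
  case (sw_tensor a r M b s N p)
  then show ?case
    by (cases u) (auto simp: append_eq_append_conv similar_length intro!: sw.intros)
next
  case (sw_left a r M b s N p)
  then show ?case
    by (cases u) (auto simp: append_eq_append_conv similar_length intro!: sw.sw_left)
next
  case (sw_right a r M b s N p)
  then show ?case
    by (cases u) (auto simp: append_eq_append_conv similar_length intro!: sw.sw_right)
qed

section \<open>Replacing subtrees, and switchings of one-hole contexts\<close>

fun subtree :: "'a tree \<Rightarrow> 'a tree \<Rightarrow> bool" where
  "subtree s (Leaf x) \<longleftrightarrow> s = Leaf x"
| "subtree s (Node k p a b) \<longleftrightarrow> s = Node k p a b \<or> subtree s a \<or> subtree s b"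

text \<open>A relation, because it replaces one occurrence of \<open>s\<close>, and \<open>s\<close>
  may occur several times in a tree.\<close>

inductive replace :: "'a tree \<Rightarrow> 'a tree \<Rightarrow> 'a tree \<Rightarrow> 'a tree \<Rightarrow> bool" for s s' where
  replace_here: "replace s s' s s'"
| replace_left: "replace s s' a a' \<Longrightarrow> replace s s' (Node k p a b) (Node k p a' b)"
| replace_right: "replace s s' b b' \<Longrightarrow> replace s s' (Node k p a b) (Node k p a b')"

lemma replace_exists: "subtree s t \<Longrightarrow> \<exists>t'. replace s s' t t'"
  by (induction t) (auto intro: replace.intros)

lemma replace_root: "replace s s' t t' \<Longrightarrow> root s = root s' \<Longrightarrow> root t = root t'"
  by (induction rule: replace.induct) auto

lemma replace_inner_leaves:
  "replace s s' t t' \<Longrightarrow> \<exists>K L. inner t = inner s + K \<and> inner t' = inner s' + K \<and>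
     mset (leaves t) = mset (leaves s) + L \<and> mset (leaves t') = mset (leaves s') + L"
proof (induction rule: replace.induct)
  case (replace_left a a' k p b)
  then obtain K L where "inner a = inner s + K \<and> inner a' = inner s' + K \<and>
     mset (leaves a) = mset (leaves s) + L \<and> mset (leaves a') = mset (leaves s') + L" by blast
  then show ?case
    by (intro exI[of _ "add_mset p (K + inner b)"] exI[of _ "L + mset (leaves b)"]) (auto simp: ac_simps)
next
  case (replace_right b b' k p a)
  then obtain K L where "inner b = inner s + K \<and> inner b' = inner s' + K \<and>
     mset (leaves b) = mset (leaves s) + L \<and> mset (leaves b') = mset (leaves s') + L" by blast
  then show ?case
    by (intro exI[of _ "add_mset p (K + inner a)"] exI[of _ "L + mset (leaves a)"]) (auto simp: ac_simps)
qed auto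

text \<open>One-hole contexts of switchings: the root class of the hole is either part of the root class
  or of a detached class.\<close>

fun plug :: "'a multiset option \<times> 'a multiset \<times> 'a multiset multiset \<Rightarrow>
    'a multiset \<times> 'a multiset multiset \<Rightarrow> 'a multiset \<times> 'a multiset multiset" where
  "plug (None, r\<^sub>0, K) (r, M) = (r + r\<^sub>0, M + K)"
| "plug (Some r', r\<^sub>0, K) (r, M) = (r', add_mset (r + r\<^sub>0) (M + K))"

text \<open>If the inner context has its hole in a detached class, its own root class is what the
  outer context extends; if the outer context detaches as well, the extended class is closed and
  becomes one more class of the composite.\<close>

lemma plug_compose: "\<exists>c''. \<forall>x. plug c (plug c' x) = plug c'' x"
proof (cases c; cases c')
  fix e r\<^sub>0 K e' r\<^sub>0' K' assume [simp]: "c = (e, r\<^sub>0, K)" "c' = (e', r\<^sub>0', K')"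
  show ?thesis
  proof (cases e; cases e')
    assume [simp]: "e = None" "e' = None"
    show ?thesis by (intro exI[of _ "(None, r\<^sub>0' + r\<^sub>0, K' + K)"]) (auto simp: ac_simps)
  next
    fix q assume [simp]: "e = None" "e' = Some q"
    show ?thesis by (intro exI[of _ "(Some (q + r\<^sub>0), r\<^sub>0', K' + K)"]) (auto simp: ac_simps)
  next
    fix q assume [simp]: "e = Some q" "e' = None"
    show ?thesis by (intro exI[of _ "(Some q, r\<^sub>0' + r\<^sub>0, K' + K)"]) (auto simp: ac_simps)
  next
    fix q q' assume [simp]: "e = Some q" "e' = Some q'"
    show ?thesis by (intro exI[of _ "(Some q, r\<^sub>0', add_mset (q' + r\<^sub>0) (K' + K))"]) (auto simp: ac_simps)
  qed
qed

definition sw_pair :: "'a tree \<Rightarrow> 'a multiset \<times> 'a multiset multiset \<Rightarrow> bool" where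
  "sw_pair t x = sw t (fst x) (snd x)"

lemma sw_pair_simps:
  "sw_pair a (r, M) \<Longrightarrow> sw_pair b (s, N) \<Longrightarrow> sw_pair (Node False p a b) (r + s, M + N)"
  "sw_pair a (r, M) \<Longrightarrow> sw_pair b (s, N) \<Longrightarrow> sw_pair (Node True p a b) (r, add_mset s (M + N))"
  "sw_pair a (r, M) \<Longrightarrow> sw_pair b (s, N) \<Longrightarrow> sw_pair (Node True p a b) (s, add_mset r (M + N))"
  by (auto simp: sw_pair_def intro: sw.intros)

lemma sw_pairE:
  assumes "sw_pair (Node k p a b) x"
  obtains (tensor) r M s N where "sw_pair a (r, M)" "sw_pair b (s, N)" "k = False" "x = (r + s, M + N)"
    | (left) r M s N where "sw_pair a (r, M)" "sw_pair b (s, N)" "k = True" "x = (r, add_mset s (M + N))"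
    | (right) r M s N where "sw_pair a (r, M)" "sw_pair b (s, N)" "k = True" "x = (s, add_mset r (M + N))"
proof -
  have "sw (Node k p a b) (fst x) (snd x)" using assms by (simp add: sw_pair_def)
  then show ?thesis
  proof cases
    case (sw_tensor r M s N)
    then show ?thesis by (intro tensor[of r M s N]) (simp_all add: sw_pair_def prod_eq_iff)
  next
    case (sw_left M s N)
    then show ?thesis by (intro left[of "fst x" M s N]) (simp_all add: sw_pair_def prod_eq_iff)
  next
    case (sw_right r M N)
    then show ?thesis by (intro right[of r M "fst x" N]) (simp_all add: sw_pair_def prod_eq_iff)
  qed
qed

text \<open>Switching a node leaves three contexts for its left premise: in a tensor the class of
  the hole absorbs the class of \<open>b\<close>, in a par switched left it remains the root class,
  and in a par switched right it is detached and the class of \<open>b\<close> becomes the root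
  class.\<close>

lemma sw_plug_left:
  assumes "sw_pair (Node k p a' b) x"
  shows "\<exists>c y. sw_pair a' y \<and> x = plug c y \<and> (\<forall>a y. sw_pair a y \<longrightarrow> sw_pair (Node k p a b) (plug c y))"
  using assms
proof (cases rule: sw_pairE)
  case (tensor r M s N)
  then show ?thesis
    by (intro exI[of _ "(None, s, N)"] exI[of _ "(r, M)"]) (auto intro: sw_pair_simps)
next
  case (left r M s N)
  then show ?thesis using sw_pair_simps(2)[OF _ left(2)]
    by (intro exI[of _ "(None, {#}, add_mset s N)"] exI[of _ "(r, M)"]) auto
next
  case (right r M s N)
  then show ?thesis
    by (intro exI[of _ "(Some s, {#}, N)"] exI[of _ "(r, M)"]) (auto intro: sw_pair_simps)
qed

lemma sw_plug_right:
  assumes "sw_pair (Node k p b a') x"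
  shows "\<exists>c y. sw_pair a' y \<and> x = plug c y \<and> (\<forall>a y. sw_pair a y \<longrightarrow> sw_pair (Node k p b a) (plug c y))"
  using assms
proof (cases rule: sw_pairE)
  case (tensor r M s N)
  then show ?thesis using sw_pair_simps(1)[OF tensor(1)]
    by (intro exI[of _ "(None, r, M)"] exI[of _ "(s, N)"]) (auto simp: ac_simps)
next
  case (left r M s N)
  then show ?thesis using sw_pair_simps(2)[OF left(1)]
    by (intro exI[of _ "(Some r, {#}, M)"] exI[of _ "(s, N)"]) (auto simp: ac_simps)
next
  case (right r M s N)
  then show ?thesis using sw_pair_simps(3)[OF right(1)]
    by (intro exI[of _ "(None, {#}, add_mset r M)"] exI[of _ "(s, N)"]) (auto simp: ac_simps)
qed

text \<open>Contexts as functions, since \<open>sw_context\<close> has to fill the hole of one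
  context with arbitrary trees.\<close>

inductive tree_context :: "('a tree \<Rightarrow> 'a tree) \<Rightarrow> bool" where
  context_hole: "tree_context (\<lambda>s. s)"
| context_left: "tree_context c \<Longrightarrow> tree_context (\<lambda>s. Node k p (c s) b)"
| context_right: "tree_context c \<Longrightarrow> tree_context (\<lambda>s. Node k p a (c s))"

lemma replace_context: "replace s s' t t' \<Longrightarrow> \<exists>c. tree_context c \<and> t = c s \<and> t' = c s'"
proof (induction rule: replace.induct)
  case replace_here
  show ?case by (intro exI[of _ "\<lambda>s. s"]) (simp add: context_hole)
next
  case (replace_left a a' k p b)
  then obtain c where "tree_context c" "a = c s" "a' = c s'" by blast
  then show ?case by (intro exI[of _ "\<lambda>s. Node k p (c s) b"]) (simp add: context_left)
next
  case (replace_right b b' k p a)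
  then obtain c where "tree_context c" "b = c s" "b' = c s'" by blast
  then show ?case by (intro exI[of _ "\<lambda>s. Node k p a (c s)"]) (simp add: context_right)
qed

lemma context_replace: "tree_context c \<Longrightarrow> replace s s' (c s) (c s')"
  by (induction rule: tree_context.induct) (auto intro: replace.intros)

text \<open>The context \<open>e\<close> records only choices made outside the hole, so the same
  \<open>e\<close> serves every tree put there, with any of its switchings.\<close>

lemma sw_context:
  assumes "tree_context c" "sw_pair (c s') x"
  shows "\<exists>e y. sw_pair s' y \<and> x = plug e y \<and> (\<forall>s y. sw_pair s y \<longrightarrow> sw_pair (c s) (plug e y))"
  using assms
proof (induction arbitrary: x rule: tree_context.induct)
  case context_hole
  have "plug (None, {#}, {#}) y = y" for y :: "'a multiset \<times> 'a multiset multiset" by (cases y) simp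
  with context_hole show ?case by (intro exI[of _ "(None, {#}, {#})"] exI[of _ x]) simp
next
  case (context_left c k p b)
  from sw_plug_left[OF context_left.prems] obtain e y where e: "sw_pair (c s') y" "x = plug e y"
    "\<And>a y. sw_pair a y \<Longrightarrow> sw_pair (Node k p a b) (plug e y)" by blast
  from context_left.IH[OF e(1)] obtain e' z where e': "sw_pair s' z" "y = plug e' z"
    "\<And>s y. sw_pair s y \<Longrightarrow> sw_pair (c s) (plug e' y)" by blast
  obtain e'' where e'': "plug e (plug e' x) = plug e'' x" for x
    using plug_compose[of e e'] by blast
  show ?case
  proof (intro exI conjI allI impI)
    show "sw_pair s' z" by fact
    show "x = plug e'' z" by (simp add: e e' e'')
    show "sw_pair (Node k p (c s) b) (plug e'' y)" if "sw_pair s y" for s y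
      using e(3)[OF e'(3)[OF that]] by (simp add: e'')
  qed
next
  case (context_right c k p a)
  from sw_plug_right[OF context_right.prems] obtain e y where e: "sw_pair (c s') y" "x = plug e y"
    "\<And>b y. sw_pair b y \<Longrightarrow> sw_pair (Node k p a b) (plug e y)" by blast
  from context_right.IH[OF e(1)] obtain e' z where e': "sw_pair s' z" "y = plug e' z"
    "\<And>s y. sw_pair s y \<Longrightarrow> sw_pair (c s) (plug e' y)" by blast
  obtain e'' where e'': "plug e (plug e' x) = plug e'' x" for x
    using plug_compose[of e e'] by blast
  show ?case
  proof (intro exI conjI allI impI)
    show "sw_pair s' z" by fact
    show "x = plug e'' z" by (simp add: e e' e'')
    show "sw_pair (Node k p a (c s)) (plug e'' y)" if "sw_pair s y" for s y
      using e(3)[OF e'(3)[OF that]] by (simp add: e'')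
  qed
qed

text \<open>Whether the class of the hole reaches the root or is detached, it is a single class
  \<open>\<rho> + r\<^sub>0\<close> of the whole switching. As \<open>switched\<close> does not
  record the root, a separate root class can join \<open>K\<close>.\<close>

lemma switched_context:
  assumes "tree_context c" "switched (c s') C'"
  obtains \<rho> N r\<^sub>0 K where "sw s' \<rho> N" "C' = add_mset (\<rho> + r\<^sub>0) (N + K)"
    "\<And>s \<rho> N. sw s \<rho> N \<Longrightarrow> switched (c s) (add_mset (\<rho> + r\<^sub>0) (N + K))"
proof -
  obtain r' M' where r': "sw (c s') r' M'" "C' = add_mset r' M'" using assms(2) by (auto simp: switched_def)
  then have "sw_pair (c s') (r', M')" by (simp add: sw_pair_def)
  from sw_context[OF assms(1) this] obtain f y where
    c: "sw_pair s' y" "(r', M') = plug f y" "\<And>s y. sw_pair s y \<Longrightarrow> sw_pair (c s) (plug f y)" by blast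
  obtain \<rho> N where y: "y = (\<rho>, N)" by (cases y)
  obtain e r\<^sub>0 K where c': "f = (e, r\<^sub>0, K)" by (cases f)
  show ?thesis
  proof (cases e)
    case None
    show ?thesis
    proof (rule that[of \<rho> N r\<^sub>0 K])
      show "switched (c s) (add_mset (\<rho> + r\<^sub>0) (N + K))" if "sw s \<rho> N" for s \<rho> N
        using c(3)[of s "(\<rho>, N)"] that None unfolding switched_def
        by (intro exI[of _ "\<rho> + r\<^sub>0"] exI[of _ "N + K"]) (auto simp: c' sw_pair_def)
    qed (use c(1,2) r' None in \<open>auto simp: y c' sw_pair_def\<close>)
  next
    case (Some r)
    show ?thesis
    proof (rule that[of \<rho> N r\<^sub>0 "add_mset r K"])
      show "switched (c s) (add_mset (\<rho> + r\<^sub>0) (N + add_mset r K))" if "sw s \<rho> N" for s \<rho> N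
        using c(3)[of s "(\<rho>, N)"] that Some unfolding switched_def
        by (intro exI[of _ r] exI[of _ "add_mset (\<rho> + r\<^sub>0) (N + K)"]) (auto simp: c' sw_pair_def)
    qed (use c(1,2) r' Some in \<open>auto simp: y c' sw_pair_def\<close>)
  qed
qed

lemma switched_replace:
  assumes "replace s s' t t'" "switched t' C'"
  obtains \<rho> N r\<^sub>0 K where "sw s' \<rho> N" "C' = add_mset (\<rho> + r\<^sub>0) (N + K)"
    "\<And>\<rho> N. sw s \<rho> N \<Longrightarrow> switched t (add_mset (\<rho> + r\<^sub>0) (N + K))"
proof -
  obtain c where "tree_context c" "t = c s" "t' = c s'" using replace_context[OF assms(1)] by blast
  with assms(2) show ?thesis using switched_context[of c s' C'] that by metis
qed

section \<open>Correct forests\<close>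

abbreviation forest_leaves :: "'a tree list \<Rightarrow> 'a multiset" where
  "forest_leaves ts \<equiv> sum_list (map (\<lambda>t. mset (leaves t)) ts)"

abbreviation forest_nodes :: "'a tree list \<Rightarrow> 'a multiset" where
  "forest_nodes ts \<equiv> sum_list (map nodes ts)"

abbreviation vertices :: "'a list multiset \<Rightarrow> 'a multiset multiset" where
  "vertices D \<equiv> image_mset mset D"

text \<open>The trees \<open>ts\<close> stand above the conclusions and \<open>D\<close> holds the
  output lists of the daimons. Since the leaves form a simple multiset, the equation makes the
  daimons disjoint and free of repetitions and puts every leaf on one of them.\<close>

definition wf_forest :: "'a tree list \<Rightarrow> 'a list multiset \<Rightarrow> bool" where
  "wf_forest ts D \<longleftrightarrow> simple (forest_nodes ts) \<and> \<Sum>\<^sub># (vertices D) = forest_leaves ts"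

text \<open>The Danos-Regnier criterion after shrinking what lies below the daimons: the vertices
  are the daimons and the classes of leaves above a conclusion of the switching, and each leaf is
  the edge between its daimon and its class.\<close>

definition correct :: "'a tree list \<Rightarrow> 'a list multiset \<Rightarrow> bool" where
  "correct ts D \<longleftrightarrow> (\<forall>Cs. list_all2 switched ts Cs \<longrightarrow> tree_graph (vertices D + sum_list Cs))"

lemma forest_nodes_leaves: "forest_nodes ts = sum_list (map inner ts) + forest_leaves ts"
  by (induction ts) (auto simp: nodes_def)

lemma wf_forest_simple: "wf_forest ts D \<Longrightarrow> simple (forest_leaves ts)"
  by (simp add: wf_forest_def forest_nodes_leaves simple_union)

lemma forest_switched_union: "list_all2 switched ts Cs \<Longrightarrow> \<Sum>\<^sub># (sum_list Cs) = forest_leaves ts"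
  by (induction rule: list_all2_induct) (auto simp: switched_union)

lemma forest_switched_size:
  "list_all2 switched ts Cs \<Longrightarrow> size (sum_list Cs) = sum_list (map pars ts) + length ts"
  by (induction rule: list_all2_induct) (auto simp: switched_size)

lemma size_forest_leaves:
  "size (forest_leaves ts) = sum_list (map pars ts) + sum_list (map tensors ts) + length ts"
  by (induction ts) (auto simp: length_leaves)

lemma switched_exists: "\<exists>C. switched t C"
  using sw_exists unfolding switched_def by blast

section \<open>Existence of a link that a daimon can absorb\<close>

fun leaf_set :: "'a tree \<Rightarrow> 'a multiset" where
  "leaf_set (Leaf x) = {#x#}"
| "leaf_set (Node k p a b) = {#}"

text \<open>Only leaves that are immediate premises of a tensor, not all leaves above one.\<close>

fun tensor_leaves :: "'a tree \<Rightarrow> 'a multiset" where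
  "tensor_leaves (Leaf x) = {#}"
| "tensor_leaves (Node k p a b) =
     (if k then {#} else leaf_set a + leaf_set b) + tensor_leaves a + tensor_leaves b"

text \<open>Strengthened for the induction: a leaf is counted at its parent, so
  \<open>leaf_set t\<close> reserves room for a root that is itself a leaf.\<close>

lemma leaf_set_tensor_leaves: "leaf_set t + tensor_leaves t \<subseteq># mset (leaves t)"
proof (induction t)
  case (Node k p a b)
  have "tensor_leaves (Node k p a b) \<subseteq># (leaf_set a + tensor_leaves a) + (leaf_set b + tensor_leaves b)"
    by (auto simp: ac_simps subset_mset.add_increasing2 subset_mset.add_increasing)
  also have "\<dots> \<subseteq># mset (leaves a) + mset (leaves b)"
    using Node.IH by (rule subset_mset.add_mono)
  finally show ?case by simp
qed simp

lemma tensor_leaves_subset: "tensor_leaves t \<subseteq># mset (leaves t)"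
  using leaf_set_tensor_leaves[of t] by (meson mset_subset_eq_add_right subset_mset.order_trans)

text \<open>By the hypothesis each tensor has at most one initial premise.\<close>

lemma size_tensor_leaves:
  assumes "\<And>p x y. \<not> subtree (Node False p (Leaf x) (Leaf y)) t"
  shows "size (tensor_leaves t) \<le> tensors t"
  using assms
proof (induction t)
  case (Node k p a b)
  have "size (leaf_set a + leaf_set b) \<le> 1" if "\<not> k"
    using Node.prems that by (cases a; cases b) auto
  moreover have "size (tensor_leaves a) \<le> tensors a" "size (tensor_leaves b) \<le> tensors b"
    using Node by auto
  ultimately show ?case by auto
qed simp

text \<open>The hypothesis says that \<open>t\<close> is not a leaf; a node with no node above it
  then has two leaves as premises.\<close>

lemma subtree_leaf_pair:
  assumes "\<not> subtree t (Leaf (root t))"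
  shows "\<exists>k p x y. subtree (Node k p (Leaf x) (Leaf y)) t"
  using assms
proof (induction t)
  case (Node k p a b)
  then show ?case by (cases a; cases b) (auto; blast)+
qed simp

text \<open>At each par, detach a premise that is a leaf in \<open>d\<close>, if there is one; by
  hypothesis there is at most one. The last conjunct is the invariant: a root class meets
  \<open>d\<close> only if the tree is itself such a leaf. Hence classes joined by a tensor, and the
  class kept at a par, avoid \<open>d\<close>.\<close>

lemma isolating_switching:
  assumes "\<And>p x y. subtree (Node True p (Leaf x) (Leaf y)) t \<Longrightarrow> x \<notin> d \<or> y \<notin> d"
    "\<And>x. x \<in># tensor_leaves t \<Longrightarrow> x \<notin> d"
  shows "\<exists>r M. sw t r M \<and> (\<forall>c\<in>#add_mset r M. \<forall>x\<in>#c. x \<in> d \<longrightarrow> c = {#x#}) \<and>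
    ((\<exists>x. t = Leaf x \<and> x \<in> d) \<or> set_mset r \<inter> d = {})" (is "?Q t")
  using assms
proof (induction t)
  case (Leaf x)
  show ?case by (intro exI[of _ "{#x#}"] exI[of _ "{#}"]) (auto intro: sw.intros)
next
  case (Node k p a b)
  have pa: "x \<notin> d \<or> y \<notin> d" if "subtree (Node True p (Leaf x) (Leaf y)) a" for p x y
    using that Node.prems(1) by auto
  have pb: "x \<notin> d \<or> y \<notin> d" if "subtree (Node True p (Leaf x) (Leaf y)) b" for p x y
    using that Node.prems(1) by auto
  have "?Q a" by (rule Node.IH(1)) (use pa Node.prems(2) in auto)
  have "?Q b" by (rule Node.IH(2)) (use pb Node.prems(2) in auto)
  obtain r M where a: "sw a r M" "\<And>c x. c \<in># add_mset r M \<Longrightarrow> x \<in># c \<Longrightarrow> x \<in> d \<Longrightarrow> c = {#x#}"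
    "(\<exists>x. a = Leaf x \<and> x \<in> d) \<or> set_mset r \<inter> d = {}"
    using \<open>?Q a\<close> by blast
  obtain s N where b: "sw b s N" "\<And>c x. c \<in># add_mset s N \<Longrightarrow> x \<in># c \<Longrightarrow> x \<in> d \<Longrightarrow> c = {#x#}"
    "(\<exists>x. b = Leaf x \<and> x \<in> d) \<or> set_mset s \<inter> d = {}"
    using \<open>?Q b\<close> by blast
  show ?case
  proof (cases k)
    case False
    then have "set_mset r \<inter> d = {}" "set_mset s \<inter> d = {}"
      using Node.prems(2) a(3) b(3) by auto
    with False a b show ?thesis
      by (intro exI[of _ "r + s"] exI[of _ "M + N"]) (auto intro!: sw.intros)
  next
    case True
    show ?thesis
    proof (cases "\<exists>x. a = Leaf x \<and> x \<in> d")
      case True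
      then have "set_mset s \<inter> d = {}"
        using Node.prems(1) b(3) \<open>k\<close> by auto
      with \<open>k\<close> a b show ?thesis
        by (intro exI[of _ s] exI[of _ "add_mset r (M + N)"]) (auto intro!: sw.sw_right)
    next
      case False
      then have "set_mset r \<inter> d = {}" using a(3) by auto
      with \<open>k\<close> a b show ?thesis
        by (intro exI[of _ r] exI[of _ "add_mset s (M + N)"]) (auto intro!: sw.sw_left)
    qed
  qed
qed

lemma in_sum_list: "x \<in># sum_list Ms \<longleftrightarrow> (\<exists>M\<in>set Ms. x \<in># M)"
  by (induction Ms) auto

lemma list_all2_conj_right:
  "list_all2 (\<lambda>x y. P x y \<and> Q y) xs ys \<longleftrightarrow> list_all2 P xs ys \<and> (\<forall>y\<in>set ys. Q y)"
  by (induction xs ys rule: list_induct2') auto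

lemma list_all2_exists:
  assumes "\<And>x. x \<in> set xs \<Longrightarrow> \<exists>y. P x y"
  shows "\<exists>ys. list_all2 P xs ys"
proof -
  obtain f where "\<forall>x\<in>set xs. P x (f x)" using assms by metis
  then have "list_all2 P xs (map f xs)" by (simp add: list_all2_map2 list_all2_same)
  then show ?thesis by blast
qed

lemma filter_simple:
  assumes "simple M" "N \<subseteq># M"
  shows "filter_mset (\<lambda>x. x \<in># N) M = N"
proof (rule multiset_eqI)
  fix x
  have le: "count N x \<le> count M x" "count M x \<le> 1"
    using assms by (auto simp: simple_def mset_subset_eq_count)
  show "count (filter_mset (\<lambda>x. x \<in># N) M) x = count N x"
  proof (cases "x \<in># N")
    case True
    then have "count N x \<ge> 1" by simp
    with le have "count M x = count N x" by linarith
    with True show ?thesis by simp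
  next
    case False
    then show ?thesis by (simp add: count_eq_zero_iff)
  qed
qed

text \<open>A correct forest has one daimon more than tensors. If no tensor has two initial premises, some
  daimon is thus above no tensor, and switching away its pars isolates it.\<close>

lemma correct_contractible:
  assumes wf: "wf_forest ts D" and cor: "correct ts D" and ne: "\<not> (\<forall>t\<in>set ts. \<exists>x. t = Leaf x)"
  shows "\<exists>t\<in>set ts. \<exists>k p x y. subtree (Node k p (Leaf x) (Leaf y)) t \<and>
    (k \<longrightarrow> (\<exists>d\<in>#D. x \<in> set d \<and> y \<in> set d))"
proof (rule ccontr)
  assume "\<not> ?thesis"
  then have ten: "\<And>t p x y. t \<in> set ts \<Longrightarrow> \<not> subtree (Node False p (Leaf x) (Leaf y)) t"
    and par: "\<And>t p x y d. t \<in> set ts \<Longrightarrow> subtree (Node True p (Leaf x) (Leaf y)) t \<Longrightarrow> d \<in># D \<Longrightarrow>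
      x \<notin> set d \<or> y \<notin> set d" by blast+
  note D = wf[unfolded wf_forest_def, THEN conjunct2]
  define B where "B = sum_list (map tensor_leaves ts)"
  have B_sub: "B \<subseteq># forest_leaves ts"
    unfolding B_def by (induction ts) (auto intro: subset_mset.add_mono tensor_leaves_subset)
  have B_size: "size B \<le> sum_list (map tensors ts)"
    using ten unfolding B_def
    by (induction ts) (auto intro!: add_mono size_tensor_leaves)
  obtain Cs where Cs: "list_all2 switched ts Cs"
    using list_all2_exists[of ts switched] switched_exists by blast
  then have "tree_graph (vertices D + sum_list Cs)" using cor by (simp add: correct_def)
  then have "2 * size (vertices D + sum_list Cs) = size (\<Sum>\<^sub># (vertices D + sum_list Cs)) + 2"
    by (simp only: tree_graph_def)
  then have "2 * (size D + size (sum_list Cs)) = 2 * size (forest_leaves ts) + 2"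
    unfolding sum_mset.union D forest_switched_union[OF Cs] size_union size_image_mset by simp
  \<comment> \<open>There are as many classes as pars and conclusions together, and as many leaves
    as pars, tensors and conclusions together; all but the tensors cancels.\<close>
  then have "size D = sum_list (map tensors ts) + 1"
    unfolding forest_switched_size[OF Cs] size_forest_leaves by simp
  with B_size have size: "size B < size D" by simp
  \<comment> \<open>Pigeonhole: the daimons partition the leaves, so if each contained a member of
    \<open>B\<close>, there would be at most \<open>size B\<close> of them.\<close>
  have "\<exists>d\<in>#D. \<forall>x\<in>set d. x \<notin># B"
  proof (rule ccontr)
    assume *: "\<not> ?thesis"
    have "size D \<le> (\<Sum>d\<in>#D. size (filter_mset (\<lambda>x. x \<in># B) (mset d)))"
      using *
    proof (induction D)
      case (add d D)
      then obtain x where "x \<in># filter_mset (\<lambda>x. x \<in># B) (mset d)" by auto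
      then have "size (filter_mset (\<lambda>x. x \<in># B) (mset d)) \<noteq> 0"
        unfolding size_eq_0_iff_empty by (metis empty_iff set_mset_empty)
      moreover have "size D \<le> (\<Sum>d\<in>#D. size (filter_mset (\<lambda>x. x \<in># B) (mset d)))"
        by (rule add.IH) (use add.prems in auto)
      ultimately show ?case unfolding size_add_mset image_mset_add_mset sum_mset.add_mset by linarith
    qed simp
    also have "\<dots> = size (filter_mset (\<lambda>x. x \<in># B) (\<Sum>\<^sub># (vertices D)))"
      by (induction D) auto
    also have "\<dots> = size B"
      by (simp add: D filter_simple[OF wf_forest_simple[OF wf] B_sub])
    finally show False using size by simp
  qed
  then obtain d where d: "d \<in># D" "\<And>x. x \<in> set d \<Longrightarrow> x \<notin># B" by blast
  obtain D' where D': "D = add_mset d D'" using d(1) by (meson mset_add)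
  have "\<exists>C. switched t C \<and> (\<forall>c\<in>#C. \<forall>x\<in>#c. x \<in> set d \<longrightarrow> c = {#x#})" if "t \<in> set ts" for t
  proof -
    have "x \<notin> set d" if "x \<in># tensor_leaves t" for x
      using that \<open>t \<in> set ts\<close> d(2) unfolding B_def by (auto simp: in_sum_list)
    then show ?thesis
      using isolating_switching[of t "set d"] par[OF \<open>t \<in> set ts\<close> _ d(1)] unfolding switched_def by blast
  qed
  then obtain Cs where "list_all2 (\<lambda>t C. switched t C \<and> (\<forall>c\<in>#C. \<forall>x\<in>#c. x \<in> set d \<longrightarrow> c = {#x#})) ts Cs"
    using list_all2_exists[of ts "\<lambda>t C. switched t C \<and> (\<forall>c\<in>#C. \<forall>x\<in>#c. x \<in> set d \<longrightarrow> c = {#x#})"]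
    by blast
  then have Cs: "list_all2 switched ts Cs"
    and "\<forall>C\<in>set Cs. \<forall>c\<in>#C. \<forall>x\<in>#c. x \<in> set d \<longrightarrow> c = {#x#}"
    by (auto simp: list_all2_conj_right)
  then have iso: "\<And>c x. c \<in># sum_list Cs \<Longrightarrow> x \<in># c \<Longrightarrow> x \<in> set d \<Longrightarrow> c = {#x#}"
    unfolding in_sum_list by blast
  \<comment> \<open>By isolation the classes meeting \<open>d\<close> are singletons inside
    \<open>d\<close>, so \<open>d\<close> together with \<open>C1\<close> shares no edge with the
    remaining vertices.\<close>
  define C1 where "C1 = filter_mset (\<lambda>c. \<exists>x\<in>#c. x \<in> set d) (sum_list Cs)"
  define C2 where "C2 = filter_mset (\<lambda>c. \<not> (\<exists>x\<in>#c. x \<in> set d)) (sum_list Cs)"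
  have C: "sum_list Cs = C1 + C2" unfolding C1_def C2_def by (rule multiset_partition)
  have C1: "x \<in> set d" if "x \<in># \<Sum>\<^sub># C1" for x
    using that iso unfolding C1_def by fastforce
  have C2: "x \<notin> set d" if "x \<in># \<Sum>\<^sub># C2" for x
    using that unfolding C2_def by fastforce
  have "connected_graph (add_mset (mset d) (C1 + (vertices D' + C2)))"
    using cor Cs by (auto simp: correct_def tree_graph_def D' C ac_simps)
  \<comment> \<open>Otherwise \<open>d\<close> contains all leaves, and a node with two leaves as
    premises is one of the links assumed absent.\<close>
  moreover have "vertices D' + C2 \<noteq> {#}"
  proof
    assume "vertices D' + C2 = {#}"
    then have "forest_leaves ts = \<Sum>\<^sub># C1"
      using forest_switched_union[OF Cs] by (simp add: C)
    with C1 have all: "x \<in> set d" if "x \<in># forest_leaves ts" for x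
      using that by simp
    from ne obtain t where t: "t \<in> set ts" "\<nexists>x. t = Leaf x" by auto
    then obtain k p x y where s: "subtree (Node k p (Leaf x) (Leaf y)) t"
      using subtree_leaf_pair by (metis subtree.simps(1))
    then have "x \<in> set (leaves t)" "y \<in> set (leaves t)"
      by (induction t) auto
    then have "x \<in> set d" "y \<in> set d"
      using t(1) all by (auto simp: in_sum_list)
    then show False using s ten[OF t(1)] par[OF t(1) _ d(1)] by (cases k) auto
  qed
  ultimately obtain x where "x \<in># mset d + \<Sum>\<^sub># C1" "x \<in># \<Sum>\<^sub># (vertices D' + C2)"
    by (rule connected_graph_addD)
  then have "x \<in> set d" "x \<in># \<Sum>\<^sub># (vertices D')"
    using C1[of x] C2[of x] unfolding sum_mset.union union_iff set_mset_mset by blast+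
  moreover have "simple (mset d + \<Sum>\<^sub># (vertices D'))"
    using wf_forest_simple[OF wf] unfolding D[symmetric] D' by simp
  ultimately show False by (auto simp: simple_union)
qed

section \<open>Correctness of daimons, pars and tensors\<close>

definition forest_switched :: "'a tree list \<Rightarrow> 'a multiset multiset \<Rightarrow> bool" where
  "forest_switched ts C \<longleftrightarrow> (\<exists>Cs. list_all2 switched ts Cs \<and> C = sum_list Cs)"

lemma correct_iff: "correct ts D \<longleftrightarrow> (\<forall>C. forest_switched ts C \<longrightarrow> tree_graph (vertices D + C))"
  unfolding correct_def forest_switched_def by blast

lemma forest_switched_Nil [simp]: "forest_switched [] C \<longleftrightarrow> C = {#}"
  by (simp add: forest_switched_def)

lemma forest_switched_Cons:
  "forest_switched (t # ts) C \<longleftrightarrow> (\<exists>A B. switched t A \<and> forest_switched ts B \<and> C = A + B)"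
  unfolding forest_switched_def list_all2_Cons1 by force

lemma forest_switched_append:
  "forest_switched (ts @ us) C \<longleftrightarrow> (\<exists>A B. forest_switched ts A \<and> forest_switched us B \<and> C = A + B)"
proof (induction ts arbitrary: C)
  case (Cons t ts)
  have "forest_switched ((t # ts) @ us) C \<longleftrightarrow>
      (\<exists>X A B. switched t X \<and> forest_switched ts A \<and> forest_switched us B \<and> C = X + (A + B))"
    by (simp add: forest_switched_Cons Cons.IH) blast
  also have "\<dots> \<longleftrightarrow> (\<exists>A B. forest_switched (t # ts) A \<and> forest_switched us B \<and> C = A + B)"
    by (simp add: forest_switched_Cons) (metis add.assoc)
  finally show ?case .
qed simp

lemma forest_switched_labels: "forest_switched ts C \<Longrightarrow> \<Sum>\<^sub># C = forest_leaves ts"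
  using forest_switched_union unfolding forest_switched_def by blast

lemma forest_switched_exists: "\<exists>C. forest_switched ts C"
  using list_all2_exists[of ts switched] switched_exists unfolding forest_switched_def by blast

lemma switched_Leaf [simp]: "switched (Leaf x) C \<longleftrightarrow> C = {#{#x#}#}"
  unfolding switched_def by (auto elim: sw_LeafE intro: sw.intros)

text \<open>Whichever premise is detached, the root classes of \<open>a\<close> and \<open>b\<close>
  survive as separate classes; the choice only decides which of them is the root class. Hence a par
  adds no graph to those of its premises.\<close>

lemma switched_Par:
  assumes "switched (Node True p a b) C"
  obtains A B where "switched a A" "switched b B" "C = A + B"
proof -
  from assms obtain r M where "sw (Node True p a b) r M" and C: "C = add_mset r M"
    by (auto simp: switched_def)
  then show ?thesis
  proof cases
    case (sw_left M' s N)
    then show ?thesis using that[of "add_mset r M'" "add_mset s N"] C by (auto simp: switched_def)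
  next
    case (sw_right r' M' N)
    then show ?thesis using that[of "add_mset r' M'" "add_mset r N"] C by (auto simp: switched_def)
  qed auto
qed

lemma switched_Tensor:
  assumes "switched (Node False p a b) C"
  obtains r M s N where "switched a (add_mset r M)" "switched b (add_mset s N)"
    "C = add_mset (r + s) (M + N)"
proof -
  from assms obtain r M where "sw (Node False p a b) r M" and C: "C = add_mset r M"
    by (auto simp: switched_def)
  then show ?thesis
  proof cases
    case (sw_tensor r' M' s N)
    then show ?thesis using that[of r' M' s N] C by (auto simp: switched_def)
  qed auto
qed

text \<open>The graph of a single daimon is a star; contracting an edge absorbs a singleton class
  into the centre.\<close>

lemma tree_graph_star: "tree_graph (add_mset (mset ps) {#{#x#}. x \<in># mset ps#})" if "distinct ps"
  using that
proof (induction ps)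
  case (Cons x ps)
  then show ?case
    using tree_graph_contract[of x "mset ps" "{#}" "{#{#x#}. x \<in># mset ps#}"]
    by (auto simp: add_mset_commute)
qed (simp add: tree_graph_single)

lemma forest_switched_leaves:
  "forest_switched (map Leaf ps) C \<longleftrightarrow> C = {#{#x#}. x \<in># mset ps#}"
  by (induction ps arbitrary: C) (auto simp: forest_switched_Cons)

lemma correct_daimon: "distinct ps \<Longrightarrow> correct (map Leaf ps) {#ps#}"
  unfolding correct_iff forest_switched_leaves by (simp add: tree_graph_star)

lemma correct_par:
  assumes "correct (ts @ [a, b]) D"
  shows "correct (ts @ [Node True p a b]) D"
  unfolding correct_iff
proof (intro allI impI)
  fix C assume "forest_switched (ts @ [Node True p a b]) C"
  then obtain A B X where "forest_switched ts X" "switched a A" "switched b B" "C = X + (A + B)"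
    by (auto simp: forest_switched_append forest_switched_Cons elim: switched_Par)
  then have "forest_switched (ts @ [a, b]) C"
    by (auto simp: forest_switched_append forest_switched_Cons)
  with assms show "tree_graph (vertices D + C)" by (simp add: correct_iff)
qed

text \<open>A switching of the tensor merges the root classes \<open>r\<close> and \<open>s\<close>
  of its premises, so its graph consists of two trees glued at these vertices.\<close>

lemma correct_tensor:
  assumes "correct (ts @ [a]) D" "correct (us @ [b]) E"
  shows "correct (ts @ us @ [Node False p a b]) (D + E)"
  unfolding correct_iff
proof (intro allI impI)
  fix C assume "forest_switched (ts @ us @ [Node False p a b]) C"
  then obtain X Y Z where XY: "forest_switched ts X" "forest_switched us Y"
    "switched (Node False p a b) Z" "C = X + (Y + Z)"
    by (auto simp: forest_switched_append forest_switched_Cons)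
  from XY(3) obtain r M s N where rs: "switched a (add_mset r M)" "switched b (add_mset s N)"
    "Z = add_mset (r + s) (M + N)" by (rule switched_Tensor)
  have "forest_switched (ts @ [a]) (X + add_mset r M)" "forest_switched (us @ [b]) (Y + add_mset s N)"
    using XY rs by (auto simp: forest_switched_append forest_switched_Cons)
  then have "tree_graph (vertices D + (X + add_mset r M))" "tree_graph (vertices E + (Y + add_mset s N))"
    using assms[unfolded correct_iff] by blast+
  then have "tree_graph (add_mset (r + s) ((vertices D + X + M) + (vertices E + Y + N)))"
    by (intro tree_graph_join) (simp_all add: ac_simps)
  then show "tree_graph (vertices (D + E) + C)" by (simp add: XY rs ac_simps)
qed

lemma correct_mset:
  assumes "mset ts = mset us" "correct ts D"
  shows "correct us D"
proof -
  have "\<exists>Bs. list_all2 switched ts Bs \<and> mset Bs = mset Cs" if "list_all2 switched us Cs" for Cs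
    using list_all2_reorder_left_invariance[OF that assms(1)] by metis
  then show ?thesis using assms(2) unfolding correct_def by (metis sum_mset_sum_list)
qed

section \<open>Contracting a link with initial premises\<close>

lemma count_vertices:
  assumes "wf_forest ts D" "forest_switched ts C"
  shows "\<Sum>\<^sub># (vertices D + C) = forest_leaves ts + forest_leaves ts"
    "count (\<Sum>\<^sub># (vertices D + C)) x \<le> 2"
proof -
  \<comment> \<open>Each leaf is an edge with one end at its daimon and the other at its
    class.\<close>
  show *: "\<Sum>\<^sub># (vertices D + C) = forest_leaves ts + forest_leaves ts"
    using assms forest_switched_labels by (simp add: wf_forest_def)
  have "count (forest_leaves ts) x \<le> 1"
    using wf_forest_simple[OF assms(1)] by (simp add: simple_def)
  then show "count (\<Sum>\<^sub># (vertices D + C)) x \<le> 2" unfolding * count_union by linarith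
qed

text \<open>Contracting \<open>x\<close> and \<open>y\<close> on one side and \<open>p\<close> on
  the other produces the same vertex \<open>e\<^sub>1 + e\<^sub>2 + r\<close>. This is the
  absorption of a tensor, which merges the two daimons above it.\<close>

lemma tree_graph_contract_tensor:
  assumes "x \<notin># e\<^sub>1 + e\<^sub>2 + r + \<Sum>\<^sub># H" "y \<notin># e\<^sub>1 + e\<^sub>2 + r + \<Sum>\<^sub># H" "x \<noteq> y" "p \<notin># e\<^sub>1 + e\<^sub>2 + r + \<Sum>\<^sub># H"
  shows "tree_graph ({#add_mset x e\<^sub>1, add_mset y e\<^sub>2, add_mset x (add_mset y r)#} + H) \<longleftrightarrow>
    tree_graph ({#add_mset p (e\<^sub>1 + e\<^sub>2), add_mset p r#} + H)"
proof -
  have "tree_graph ({#add_mset x e\<^sub>1, add_mset y e\<^sub>2, add_mset x (add_mset y r)#} + H) \<longleftrightarrow>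
      tree_graph (add_mset (add_mset x e\<^sub>1) (add_mset (add_mset x (add_mset y r)) (add_mset (add_mset y e\<^sub>2) H)))"
    by (simp add: add_mset_commute)
  also have "\<dots> \<longleftrightarrow> tree_graph (add_mset (e\<^sub>1 + add_mset y r) (add_mset (add_mset y e\<^sub>2) H))"
    by (rule tree_graph_contract) (use assms in simp)
  also have "\<dots> \<longleftrightarrow> tree_graph (add_mset (add_mset y (e\<^sub>1 + r)) (add_mset (add_mset y e\<^sub>2) H))"
    by simp
  also have "\<dots> \<longleftrightarrow> tree_graph (add_mset ((e\<^sub>1 + r) + e\<^sub>2) H)"
    by (rule tree_graph_contract) (use assms in simp)
  also have "\<dots> \<longleftrightarrow> tree_graph (add_mset ((e\<^sub>1 + e\<^sub>2) + r) H)"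
    by (simp add: ac_simps)
  also have "\<dots> \<longleftrightarrow> tree_graph (add_mset (add_mset p (e\<^sub>1 + e\<^sub>2)) (add_mset (add_mset p r) H))"
    by (rule tree_graph_contract[symmetric]) (use assms in simp)
  finally show ?thesis by simp
qed

text \<open>With \<open>y\<close> detached, \<open>{#y#}\<close> is a pendant vertex at the daimon.
  Contracting \<open>y\<close> and then \<open>x\<close> leaves the vertex that contracting
  \<open>p\<close> leaves on the other side.\<close>

lemma tree_graph_contract_par:
  assumes "x \<notin># e + r + \<Sum>\<^sub># H" "y \<notin># e + r + \<Sum>\<^sub># H" "x \<noteq> y" "p \<notin># e + r + \<Sum>\<^sub># H"
  shows "tree_graph ({#add_mset x (add_mset y e), {#y#}, add_mset x r#} + H) \<longleftrightarrow>
    tree_graph ({#add_mset p e, add_mset p r#} + H)"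
proof -
  have "tree_graph ({#add_mset x (add_mset y e), {#y#}, add_mset x r#} + H) \<longleftrightarrow>
      tree_graph (add_mset (add_mset y (add_mset x e)) (add_mset (add_mset y {#}) (add_mset (add_mset x r) H)))"
    by (simp add: add_mset_commute)
  also have "\<dots> \<longleftrightarrow> tree_graph (add_mset (add_mset x e + {#}) (add_mset (add_mset x r) H))"
    by (rule tree_graph_contract) (use assms in simp)
  also have "\<dots> \<longleftrightarrow> tree_graph (add_mset (add_mset x e) (add_mset (add_mset x r) H))"
    by simp
  also have "\<dots> \<longleftrightarrow> tree_graph (add_mset (e + r) H)"
    by (rule tree_graph_contract) (use assms in simp)
  also have "\<dots> \<longleftrightarrow> tree_graph (add_mset (add_mset p e) (add_mset (add_mset p r) H))"
    by (rule tree_graph_contract[symmetric]) (use assms in simp)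
  finally show ?thesis by simp
qed

text \<open>The output of a link is no leaf, so it can serve as a fresh edge when a contraction is
  run backwards to create \<open>p\<close>.\<close>

lemma not_in_nodes:
  assumes "wf_forest ts D" "forest_switched ts C" "p \<in># sum_list (map inner ts)"
  shows "p \<notin># \<Sum>\<^sub># (vertices D + C)"
  using assms(1,3) unfolding count_vertices(1)[OF assms(1,2)] wf_forest_def forest_nodes_leaves
  by (auto simp: simple_union)

text \<open>Every switching of the smaller forest lifts to one whose class has \<open>x\<close> and
  \<open>y\<close> in place of \<open>p\<close>, so the two graphs are related by
  \<open>tree_graph_contract_tensor\<close>. The order of outputs of the merged daimon
  \<open>d\<close> is left open for the later derivation.\<close>

lemma contract_tensor:
  assumes wf: "wf_forest (us @ t # vs) D" and cor: "correct (us @ t # vs) D"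
    and rep: "replace (Node False p (Leaf x) (Leaf y)) (Leaf p) t t'"
  obtains d\<^sub>1 e\<^sub>1 d\<^sub>2 e\<^sub>2 D' where "D = {#d\<^sub>1, d\<^sub>2#} + D'" "mset d\<^sub>1 = add_mset x e\<^sub>1" "mset d\<^sub>2 = add_mset y e\<^sub>2"
    "\<And>d. mset d = add_mset p (e\<^sub>1 + e\<^sub>2) \<Longrightarrow>
      wf_forest (us @ t' # vs) (add_mset d D') \<and> correct (us @ t' # vs) (add_mset d D')"
proof -
  define ts where "ts = us @ t # vs"
  define X where "X = forest_leaves us + forest_leaves vs"
  obtain K L where KL: "inner t = add_mset p K" "inner t' = K"
    "mset (leaves t) = add_mset x (add_mset y L)" "mset (leaves t') = add_mset p L"
    using replace_inner_leaves[OF rep] by auto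
  note D = wf[unfolded wf_forest_def, THEN conjunct2]
  have xy: "x \<noteq> y" using wf_forest_simple[OF wf] by (auto simp: KL simple_union)
  have sws: "\<exists>r K Y. C' = add_mset (add_mset p r) (K + Y) \<and>
      forest_switched (us @ t # vs) (add_mset (add_mset x (add_mset y r)) (K + Y))"
    if C': "forest_switched (us @ t' # vs) C'" for C'
  proof -
    from C' obtain A B Z where Z: "forest_switched us A" "switched t' Z" "forest_switched vs B" "C' = A + (Z + B)"
      by (auto simp: forest_switched_append forest_switched_Cons)
    obtain \<rho> N r K where "sw (Leaf p) \<rho> N" "Z = add_mset (\<rho> + r) (N + K)"
      and *: "\<And>\<rho> N. sw (Node False p (Leaf x) (Leaf y)) \<rho> N \<Longrightarrow> switched t (add_mset (\<rho> + r) (N + K))"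
      using switched_replace[OF rep Z(2)] by metis
    then have "Z = add_mset (add_mset p r) K" by (auto elim: sw_LeafE)
    moreover have "switched t (add_mset ({#x#} + {#y#} + r) ({#} + {#} + K))"
      by (intro * sw.intros)
    then have "switched t (add_mset (add_mset x (add_mset y r)) K)" by (simp add: add_mset_commute)
    then have "forest_switched (us @ t # vs) (A + (add_mset (add_mset x (add_mset y r)) K + B))"
      unfolding forest_switched_append forest_switched_Cons using Z by blast
    ultimately show ?thesis
      by (intro exI[of _ r] exI[of _ K] exI[of _ "A + B"]) (simp add: Z ac_simps)
  qed
  have "x \<in># \<Sum>\<^sub># (vertices D)" "y \<in># \<Sum>\<^sub># (vertices D)"
    unfolding D by (simp_all add: KL)
  then obtain d\<^sub>1 d\<^sub>2 where d: "d\<^sub>1 \<in># D" "x \<in> set d\<^sub>1" "d\<^sub>2 \<in># D" "y \<in> set d\<^sub>2" by auto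
  obtain C' where "forest_switched (us @ t' # vs) C'" using forest_switched_exists by blast
  from sws[OF this] obtain r K' Y where
    fs: "forest_switched (us @ t # vs) (add_mset (add_mset x (add_mset y r)) (K' + Y))" by blast
  have "d\<^sub>1 \<noteq> d\<^sub>2"
  proof
    assume "d\<^sub>1 = d\<^sub>2"
    obtain D0 where D0: "D = add_mset d\<^sub>1 D0" using d(1) by (meson mset_add)
    obtain e where e: "mset d\<^sub>1 = add_mset x (add_mset y e)"
      using d \<open>d\<^sub>1 = d\<^sub>2\<close> xy by (metis insert_noteq_member mset_add set_mset_mset)
    let ?H = "vertices D0 + (K' + Y)"
    have G: "vertices D + add_mset (add_mset x (add_mset y r)) (K' + Y) =
        add_mset (add_mset x (add_mset y e)) (add_mset (add_mset x (add_mset y r)) ?H)"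
      by (simp add: D0 e)
    note count = count_vertices(2)[OF wf fs, unfolded G]
    have x: "x \<notin># add_mset y e + add_mset y r + \<Sum>\<^sub># ?H"
      using count[of x] xy unfolding not_in_iff by simp
    \<comment> \<open>If one daimon held both premises, contracting \<open>x\<close> would turn
      \<open>y\<close> into a loop.\<close>
    have "tree_graph (add_mset (add_mset y e + add_mset y r) ?H)"
      using cor[unfolded correct_iff, rule_format, OF fs] unfolding G tree_graph_contract[OF x] .
    then have "tree_graph (add_mset (add_mset y (add_mset y (e + r))) ?H)" by simp
    moreover have "count (\<Sum>\<^sub># (add_mset (add_mset y (add_mset y (e + r))) ?H)) z \<le> 2" for z
      using count[of z] by (simp split: if_splits)
    ultimately show False by (rule tree_graph_no_loop)
  qed
  obtain D1 where D1: "D = add_mset d\<^sub>1 D1" using d(1) by (meson mset_add)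
  with d(3) \<open>d\<^sub>1 \<noteq> d\<^sub>2\<close> have "d\<^sub>2 \<in># D1" by auto
  then obtain D' where "D1 = add_mset d\<^sub>2 D'" by (meson mset_add)
  with D1 have D': "D = {#d\<^sub>1, d\<^sub>2#} + D'" by simp
  obtain e\<^sub>1 where e1: "mset d\<^sub>1 = add_mset x e\<^sub>1" using d by (metis mset_add set_mset_mset)
  obtain e\<^sub>2 where e2: "mset d\<^sub>2 = add_mset y e\<^sub>2" using d by (metis mset_add set_mset_mset)
  show ?thesis
  proof (rule that[OF D' e1 e2])
    fix d assume d: "mset d = add_mset p (e\<^sub>1 + e\<^sub>2)"
    have "wf_forest (us @ t' # vs) (add_mset d D')"
      using wf unfolding wf_forest_def forest_nodes_leaves
      by (auto simp: KL D' e1 e2 d simple_union ac_simps)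
    moreover have "correct (us @ t' # vs) (add_mset d D')"
      unfolding correct_iff
    proof (intro allI impI)
      fix C' assume "forest_switched (us @ t' # vs) C'"
      then obtain r K Y where C': "C' = add_mset (add_mset p r) (K + Y)" and
        fs: "forest_switched (us @ t # vs) (add_mset (add_mset x (add_mset y r)) (K + Y))"
        using sws by blast
      let ?H = "vertices D' + (K + Y)"
      have G: "vertices D + add_mset (add_mset x (add_mset y r)) (K + Y) =
        {#add_mset x e\<^sub>1, add_mset y e\<^sub>2, add_mset x (add_mset y r)#} + ?H"
        by (simp add: D' e1 e2)
      note count = count_vertices(2)[OF wf fs, unfolded G]
      have "x \<notin># e\<^sub>1 + e\<^sub>2 + r + \<Sum>\<^sub># ?H" "y \<notin># e\<^sub>1 + e\<^sub>2 + r + \<Sum>\<^sub># ?H"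
        using count[of x] count[of y] xy unfolding not_in_iff by simp_all
      moreover have "p \<notin># e\<^sub>1 + e\<^sub>2 + r + \<Sum>\<^sub># ?H"
        using not_in_nodes[OF wf fs, of p, unfolded G] by (auto simp: KL)
      moreover have "tree_graph ({#add_mset x e\<^sub>1, add_mset y e\<^sub>2, add_mset x (add_mset y r)#} + ?H)"
        using cor[unfolded correct_iff, rule_format, OF fs] unfolding G .
      ultimately have "tree_graph ({#add_mset p (e\<^sub>1 + e\<^sub>2), add_mset p r#} + ?H)"
        using tree_graph_contract_tensor xy by metis
      then show "tree_graph (vertices (add_mset d D') + C')" by (simp add: C' d add_mset_commute)
    qed
    ultimately show "wf_forest (us @ t' # vs) (add_mset d D') \<and> correct (us @ t' # vs) (add_mset d D')" ..
  qed
qed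

lemma contract_par:
  assumes wf: "wf_forest (us @ t # vs) (add_mset d\<^sub>0 D)" and cor: "correct (us @ t # vs) (add_mset d\<^sub>0 D)"
    and rep: "replace (Node True p (Leaf x) (Leaf y)) (Leaf p) t t'"
    and d0: "mset d\<^sub>0 = add_mset x (add_mset y e)" and d: "mset d = add_mset p e"
  shows "wf_forest (us @ t' # vs) (add_mset d D) \<and> correct (us @ t' # vs) (add_mset d D)"
proof
  obtain K L where KL: "inner t = add_mset p K" "inner t' = K"
    "mset (leaves t) = add_mset x (add_mset y L)" "mset (leaves t') = add_mset p L"
    using replace_inner_leaves[OF rep] by auto
  have xy: "x \<noteq> y" using wf_forest_simple[OF wf] by (auto simp: KL simple_union)
  show "wf_forest (us @ t' # vs) (add_mset d D)"
    using wf unfolding wf_forest_def forest_nodes_leaves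
    by (auto simp: KL d0 d simple_union ac_simps)
  show "correct (us @ t' # vs) (add_mset d D)"
    unfolding correct_iff
  proof (intro allI impI)
    fix C' assume C': "forest_switched (us @ t' # vs) C'"
    then obtain A B Z where Z: "forest_switched us A" "switched t' Z" "forest_switched vs B" "C' = A + (Z + B)"
      by (auto simp: forest_switched_append forest_switched_Cons)
    obtain \<rho> N r K where "sw (Leaf p) \<rho> N" "Z = add_mset (\<rho> + r) (N + K)"
      and *: "\<And>\<rho> N. sw (Node True p (Leaf x) (Leaf y)) \<rho> N \<Longrightarrow> switched t (add_mset (\<rho> + r) (N + K))"
      using switched_replace[OF rep Z(2)] by metis
    then have Z': "Z = add_mset (add_mset p r) K" by (auto elim: sw_LeafE)
    \<comment> \<open>Each switching of the smaller forest has to be lifted in one way; the lift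
      keeps \<open>x\<close> and detaches \<open>y\<close>.\<close>
    have "switched t (add_mset ({#x#} + r) (add_mset {#y#} ({#} + {#}) + K))"
      by (intro * sw_left sw_leaf)
    then have "switched t (add_mset (add_mset x r) (add_mset {#y#} K))" by simp
    then have fs: "forest_switched (us @ t # vs) (A + (add_mset (add_mset x r) (add_mset {#y#} K) + B))"
      unfolding forest_switched_append forest_switched_Cons using Z by blast
    let ?H = "vertices D + (A + (K + B))"
    have G: "vertices (add_mset d\<^sub>0 D) + (A + (add_mset (add_mset x r) (add_mset {#y#} K) + B)) =
      {#add_mset x (add_mset y e), {#y#}, add_mset x r#} + ?H"
      by (simp add: d0 add_mset_commute)
    note count = count_vertices(2)[OF wf fs, unfolded G]
    have "x \<notin># e + r + \<Sum>\<^sub># ?H" "y \<notin># e + r + \<Sum>\<^sub># ?H"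
      using count[of x] count[of y] xy unfolding not_in_iff by simp_all
    moreover have "p \<notin># e + r + \<Sum>\<^sub># ?H"
      using not_in_nodes[OF wf fs, of p, unfolded G] by (auto simp: KL)
    moreover have "tree_graph ({#add_mset x (add_mset y e), {#y#}, add_mset x r#} + ?H)"
      using cor[unfolded correct_iff, rule_format, OF fs] unfolding G .
    ultimately have "tree_graph ({#add_mset p e, add_mset p r#} + ?H)"
      using tree_graph_contract_par xy by metis
    then show "tree_graph (vertices (add_mset d D) + C')" by (simp add: Z Z' d add_mset_commute)
  qed
qed

section \<open>Cut-free nets as forests\<close>

definition targets :: "link multiset \<Rightarrow> pos multiset" where
  "targets L = \<Sum>\<^sub># (image_mset (\<lambda>l. mset (target l)) L)"

definition sources :: "link multiset \<Rightarrow> pos multiset" where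
  "sources L = \<Sum>\<^sub># (image_mset (\<lambda>l. mset (source l)) L)"

lemma targets_simps [simp]:
  "targets {#} = {#}" "targets (add_mset l L) = mset (target l) + targets L"
  "targets (L + M) = targets L + targets M"
  by (simp_all add: targets_def)

lemma sources_simps [simp]:
  "sources {#} = {#}" "sources (add_mset l L) = mset (source l) + sources L"
  "sources (L + M) = sources L + sources M"
  by (simp_all add: sources_def)

lemma in_targets: "p \<in># targets L \<longleftrightarrow> (\<exists>l\<in>#L. p \<in> set (target l))"
  by (simp add: targets_def)

lemma in_sources: "p \<in># sources L \<longleftrightarrow> (\<exists>l\<in>#L. p \<in> set (source l))"
  by (simp add: sources_def)

lemma positions_eq: "positions S = set_mset (targets (links S)) \<union> set_mset (sources (links S))"
  by (auto simp: positions_def in_targets in_sources)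

lemma count_targets:
  "\<forall>l\<in>#L. distinct (target l) \<Longrightarrow> count (targets L) p = size {#l \<in># L. p \<in> set (target l)#}"
  by (induction L) (auto simp: distinct_count_atmost_1 count_mset_0_iff)

lemma count_sources:
  "\<forall>l\<in>#L. distinct (source l) \<Longrightarrow> count (sources L) p = size {#l \<in># L. p \<in> set (source l)#}"
  by (induction L) (auto simp: distinct_count_atmost_1 count_mset_0_iff)

text \<open>Counting occurrences condenses the clauses on positions: each position is a target
  exactly once, and it is either a conclusion or a source exactly once.\<close>

lemma is_net_iff:
  "is_net S \<longleftrightarrow> (\<forall>l\<in>#links S. distinct (source l) \<and> set (source l) \<inter> set (target l) = {}) \<and>
     simple (targets (links S)) \<and> mset (concl S) + sources (links S) = targets (links S)"
    (is "_ \<longleftrightarrow> ?L \<and> simple ?T \<and> _ + ?S = _")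
proof
  assume net: "is_net S"
  then have d: "\<forall>l\<in>#links S. distinct (source l)" "\<forall>l\<in>#links S. distinct (target l)"
    by (auto simp: is_net_def)
  have "count ?T p \<le> 1 \<and> count (mset (concl S)) p + count ?S p = count ?T p" for p
  proof (cases "p \<in> positions S")
    case True
    then have "count ?T p = 1" "count ?S p \<le> 1"
      using net by (auto simp: is_net_def count_targets[OF d(2)] count_sources[OF d(1)])
    moreover have "p \<in> set (concl S) \<longleftrightarrow> count ?S p = 0"
      using net True by (auto simp: is_net_def count_eq_zero_iff in_sources)
    moreover have "count (mset (concl S)) p = (if p \<in> set (concl S) then 1 else 0)"
      using net by (simp add: is_net_def distinct_count_atmost_1)
    ultimately have *: "count ?T p = 1" "count ?S p \<le> 1"
      "count (mset (concl S)) p = (if count ?S p = 0 then 1 else 0)" by simp_all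
    show ?thesis
    proof (cases "count ?S p = 0")
      case False
      with *(2) have "count ?S p = 1" by linarith
      then show ?thesis unfolding * by simp
    qed (simp only: *, simp)
  next
    case False
    then have "p \<notin># ?T" "p \<notin># ?S" "p \<notin> set (concl S)"
      using net by (auto simp: is_net_def positions_eq)
    then have *: "count ?T p = 0" "count ?S p = 0" "count (mset (concl S)) p = 0"
      by (simp_all add: count_eq_zero_iff)
    show ?thesis unfolding * by simp
  qed
  then show "?L \<and> simple ?T \<and> mset (concl S) + ?S = ?T"
    using net by (auto simp: simple_def multiset_eq_iff is_net_def)
next
  assume R: "?L \<and> simple ?T \<and> mset (concl S) + ?S = ?T"
  have dt: "\<forall>l\<in>#links S. distinct (target l)"
  proof
    fix l assume "l \<in># links S"
    then have "mset (target l) \<subseteq># ?T"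
      by (metis mset_subset_eq_add_left multi_member_split targets_simps(2))
    then show "distinct (target l)" using R simple_subset simple_mset by blast
  qed
  have ds: "\<forall>l\<in>#links S. distinct (source l)" using R by blast
  have sub: "set_mset ?S \<subseteq> set_mset ?T" "set (concl S) \<subseteq> set_mset ?T"
    using R by (metis set_mset_union sup_ge2, metis set_mset_union sup_ge1 set_mset_mset)
  have eq: "count (mset (concl S)) p + count ?S p = count ?T p" "count ?T p \<le> 1" for p
    using R by (metis count_union, auto simp: simple_def)
  have "count (mset (concl S)) p \<le> 1" for p using eq[of p] by linarith
  then have "simple (mset (concl S))" unfolding simple_def by blast
  then have dc: "distinct (concl S)" by simp
  show "is_net S"
    unfolding is_net_def
  proof (intro conjI ballI)
    fix p assume "p \<in> positions S"
    then have "p \<in># ?T" using sub by (auto simp: positions_eq)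
    then have "count ?T p = 1" using eq(2)[of p] by (metis One_nat_def Suc_leI count_greater_zero_iff le_antisym)
    then show "size {#l \<in># links S. p \<in> set (target l)#} = 1" using count_targets[OF dt] by simp
    have "count ?S p \<le> 1" using eq[of p] by linarith
    then show "size {#l \<in># links S. p \<in> set (source l)#} \<le> 1" using count_sources[OF ds] by simp
  next
    have "p \<in> set (concl S) \<longleftrightarrow> p \<in># ?T \<and> p \<notin># ?S" for p
    proof -
      have "p \<in> set (concl S) \<longleftrightarrow> count (mset (concl S)) p > 0" by (metis count_greater_zero_iff set_mset_mset)
      moreover have "p \<in># ?T \<longleftrightarrow> count ?T p > 0" "p \<notin># ?S \<longleftrightarrow> count ?S p = 0" by (auto simp: count_eq_zero_iff)
      ultimately show ?thesis using eq[of p] by linarith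
    qed
    then show "set (concl S) = {p \<in> positions S. \<forall>l\<in>#links S. p \<notin> set (source l)}"
      using sub by (auto simp: positions_eq in_sources)
  qed (use R dt dc in auto)
qed

lemma is_net_positions: "is_net S \<Longrightarrow> positions S = set_mset (targets (links S))"
  unfolding is_net_iff positions_eq by (metis set_mset_union sup.absorb1 sup_ge2)

definition conn_link :: "bool \<Rightarrow> pos \<Rightarrow> pos \<Rightarrow> pos \<Rightarrow> link" where
  "conn_link k p q r = (if k then Par p q r else Tensor p q r)"

lemma conn_link_simps [simp]:
  "source (conn_link k p q r) = [p, q]" "target (conn_link k p q r) = [r]"
  "conn_link k p q r \<noteq> Daimon ps" "conn_link k p q r \<noteq> Cut p' q'"
  "Daimon ps \<noteq> conn_link k p q r" "Cut p' q' \<noteq> conn_link k p q r"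
  "map_link f g (conn_link k p q r) = conn_link k (f p) (f q) (g r)"
  "conn_link k p q r = conn_link k' p' q' r' \<longleftrightarrow> k = k' \<and> p = p' \<and> q = q' \<and> r = r'"
  "Par p q r = conn_link k' p' q' r' \<longleftrightarrow> k' \<and> p = p' \<and> q = q' \<and> r = r'"
  "Tensor p q r = conn_link k' p' q' r' \<longleftrightarrow> \<not> k' \<and> p = p' \<and> q = q' \<and> r = r'"
  by (auto simp: conn_link_def)

fun tree_links :: "pos tree \<Rightarrow> link multiset" where
  "tree_links (Leaf x) = {#}"
| "tree_links (Node k p a b) = add_mset (conn_link k (root a) (root b) p) (tree_links a + tree_links b)"

definition forest_net :: "pos tree list \<Rightarrow> pos list multiset \<Rightarrow> net" where
  "forest_net ts D = Net (sum_list (map tree_links ts) + image_mset Daimon D) (map root ts)"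

lemma forest_net_simps [simp]:
  "links (forest_net ts D) = sum_list (map tree_links ts) + image_mset Daimon D"
  "concl (forest_net ts D) = map root ts"
  by (simp_all add: forest_net_def)

lemma targets_tree_links [simp]: "targets (tree_links t) = inner t"
  by (induction t) auto

lemma sources_tree_links: "add_mset (root t) (sources (tree_links t)) = nodes t"
proof (induction t)
  case (Node k p a b)
  have "sources (tree_links (Node k p a b)) =
    add_mset (root a) (sources (tree_links a)) + add_mset (root b) (sources (tree_links b))" by simp
  then show ?case by (simp add: Node.IH)
qed simp

lemma targets_forest: "targets (sum_list (map tree_links ts)) = sum_list (map inner ts)"
  by (induction ts) auto

lemma sources_forest: "mset (map root ts) + sources (sum_list (map tree_links ts)) = forest_nodes ts"
proof (induction ts)
  case (Cons t ts)
  have "mset (map root (t # ts)) + sources (sum_list (map tree_links (t # ts))) =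
    add_mset (root t) (sources (tree_links t)) + (mset (map root ts) + sources (sum_list (map tree_links ts)))"
    by simp
  also have "\<dots> = forest_nodes (t # ts)" by (simp only: Cons.IH sources_tree_links) simp
  finally show ?case .
qed simp

lemma targets_daimons [simp]: "targets (image_mset Daimon D) = \<Sum>\<^sub># (vertices D)"
  by (induction D) auto

lemma sources_daimons [simp]: "sources (image_mset Daimon D) = {#}"
  by (induction D) auto

lemma tree_links_shape: "l \<in># tree_links t \<Longrightarrow> \<exists>k p q r. l = conn_link k p q r"
  by (induction t) auto

lemma forest_links_shape: "l \<in># sum_list (map tree_links ts) \<Longrightarrow> \<exists>k p q r. l = conn_link k p q r"
  by (induction ts) (auto dest: tree_links_shape)

lemma tree_links_disjoint:
  "simple (nodes t) \<Longrightarrow> l \<in># tree_links t \<Longrightarrow> distinct (source l) \<and> set (source l) \<inter> set (target l) = {}"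
proof (induction t)
  case (Node k p a b)
  then have "\<forall>x. x \<in># nodes a \<longrightarrow> x \<notin># nodes b" "p \<notin># nodes a" "p \<notin># nodes b"
    by (simp_all add: simple_union)
  then have "root a \<noteq> root b" "p \<noteq> root a" "p \<noteq> root b"
    using root_in_nodes[of a] root_in_nodes[of b] by metis+
  then show ?case using Node by (auto simp: simple_union)
qed simp

lemma simple_in_forest: "simple (forest_nodes ts) \<Longrightarrow> t \<in> set ts \<Longrightarrow> simple (nodes t)"
  by (induction ts) (auto simp: simple_union)

lemma forest_links_disjoint:
  "simple (forest_nodes ts) \<Longrightarrow> l \<in># sum_list (map tree_links ts) \<Longrightarrow>
    distinct (source l) \<and> set (source l) \<inter> set (target l) = {}"
  by (induction ts) (auto simp: simple_union dest: tree_links_disjoint)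

lemma targets_forest_net: "targets (links (forest_net ts D)) = sum_list (map inner ts) + \<Sum>\<^sub># (vertices D)"
  by (simp add: targets_forest)

lemma targets_wf_forest: "wf_forest ts D \<Longrightarrow> targets (links (forest_net ts D)) = forest_nodes ts"
  unfolding targets_forest_net by (simp only: wf_forest_def forest_nodes_leaves)

lemma is_net_forest_net:
  assumes "wf_forest ts D"
  shows "is_net (forest_net ts D)"
proof -
  have "distinct (source l) \<and> set (source l) \<inter> set (target l) = {}" if "l \<in># links (forest_net ts D)" for l
    using that assms forest_links_disjoint by (auto simp: wf_forest_def)
  moreover have "mset (concl (forest_net ts D)) + sources (links (forest_net ts D)) = forest_nodes ts"
    using sources_forest[of ts] by (simp add: add.assoc[symmetric])
  moreover have "targets (links (forest_net ts D)) = forest_nodes ts"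
    using assms by (rule targets_wf_forest)
  ultimately show ?thesis using assms by (simp only: is_net_iff wf_forest_def) simp
qed

lemma positions_forest_net:
  "wf_forest ts D \<Longrightarrow> positions (forest_net ts D) = set_mset (forest_nodes ts)"
  by (simp only: is_net_positions[OF is_net_forest_net] targets_wf_forest)

lemma wf_forestI:
  "is_net (forest_net ts D) \<Longrightarrow> \<Sum>\<^sub># (vertices D) = forest_leaves ts \<Longrightarrow> wf_forest ts D"
  unfolding is_net_iff targets_forest_net wf_forest_def forest_nodes_leaves by simp

lemma cut_free_forest_net: "cut_free (forest_net ts D)"
  unfolding cut_free_def by (auto dest!: tree_links_shape)

text \<open>A cut-free net may contain a cycle of connective links. The labelling excludes this, as
  formulas grow strictly from premise to output. Hence a connective link whose output has a label of
  maximal size ends at a conclusion; it is removed, and induction on the number of links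
  applies.\<close>

lemma net_is_forest:
  fixes \<tau> :: "pos \<Rightarrow> 'v form"
  assumes "is_net S" "cut_free S" "formula_labelling S \<tau>"
  shows "\<exists>ts D. wf_forest ts D \<and> S = forest_net ts D"
  using assms
proof (induction "size (links S)" arbitrary: S rule: less_induct)
  case less
  define conn where "conn = {l. l \<in># links S \<and> (\<forall>ps. l \<noteq> Daimon ps)}"
  have shape: "\<exists>k p q r. l = conn_link k p q r" if "l \<in> conn" for l
    using that less.prems(2) by (cases l) (auto simp: conn_def cut_free_def)
  show ?case
  proof (cases "conn = {}")
    case True
    define D where "D = image_mset target (links S)"
    have "Daimon (target l) = l" if "l \<in># links S" for l
      using True that by (cases l) (auto simp: conn_def)
    then have L: "links S = image_mset Daimon D"
      unfolding D_def by (simp add: multiset.map_comp comp_def cong: image_mset_cong)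
    then have eq: "S = forest_net (map Leaf (concl S)) D"
      by (cases S) (auto simp: forest_net_def comp_def)
    moreover have "\<Sum>\<^sub># (vertices D) = mset (concl S)"
      using less.prems(1) by (simp add: is_net_iff L)
    moreover have "forest_leaves (map Leaf xs) = mset xs" for xs :: "pos list"
      by (induction xs) auto
    ultimately have "wf_forest (map Leaf (concl S)) D"
      using less.prems(1) by (intro wf_forestI) auto
    with eq show ?thesis by blast
  next
    case False
    have "finite conn" unfolding conn_def by simp
    define f where "f l = size (\<tau> (hd (target l)))" for l
    have "Max (f ` conn) \<in> f ` conn" using False \<open>finite conn\<close> by (intro Max_in) auto
    then obtain l where l: "l \<in> conn" "f l = Max (f ` conn)" by force
    then have max: "size (\<tau> (hd (target l'))) \<le> size (\<tau> (hd (target l)))" if "l' \<in> conn" for l'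
      using that \<open>finite conn\<close> unfolding f_def[symmetric] by simp
    obtain k p q r where lk: "l = conn_link k p q r" using shape[OF l(1)] by blast
    have "r \<notin># sources (links S)"
    proof
      assume "r \<in># sources (links S)"
      then obtain l' where l': "l' \<in># links S" "r \<in> set (source l')" by (auto simp: in_sources)
      then have "l' \<in> conn" by (auto simp: conn_def)
      with shape obtain k' p' q' r' where lk': "l' = conn_link k' p' q' r'" by blast
      have "size (\<tau> r) < size (\<tau> r')"
        using less.prems(3) l' by (cases k') (auto simp: lk' conn_link_def formula_labelling_def)
      with max[OF \<open>l' \<in> conn\<close>] show False by (simp add: lk lk')
    qed
    moreover obtain L where L: "links S = add_mset l L" using l(1) by (auto simp: conn_def dest: multi_member_split)
    moreover have net: "simple (targets (links S))" "mset (concl S) + sources (links S) = targets (links S)"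
      "\<And>l. l \<in># links S \<Longrightarrow> distinct (source l) \<and> set (source l) \<inter> set (target l) = {}"
      using less.prems(1) by (auto simp: is_net_iff)
    ultimately have "r \<in># mset (concl S)"
      by (metis lk conn_link_simps(2) targets_simps(2) union_iff union_single_eq_member mset_single_iff_right)
    then obtain us vs where c: "concl S = us @ r # vs" by (metis set_mset_mset split_list)
    \<comment> \<open>The premises take the place of \<open>r\<close> among the conclusions,
      adjacent and in order, so that the node can be put back on the two corresponding
      trees.\<close>
    define S' where "S' = Net L (us @ p # q # vs)"
    have "is_net S'"
      using net unfolding is_net_iff S'_def by (auto simp: L lk c simple_union add_mset_commute add.assoc)
    moreover have "cut_free S'" using less.prems(2) by (simp add: cut_free_def S'_def L)
    moreover have "formula_labelling S' \<tau>" using less.prems(3) by (simp add: formula_labelling_def S'_def L)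
    moreover have "size (links S') < size (links S)" by (simp add: S'_def L)
    ultimately obtain ts D where ts: "wf_forest ts D" "S' = forest_net ts D" using less.hyps by blast
    then have "map root ts = us @ p # q # vs" by (simp add: S'_def forest_net_def)
    then obtain As a b Bs where ab: "ts = As @ a # b # Bs" "map root As = us" "root a = p" "root b = q" "map root Bs = vs"
      by (auto simp: map_eq_append_conv map_eq_Cons_conv)
    have eq: "S = forest_net (As @ Node k r a b # Bs) D"
      using ts(2) c L by (cases S) (auto simp: S'_def forest_net_def lk ab add.assoc)
    moreover have "wf_forest (As @ Node k r a b # Bs) D"
      using less.prems(1) ts(1) unfolding eq by (intro wf_forestI) (auto simp: wf_forest_def ab)
    ultimately show ?thesis by blast
  qed
qed

fun labelled :: "(pos \<Rightarrow> 'v form) \<Rightarrow> pos tree \<Rightarrow> bool" where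
  "labelled \<tau> (Leaf x) \<longleftrightarrow> (\<exists>X. \<tau> x = Var X)"
| "labelled \<tau> (Node k p a b) \<longleftrightarrow>
     \<tau> p = (if k then FPar else FTensor) (\<tau> (root a)) (\<tau> (root b)) \<and> labelled \<tau> a \<and> labelled \<tau> b"

text \<open>The tree has exactly the connectives of the formula, while the variable at a leaf is
  left open.\<close>

fun fits :: "pos tree \<Rightarrow> 'v form \<Rightarrow> bool" where
  "fits (Leaf x) (Var X) \<longleftrightarrow> True"
| "fits (Node k p a b) (FPar A B) \<longleftrightarrow> k \<and> fits a A \<and> fits b B"
| "fits (Node k p a b) (FTensor A B) \<longleftrightarrow> \<not> k \<and> fits a A \<and> fits b B"
| "fits _ _ \<longleftrightarrow> False"

lemma labelled_fits: "labelled \<tau> t \<Longrightarrow> fits t (\<tau> (root t))"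
  by (induction t) auto

lemma fits_similar: "fits t A \<Longrightarrow> fits u A \<Longrightarrow> similar False t u"
proof (induction t arbitrary: A u)
  case (Leaf x)
  then show ?case by (cases A; cases u) auto
next
  case (Node k p a b)
  then show ?case by (cases A; cases u) auto
qed

lemma fits_neg_similar: "fits t A \<Longrightarrow> fits u (neg d A) \<Longrightarrow> similar True t u"
proof (induction t arbitrary: A u)
  case (Leaf x)
  then show ?case by (cases A; cases u) auto
next
  case (Node k p a b)
  then show ?case by (cases A; cases u) auto
qed

lemma initial_positions_forest_net:
  assumes "wf_forest ts D"
  shows "initial_positions (forest_net ts D) = set_mset (forest_leaves ts)"
proof -
  have "initial_positions (forest_net ts D) = set_mset (\<Sum>\<^sub># (vertices D))"
    by (auto simp: initial_positions_def dest!: tree_links_shape)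
  then show ?thesis using assms by (simp only: wf_forest_def)
qed

lemma atomic_labelling_forest_net:
  assumes "wf_forest ts D"
  shows "atomic_labelling (forest_net ts D) \<tau> \<longleftrightarrow> (\<forall>t\<in>set ts. labelled \<tau> t)"
proof -
  define ok where "ok l \<longleftrightarrow> (\<forall>k p q r. l = conn_link k p q r \<longrightarrow> \<tau> r = (if k then FPar else FTensor) (\<tau> p) (\<tau> q))" for l
  have ok_conn [simp]: "ok (conn_link k p q r) \<longleftrightarrow> \<tau> r = (if k then FPar else FTensor) (\<tau> p) (\<tau> q)" for k p q r
    unfolding ok_def conn_link_simps by blast
  have tree: "labelled \<tau> t \<longleftrightarrow> (\<forall>l\<in>#tree_links t. ok l) \<and> (\<forall>x\<in>set (leaves t). \<exists>X. \<tau> x = Var X)" for t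
  proof (induction t)
    case (Node k p a b)
    then show ?case by (simp only: labelled.simps tree_links.simps ok_conn) auto
  qed simp
  have "formula_labelling (forest_net ts D) \<tau> \<longleftrightarrow> (\<forall>l\<in>#sum_list (map tree_links ts). ok l)"
  proof
    assume F: "formula_labelling (forest_net ts D) \<tau>"
    show "\<forall>l\<in>#sum_list (map tree_links ts). ok l"
    proof
      fix l assume l: "l \<in># sum_list (map tree_links ts)"
      then obtain k p q r where lk: "l = conn_link k p q r" using forest_links_shape by blast
      with l have "conn_link k p q r \<in># links (forest_net ts D)" by simp
      with F show "ok l" unfolding lk ok_conn unfolding formula_labelling_def conn_link_def
        by (cases k) (simp only: if_True if_False; blast)+
    qed
  next
    assume F: "\<forall>l\<in>#sum_list (map tree_links ts). ok l"
    have "ok l" if "l \<in># links (forest_net ts D)" for l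
      using that F by (auto simp: ok_def)
    then have "ok (conn_link k p q r)" if "conn_link k p q r \<in># links (forest_net ts D)" for k p q r
      using that by blast
    from this[of True] this[of False] show "formula_labelling (forest_net ts D) \<tau>"
      unfolding formula_labelling_def ok_conn unfolding conn_link_def by simp
  qed
  then show ?thesis
    by (auto simp: atomic_labelling_def initial_positions_forest_net[OF assms] tree in_sum_list)
qed

lemma atomically_testable_forest:
  assumes "atomically_testable S As"
  obtains ts D \<tau> where "wf_forest ts D" "S = forest_net ts D" "\<And>t. t \<in> set ts \<Longrightarrow> labelled \<tau> t"
    "As = map (\<lambda>t. \<tau> (root t)) ts"
proof -
  obtain \<tau> where S: "is_net S" "cut_free S" "atomic_labelling S \<tau>" "map \<tau> (concl S) = As"
    using assms by (auto simp: atomically_testable_def)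
  then have "formula_labelling S \<tau>" by (simp add: atomic_labelling_def)
  with S net_is_forest obtain ts D where ts: "wf_forest ts D" "S = forest_net ts D" by blast
  show ?thesis
  proof (rule that[OF ts])
    show "labelled \<tau> t" if "t \<in> set ts" for t
      using that S(3) atomic_labelling_forest_net[OF ts(1)] ts(2) by blast
    show "As = map (\<lambda>t. \<tau> (root t)) ts" using S(4) by (auto simp: ts(2))
  qed
qed

lemma forest_atomically_testable:
  assumes "wf_forest ts D" "\<And>t. t \<in> set ts \<Longrightarrow> labelled \<tau> t"
  shows "atomically_testable (forest_net ts D) (map (\<lambda>t. \<tau> (root t)) ts)"
  unfolding atomically_testable_def
proof (intro conjI exI)
  show "is_net (forest_net ts D)" using assms(1) by (rule is_net_forest_net)
  show "cut_free (forest_net ts D)" by (rule cut_free_forest_net)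
  show "atomic_labelling (forest_net ts D) \<tau>"
    using assms atomic_labelling_forest_net by blast
qed simp

section \<open>Sequentialization\<close>

text \<open>The cut-free part of \<^const>\<open>represents\<close>, without the proof tree.\<close>

inductive sequential :: "link multiset \<Rightarrow> pos list \<Rightarrow> bool" where
  seq_daimon: "distinct ps \<Longrightarrow> sequential {#Daimon ps#} ps"
| seq_par: "sequential L (cs @ [p, q]) \<Longrightarrow> r \<notin># targets L + sources L \<Longrightarrow>
    sequential (L + {#Par p q r#}) (cs @ [r])"
| seq_tensor: "sequential L (cs @ [p]) \<Longrightarrow> sequential M (ds @ [q]) \<Longrightarrow>
    set_mset (targets L + sources L) \<inter> set_mset (targets M + sources M) = {} \<Longrightarrow>
    r \<notin># targets L + sources L + (targets M + sources M) \<Longrightarrow>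
    sequential (L + M + {#Tensor p q r#}) (cs @ ds @ [r])"
| seq_exchange: "sequential L (cs @ [p, q] @ ds) \<Longrightarrow> sequential L (cs @ [q, p] @ ds)"

text \<open>The labelling supplies the formulas, so a proof can be read off the derivation, each
  daimon rule introducing the labels of its outputs.\<close>

lemma sequential_represents:
  "sequential L cs \<Longrightarrow> formula_labelling (Net L cs) \<tau> \<Longrightarrow>
    \<exists>\<pi>. proof_of d \<pi> (map \<tau> cs) \<and> represents (Net L cs) \<pi>"
proof (induction rule: sequential.induct)
  case (seq_daimon ps)
  then show ?case
    by (intro exI[of _ "DaimonR (map \<tau> ps)"]) (auto intro: proof_of.intros represents.intros)
next
  case (seq_par L cs p q r)
  then have "formula_labelling (Net L (cs @ [p, q])) \<tau>" and \<tau>: "\<tau> r = FPar (\<tau> p) (\<tau> q)"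
    by (auto simp: formula_labelling_def)
  with seq_par.IH obtain \<pi> where \<pi>: "proof_of d \<pi> (map \<tau> cs @ [\<tau> p, \<tau> q])"
    "represents (Net L (cs @ [p, q])) \<pi>" by auto
  then show ?case
    using proof_of.intros(2)[OF \<pi>(1)] represents.intros(2)[OF \<pi>(2), of cs p q r] seq_par.hyps
    by (intro exI[of _ "ParR \<pi>"]) (auto simp: \<tau> positions_eq)
next
  case (seq_tensor L cs p M ds q r)
  then have "formula_labelling (Net L (cs @ [p])) \<tau>" "formula_labelling (Net M (ds @ [q])) \<tau>"
    and \<tau>: "\<tau> r = FTensor (\<tau> p) (\<tau> q)"
    by (auto simp: formula_labelling_def)
  with seq_tensor.IH obtain \<pi> \<rho> where \<pi>: "proof_of d \<pi> (map \<tau> cs @ [\<tau> p])"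
    "represents (Net L (cs @ [p])) \<pi>" "proof_of d \<rho> (map \<tau> ds @ [\<tau> q])"
    "represents (Net M (ds @ [q])) \<rho>" by auto
  then show ?case
    using proof_of.intros(3)[OF \<pi>(1,3)] represents.intros(3)[OF \<pi>(2,4), of cs p ds q r] seq_tensor.hyps
    by (intro exI[of _ "TensorR \<pi> \<rho>"]) (auto simp: \<tau> positions_eq)
next
  case (seq_exchange L cs p q ds)
  then have "formula_labelling (Net L (cs @ [p, q] @ ds)) \<tau>"
    by (auto simp: formula_labelling_def)
  with seq_exchange.IH obtain \<pi> where \<pi>: "proof_of d \<pi> (map \<tau> cs @ [\<tau> p, \<tau> q] @ map \<tau> ds)"
    "represents (Net L (cs @ [p, q] @ ds)) \<pi>" by auto
  then show ?case
    using proof_of.intros(5)[OF \<pi>(1)] represents.intros(5)[OF \<pi>(2), of cs p q ds]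
    by (intro exI[of _ "ExR (length cs) \<pi>"]) auto
qed

lemma represents_sequential: "represents S \<pi> \<Longrightarrow> cut_free S \<Longrightarrow> sequential (links S) (concl S)"
proof (induction rule: represents.induct)
  case (1 ps \<Gamma>)
  then show ?case by (simp add: seq_daimon)
next
  case (2 S \<pi> cs p q r)
  then have "sequential (links S) (cs @ [p, q])" by (simp add: cut_free_def)
  then show ?case using 2 by (simp only: net.sel) (rule seq_par, auto simp: positions_eq)
next
  case (3 S \<pi> T \<rho> cs p ds q r)
  then have "sequential (links S) (cs @ [p])" "sequential (links T) (ds @ [q])"
    by (simp_all add: cut_free_def)
  then show ?case using 3 by (simp only: net.sel) (rule seq_tensor, auto simp: positions_eq)
next
  case (4 S \<pi> T \<rho> cs p ds q)
  then show ?case by (auto simp: cut_free_def)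
next
  case (5 S \<pi> cs p q ds)
  then show ?case using seq_exchange[of "links S" cs p q ds] by (simp add: cut_free_def)
qed

lemma forest_positions:
  "wf_forest ts D \<Longrightarrow> set_mset (targets (links (forest_net ts D)) + sources (links (forest_net ts D))) =
    set_mset (forest_nodes ts)"
  using positions_forest_net[of ts D] by (simp only: positions_eq set_mset_union)

lemma sequential_correct:
  "sequential L cs \<Longrightarrow> \<exists>ts D. wf_forest ts D \<and> correct ts D \<and> Net L cs = forest_net ts D"
proof (induction rule: sequential.induct)
  case (seq_daimon ps)
  have leaves: "forest_leaves (map Leaf xs) = mset xs" "forest_nodes (map Leaf xs) = mset xs" for xs :: "pos list"
    by (induction xs) auto
  have "sum_list (map tree_links (map Leaf xs)) = {#}" for xs by (induction xs) auto
  then have "Net {#Daimon ps#} ps = forest_net (map Leaf ps) {#ps#}" by (simp add: forest_net_def comp_def)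
  moreover have "wf_forest (map Leaf ps) {#ps#}"
    using seq_daimon unfolding wf_forest_def leaves by simp
  ultimately show ?case using correct_daimon[OF seq_daimon] by blast
next
  case (seq_par L cs p q r)
  then obtain ts' D where ts': "wf_forest ts' D" "correct ts' D" "Net L (cs @ [p, q]) = forest_net ts' D" by blast
  then obtain ts a b where ab: "ts' = ts @ [a, b]" "cs = map root ts" "root a = p" "root b = q"
    by (auto simp: forest_net_def append_eq_map_conv Cons_eq_map_conv)
  have L: "L = links (forest_net ts' D)" using ts'(3) by (metis net.sel(1))
  have eq: "Net (L + {#Par p q r#}) (cs @ [r]) = forest_net (ts @ [Node True r a b]) D"
    by (simp add: L ab forest_net_def conn_link_def)
  have "r \<notin># forest_nodes ts'"
    using seq_par.hyps(2) forest_positions[OF ts'(1)] unfolding L by metis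
  then have "wf_forest (ts @ [Node True r a b]) D"
    using ts'(1) unfolding wf_forest_def by (auto simp: ab simple_union)
  then show ?case using eq correct_par[OF ts'(2)[unfolded ab(1)], of r] by blast
next
  case (seq_tensor L cs p M ds q r)
  from seq_tensor.IH obtain ts' D us' E where ts': "wf_forest ts' D" "correct ts' D" "Net L (cs @ [p]) = forest_net ts' D"
    and us': "wf_forest us' E" "correct us' E" "Net M (ds @ [q]) = forest_net us' E" by blast
  obtain ts a where a: "ts' = ts @ [a]" "cs = map root ts" "root a = p"
    using ts'(3) by (auto simp: forest_net_def append_eq_map_conv Cons_eq_map_conv)
  obtain us b where b: "us' = us @ [b]" "ds = map root us" "root b = q"
    using us'(3) by (auto simp: forest_net_def append_eq_map_conv Cons_eq_map_conv)
  have L: "L = links (forest_net ts' D)" "M = links (forest_net us' E)" using ts'(3) us'(3) by (metis net.sel(1))+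
  have eq: "Net (L + M + {#Tensor p q r#}) (cs @ ds @ [r]) = forest_net (ts @ us @ [Node False r a b]) (D + E)"
    by (simp add: L a b forest_net_def conn_link_def ac_simps)
  have r: "r \<notin># forest_nodes ts'" "r \<notin># forest_nodes us'"
    using seq_tensor.hyps(4) forest_positions[OF ts'(1)] forest_positions[OF us'(1)] unfolding L by (metis union_iff)+
  have "set_mset (forest_nodes ts') \<inter> set_mset (forest_nodes us') = {}"
    using seq_tensor.hyps(3) forest_positions[OF ts'(1)] forest_positions[OF us'(1)] unfolding L by metis
  then have "simple (forest_nodes ts' + forest_nodes us')"
    using ts'(1) us'(1) unfolding wf_forest_def simple_union by blast
  with r have "simple (add_mset r (forest_nodes ts' + forest_nodes us'))"
    by (simp only: simple_add_mset union_iff) simp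
  moreover have "add_mset r (forest_nodes ts' + forest_nodes us') = forest_nodes (ts @ us @ [Node False r a b])"
    by (simp add: a b ac_simps)
  moreover have "forest_leaves ts' + forest_leaves us' = forest_leaves (ts @ us @ [Node False r a b])"
    by (simp add: a b ac_simps)
  ultimately have "wf_forest (ts @ us @ [Node False r a b]) (D + E)"
    using ts'(1) us'(1) unfolding wf_forest_def by simp
  moreover have "correct (ts @ us @ [Node False r a b]) (D + E)"
    by (rule correct_tensor[OF ts'(2)[unfolded a(1)] us'(2)[unfolded b(1)]])
  ultimately show ?case using eq by blast
next
  case (seq_exchange L cs p q ds)
  then obtain ts' D where ts': "wf_forest ts' D" "correct ts' D" "Net L (cs @ [p, q] @ ds) = forest_net ts' D" by blast
  then obtain ts a b us where ab: "ts' = ts @ [a, b] @ us" "cs = map root ts" "root a = p" "root b = q" "ds = map root us"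
    by (auto simp: forest_net_def append_eq_map_conv Cons_eq_map_conv)
  have L: "L = links (forest_net ts' D)" using ts'(3) by (metis net.sel(1))
  have "Net L (cs @ [q, p] @ ds) = forest_net (ts @ [b, a] @ us) D"
    by (simp add: L ab forest_net_def ac_simps)
  moreover have "wf_forest (ts @ [b, a] @ us) D"
    using ts'(1) unfolding wf_forest_def ab by (simp add: ac_simps)
  moreover have "correct (ts @ [b, a] @ us) D"
    by (rule correct_mset[OF _ ts'(2)]) (simp add: ab)
  ultimately show ?case by blast
qed

section \<open>Permuting conclusions, and derivations put in place of daimons\<close>

lemma sequential_move: "sequential L (us @ A @ x # B) \<Longrightarrow> sequential L (us @ x # A @ B)"
proof (induction A arbitrary: B rule: rev_induct)
  case (snoc y A)
  then have "sequential L ((us @ A) @ [y, x] @ B)" by simp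
  then have "sequential L ((us @ A) @ [x, y] @ B)" by (rule seq_exchange)
  then show ?case using snoc.IH[of "y # B"] by simp
qed simp

lemma sequential_permute: "sequential L (us @ cs) \<Longrightarrow> mset cs = mset cs' \<Longrightarrow> sequential L (us @ cs')"
proof (induction cs' arbitrary: us cs)
  case (Cons x cs')
  then have "x \<in> set cs" by (metis list.set_intros(1) set_mset_mset)
  then obtain A B where AB: "cs = A @ x # B" by (meson split_list)
  with Cons.prems have "sequential L (us @ x # A @ B)" using sequential_move by simp
  then show ?case using Cons.IH[of "us @ [x]" "A @ B"] Cons.prems(2) by (simp add: AB)
qed simp

lemma sequential_mset: "sequential L cs \<Longrightarrow> mset cs = mset cs' \<Longrightarrow> sequential L cs'"
  using sequential_permute[of L "[]"] by simp

lemma targets_minus_subset: "set_mset (targets (L - M) + sources (L - M)) \<subseteq> set_mset (targets L + sources L)"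
  by (simp add: subset_iff in_targets in_sources) (blast dest: in_diffD)

text \<open>The daimon and its replacement \<open>M\<close> have the same conclusions
  \<open>e\<close>, so the rest of the derivation is repeated unchanged. The last hypothesis lets
  \<open>M\<close> meet the old net only there, which keeps the outputs \<open>r\<close> fresh and
  the premises of a tensor disjoint.\<close>

lemma sequential_substitute:
  assumes "sequential L cs" "Daimon e \<in># L" "sequential M e"
    "\<And>x. x \<in># targets M + sources M \<Longrightarrow> x \<in># targets L + sources L \<Longrightarrow> x \<in> set e"
  shows "sequential (L - {#Daimon e#} + M) cs"
  using assms(1,2,4)
proof (induction rule: sequential.induct)
  case (seq_daimon ps)
  then show ?case using assms(3) by simp
next
  case (seq_par L cs p q r)
  then have e: "Daimon e \<in># L" by simp
  have sub: "x \<in> set e" if "x \<in># targets M + sources M" "x \<in># targets L + sources L" for x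
    using seq_par.prems(2)[of x] that by auto
  have "sequential (L - {#Daimon e#} + M) (cs @ [p, q])" using seq_par.IH[OF e] sub by blast
  moreover have "r \<notin># targets (L - {#Daimon e#} + M) + sources (L - {#Daimon e#} + M)"
  proof
    assume "r \<in># targets (L - {#Daimon e#} + M) + sources (L - {#Daimon e#} + M)"
    then have "r \<in># targets (L - {#Daimon e#}) + sources (L - {#Daimon e#}) \<or> r \<in># targets M + sources M" by auto
    moreover have "r \<notin># targets (L - {#Daimon e#}) + sources (L - {#Daimon e#})"
      using seq_par.hyps(2) targets_minus_subset by blast
    ultimately have "r \<in># targets M + sources M" by blast
    then have "r \<in> set e" using seq_par.prems(2)[of r] by simp
    then have "r \<in># targets L" using e by (auto simp: in_targets intro!: bexI[of _ "Daimon e"])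
    then show False using seq_par.hyps(2) by simp
  qed
  ultimately have "sequential (L - {#Daimon e#} + M + {#Par p q r#}) (cs @ [r])" by (rule sequential.seq_par)
  then show ?case using e by (simp add: insert_DiffM2 ac_simps)
next
  case (seq_tensor L cs p K ds q r)
  have r: "r \<notin># targets M + sources M"
  proof
    assume "r \<in># targets M + sources M"
    then have "r \<in> set e" using seq_tensor.prems(2)[of r] by simp
    moreover have "Daimon e \<in># L + K" using seq_tensor.prems(1) by simp
    ultimately have "r \<in># targets (L + K)" unfolding in_targets by (intro bexI[of _ "Daimon e"]) auto
    then show False using seq_tensor.hyps(4) by auto
  qed
  have "Daimon e \<in># L \<or> Daimon e \<in># K" using seq_tensor.prems(1) by auto
  then show ?case
  proof
    assume e: "Daimon e \<in># L"
    then have eL: "set e \<subseteq> set_mset (targets L)"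
      by (auto simp: in_targets intro!: bexI[of _ "Daimon e"])
    have "sequential (L - {#Daimon e#} + M) (cs @ [p])"
      using seq_tensor.IH(1)[OF e] seq_tensor.prems(2) by auto
    moreover note seq_tensor.hyps(2)
    moreover have "set_mset (targets (L - {#Daimon e#} + M) + sources (L - {#Daimon e#} + M)) \<inter>
      set_mset (targets K + sources K) = {}"
    proof -
      have "x \<notin># targets K + sources K" if "x \<in># targets M + sources M" for x
        using seq_tensor.prems(2)[of x] that eL seq_tensor.hyps(3) by auto
      moreover have "x \<notin># targets K + sources K" if "x \<in># targets (L - {#Daimon e#}) + sources (L - {#Daimon e#})" for x
        using targets_minus_subset that seq_tensor.hyps(3) by blast
      ultimately show ?thesis by auto
    qed
    moreover have "r \<notin># targets (L - {#Daimon e#} + M) + sources (L - {#Daimon e#} + M) + (targets K + sources K)"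
      using r targets_minus_subset[of L "{#Daimon e#}"] seq_tensor.hyps(4) by auto
    ultimately have "sequential (L - {#Daimon e#} + M + K + {#Tensor p q r#}) (cs @ ds @ [r])"
      by (rule sequential.seq_tensor)
    then show ?case using e by (simp add: ac_simps)
  next
    assume e: "Daimon e \<in># K"
    then have eL: "set e \<subseteq> set_mset (targets K)"
      by (auto simp: in_targets intro!: bexI[of _ "Daimon e"])
    note seq_tensor.hyps(1)
    moreover have "sequential (K - {#Daimon e#} + M) (ds @ [q])"
      using seq_tensor.IH(2)[OF e] seq_tensor.prems(2) by auto
    moreover have "set_mset (targets L + sources L) \<inter>
      set_mset (targets (K - {#Daimon e#} + M) + sources (K - {#Daimon e#} + M)) = {}"
    proof -
      have "x \<notin># targets L + sources L" if "x \<in># targets M + sources M" for x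
        using seq_tensor.prems(2)[of x] that eL seq_tensor.hyps(3) by auto
      moreover have "x \<notin># targets L + sources L" if "x \<in># targets (K - {#Daimon e#}) + sources (K - {#Daimon e#})" for x
        using targets_minus_subset that seq_tensor.hyps(3) by blast
      ultimately show ?thesis by auto
    qed
    moreover have "r \<notin># targets L + sources L + (targets (K - {#Daimon e#} + M) + sources (K - {#Daimon e#} + M))"
      using r targets_minus_subset[of K "{#Daimon e#}"] seq_tensor.hyps(4) by auto
    ultimately have "sequential (L + (K - {#Daimon e#} + M) + {#Tensor p q r#}) (cs @ ds @ [r])"
      by (rule sequential.seq_tensor)
    then show ?case using e by (simp add: ac_simps)
  qed
next
  case (seq_exchange L cs p q ds)
  then show ?case using sequential.seq_exchange by blast
qed

lemma replace_links:
  "replace s s' t t' \<Longrightarrow> root s = root s' \<Longrightarrow>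
    \<exists>K. tree_links t = tree_links s + K \<and> tree_links t' = tree_links s' + K"
proof (induction rule: replace.induct)
  case (replace_left a a' k p b)
  then obtain K where "tree_links a = tree_links s + K" "tree_links a' = tree_links s' + K" by blast
  then show ?case using replace_root[OF replace_left.hyps replace_left.prems]
    by (intro exI[of _ "add_mset (conn_link k (root a) (root b) p) (K + tree_links b)"]) (simp add: ac_simps)
next
  case (replace_right b b' k p a)
  then obtain K where "tree_links b = tree_links s + K" "tree_links b' = tree_links s' + K" by blast
  then show ?case using replace_root[OF replace_right.hyps replace_right.prems]
    by (intro exI[of _ "add_mset (conn_link k (root a) (root b) p) (K + tree_links a)"]) (simp add: ac_simps)
qed auto

theorem correct_sequential:
  assumes "wf_forest ts D" "correct ts D"
  shows "sequential (links (forest_net ts D)) (map root ts)"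
  using assms
proof (induction "size (sum_list (map inner ts))" arbitrary: ts D rule: less_induct)
  case less
  show ?case
  proof (cases "\<forall>t\<in>set ts. \<exists>x. t = Leaf x")
    case True
    then have ts: "ts = map Leaf (map root ts)" by (induction ts) auto
    define xs where "xs = map root ts"
    have leaves: "forest_leaves (map Leaf xs) = mset xs" for xs :: "pos list"
      by (induction xs) auto
    have no_links: "sum_list (map tree_links (map Leaf xs)) = {#}" for xs by (induction xs) auto
    have eq: "ts = map Leaf xs" using ts by (simp add: xs_def)
    have D: "\<Sum>\<^sub># (vertices D) = mset xs" using less.prems(1) unfolding wf_forest_def eq leaves by simp
    \<comment> \<open>Without connectives every class is a singleton, so there are as many classes
      as edges and the count leaves exactly one daimon.\<close>
    have "tree_graph (vertices D + {#{#x#}. x \<in># mset xs#})"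
      using less.prems(2) unfolding correct_iff eq forest_switched_leaves by blast
    then have "2 * size (vertices D + {#{#x#}. x \<in># mset xs#}) = size (\<Sum>\<^sub># (vertices D + {#{#x#}. x \<in># mset xs#})) + 2"
      by (simp only: tree_graph_def)
    then have "2 * size D + 2 * length xs = 2 * length xs + 2"
      unfolding sum_mset.union D by simp
    then have "size D = 1" by simp
    then obtain d where d: "D = {#d#}" using size_1_singleton_mset by blast
    have "sequential {#Daimon d#} d"
      using wf_forest_simple[OF less.prems(1)] D unfolding eq leaves d
      by (intro seq_daimon) (simp add: mset_eq_imp_distinct_iff[of d xs])
    then have "sequential {#Daimon d#} xs" by (rule sequential_mset) (use D d in simp)
    then show ?thesis unfolding forest_net_simps eq no_links d by (simp add: comp_def)
  next
    case False
    from correct_contractible[OF less.prems False] obtain t k p x y where t: "t \<in> set ts"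
      "subtree (Node k p (Leaf x) (Leaf y)) t" "k \<longrightarrow> (\<exists>d\<in>#D. x \<in> set d \<and> y \<in> set d)" by blast
    then obtain us vs where ts: "ts = us @ t # vs" by (meson split_list)
    obtain t' where rep: "replace (Node k p (Leaf x) (Leaf y)) (Leaf p) t t'"
      using replace_exists[OF t(2)] by blast
    obtain K L where KL: "inner t = add_mset p K" "inner t' = K"
      "mset (leaves t) = add_mset x (add_mset y L)" "mset (leaves t') = add_mset p L"
      using replace_inner_leaves[OF rep] by auto
    have root: "root t = root t'" using replace_root[OF rep] by simp
    obtain Ls where Ls: "tree_links t = add_mset (conn_link k x y p) Ls" "tree_links t' = Ls"
      using replace_links[OF rep] by auto
    have smaller: "size (sum_list (map inner (us @ t' # vs))) < size (sum_list (map inner ts))"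
      by (simp add: ts KL)
    have nodes: "x \<notin># forest_nodes (us @ t' # vs)" "y \<notin># forest_nodes (us @ t' # vs)" "x \<noteq> y"
      "p \<notin># forest_leaves ts"
      using less.prems(1) unfolding wf_forest_def ts forest_nodes_leaves
      by (auto simp: KL simple_union)
    note D = less.prems(1)[unfolded wf_forest_def, THEN conjunct2]
    note sD = wf_forest_simple[OF less.prems(1)]
    \<comment> \<open>Common end of the two cases: \<open>M\<close> are the daimons absorbed
      together with the link, and \<open>d\<close> stands for them in the smaller net. There
      \<open>d\<close> is replaced by the derivation of the link on \<open>M\<close>.\<close>
    have step: "sequential (links (forest_net ts D)) (map root ts)"
      if D': "D = M + D'" and wfc: "wf_forest (us @ t' # vs) (add_mset d D') \<and> correct (us @ t' # vs) (add_mset d D')"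
        and M: "sequential (image_mset Daimon M + {#conn_link k x y p#}) d"
        and Md: "set_mset (\<Sum>\<^sub># (vertices M)) = {x, y} \<union> (set d - {p})" and pd: "p \<in> set d" for M D' d
    proof -
      let ?L = "links (forest_net (us @ t' # vs) (add_mset d D'))"
      let ?M = "image_mset Daimon M + {#conn_link k x y p#}"
      have "map root ts = map root (us @ t' # vs)" by (simp add: ts root)
      then have "sequential ?L (map root ts)"
        using less.hyps[OF smaller] wfc by metis
      moreover have "Daimon d \<in># ?L" by simp
      moreover note M
      moreover have "z \<in> set d" if "z \<in># targets ?M + sources ?M" "z \<in># targets ?L + sources ?L" for z
      proof -
        have "z \<in># forest_nodes (us @ t' # vs)"
          using that(2) forest_positions wfc by blast
        then have "z \<noteq> x" "z \<noteq> y" using nodes by auto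
        moreover have "z \<in># \<Sum>\<^sub># (vertices M) \<or> z = p \<or> z = x \<or> z = y" using that(1) by auto
        ultimately show ?thesis using Md pd by auto
      qed
      ultimately have "sequential (?L - {#Daimon d#} + ?M) (map root ts)"
        by (rule sequential_substitute)
      moreover have "?L - {#Daimon d#} + ?M = links (forest_net ts D)"
        by (simp add: ts D' Ls ac_simps)
      ultimately show ?thesis by simp
    qed
    show ?thesis
    proof (cases k)
      case False
      then have "wf_forest (us @ t # vs) D" "correct (us @ t # vs) D"
        "replace (Node False p (Leaf x) (Leaf y)) (Leaf p) t t'" using less.prems ts rep by auto
      then obtain d\<^sub>1 e\<^sub>1 d\<^sub>2 e\<^sub>2 D' where D': "D = {#d\<^sub>1, d\<^sub>2#} + D'"
        and d: "mset d\<^sub>1 = add_mset x e\<^sub>1" "mset d\<^sub>2 = add_mset y e\<^sub>2"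
        and *: "\<And>d. mset d = add_mset p (e\<^sub>1 + e\<^sub>2) \<Longrightarrow>
          wf_forest (us @ t' # vs) (add_mset d D') \<and> correct (us @ t' # vs) (add_mset d D')"
        by (rule contract_tensor) blast
      obtain l\<^sub>1 l\<^sub>2 where l: "mset l\<^sub>1 = e\<^sub>1" "mset l\<^sub>2 = e\<^sub>2" by (metis ex_mset)
      have simple: "simple (mset d\<^sub>1 + (mset d\<^sub>2 + \<Sum>\<^sub># (vertices D')))"
        using sD unfolding D[symmetric] D' by (simp add: ac_simps)
      have p: "p \<notin> set d\<^sub>1" "p \<notin> set d\<^sub>2" using nodes(4) unfolding D[symmetric] D' by auto
      have dist: "distinct d\<^sub>1" "distinct d\<^sub>2" "set d\<^sub>1 \<inter> set d\<^sub>2 = {}"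
        using simple by (auto simp: simple_union)
      \<comment> \<open>The outputs are reordered with \<open>x\<close> and \<open>y\<close> last,
        where the tensor rule takes its premises.\<close>
      have "sequential {#Daimon d\<^sub>1#} (l\<^sub>1 @ [x])" "sequential {#Daimon d\<^sub>2#} (l\<^sub>2 @ [y])"
        by (rule sequential_mset[OF seq_daimon]; use dist d l in simp)+
      then have "sequential ({#Daimon d\<^sub>1#} + {#Daimon d\<^sub>2#} + {#Tensor x y p#}) (l\<^sub>1 @ l\<^sub>2 @ [p])"
        by (rule seq_tensor) (use dist p in auto)
      moreover have "set d\<^sub>1 = insert x (set l\<^sub>1)" "set d\<^sub>2 = insert y (set l\<^sub>2)"
        using d l by (metis set_mset_mset set_mset_add_mset_insert)+
      ultimately show ?thesis
        using p by (intro step[OF D' *[of "l\<^sub>1 @ l\<^sub>2 @ [p]"]]) (auto simp: l conn_link_def False add_mset_commute)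
    next
      case True
      with t(3) obtain d\<^sub>0 where d0: "d\<^sub>0 \<in># D" "x \<in> set d\<^sub>0" "y \<in> set d\<^sub>0" by blast
      obtain D' where D': "D = add_mset d\<^sub>0 D'" using d0(1) by (meson mset_add)
      obtain e where e: "mset d\<^sub>0 = add_mset x (add_mset y e)"
        using d0 nodes(3) by (metis insert_noteq_member mset_add set_mset_mset)
      obtain l where l: "mset l = e" by (metis ex_mset)
      have "wf_forest (us @ t # vs) (add_mset d\<^sub>0 D')" "correct (us @ t # vs) (add_mset d\<^sub>0 D')"
        "replace (Node True p (Leaf x) (Leaf y)) (Leaf p) t t'" using less.prems ts rep True D' by auto
      note * = contract_par[OF this e, of "l @ [p]"]
      have p: "p \<notin> set d\<^sub>0" using nodes(4) unfolding D[symmetric] D' by auto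
      have dist: "distinct d\<^sub>0"
        using sD unfolding D[symmetric] D' by (simp add: simple_union)
      have "sequential {#Daimon d\<^sub>0#} (l @ [x, y])"
        by (rule sequential_mset[OF seq_daimon]) (use dist e l in simp_all)
      then have "sequential ({#Daimon d\<^sub>0#} + {#Par x y p#}) (l @ [p])"
        by (rule seq_par) (use p in simp)
      moreover have "set d\<^sub>0 = insert x (insert y (set l))"
        using e l by (metis set_mset_mset set_mset_add_mset_insert)
      ultimately show ?thesis
        using p D' * by (intro step[of "{#d\<^sub>0#}" D' "l @ [p]"]) (auto simp: l conn_link_def True)
    qed
  qed
qed

section \<open>Interaction of dual forests\<close>

abbreviation even_pos :: "pos \<Rightarrow> pos" where "even_pos \<equiv> (\<lambda>p. 2 * p)"
abbreviation odd_pos :: "pos \<Rightarrow> pos" where "odd_pos \<equiv> (\<lambda>p. 2 * p + 1)"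

lemma tree_links_map [simp]: "tree_links (map_tree f t) = image_mset (map_link f f) (tree_links t)"
  by (induction t) auto

lemma rename_forest_net:
  "rename f (forest_net ts D) = forest_net (map (map_tree f) ts) (image_mset (map f) D)"
proof -
  have "sum_list (map tree_links (map (map_tree f) ts)) = image_mset (map_link f f) (sum_list (map tree_links ts))"
    by (induction ts) auto
  then show ?thesis by (simp add: rename_def forest_net_def multiset.map_comp comp_def)
qed

lemma juxtapose_forest_net:
  "juxtapose (forest_net ts D) (forest_net us E) =
    forest_net (map (map_tree even_pos) ts @ map (map_tree odd_pos) us)
      (image_mset (map even_pos) D + image_mset (map odd_pos) E)"
  unfolding juxtapose_def even_copy_def odd_copy_def rename_forest_net
  by (simp add: forest_net_def add.assoc add.left_commute)

lemma forest_nodes_map: "forest_nodes (map (map_tree f) ts) = image_mset f (forest_nodes ts)"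
  by (induction ts) auto

lemma forest_leaves_map: "forest_leaves (map (map_tree f) ts) = image_mset f (forest_leaves ts)"
  by (induction ts) auto

lemma vertices_map: "vertices (image_mset (map f) D) = image_mset (image_mset f) (vertices D)"
  by (simp add: multiset.map_comp comp_def)

lemma sum_image_image: "\<Sum>\<^sub># (image_mset (image_mset f) M) = image_mset f (\<Sum>\<^sub># M)"
  by (induction M) auto

lemma simple_image: "inj f \<Longrightarrow> simple (image_mset f M) \<longleftrightarrow> simple M"
  by (induction M) (auto dest: injD)

lemma wf_forest_map:
  assumes "inj f" "wf_forest ts D"
  shows "wf_forest (map (map_tree f) ts) (image_mset (map f) D)"
  using assms unfolding wf_forest_def forest_nodes_map forest_leaves_map vertices_map sum_image_image
  by (simp add: simple_image)

lemma inj_even_odd: "inj even_pos" "inj odd_pos"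
  by (auto simp: inj_def)

lemma even_odd_disjoint: "x \<in># image_mset even_pos M \<Longrightarrow> x \<notin># image_mset odd_pos N"
  by auto presburger

lemma wf_forest_juxtapose:
  assumes "wf_forest ts D" "wf_forest us E"
  shows "wf_forest (map (map_tree even_pos) ts @ map (map_tree odd_pos) us)
      (image_mset (map even_pos) D + image_mset (map odd_pos) E)"
  using wf_forest_map[OF inj_even_odd(1) assms(1)] wf_forest_map[OF inj_even_odd(2) assms(2)]
    even_odd_disjoint
  unfolding wf_forest_def by (auto simp only: map_append sum_list_append simple_union forest_nodes_map
    image_mset_union sum_mset.union)

section \<open>Reduction of cuts between dual trees\<close>

abbreviation pair_trees :: "('a tree \<times> 'a tree) multiset \<Rightarrow> 'a tree multiset" where
  "pair_trees P \<equiv> image_mset fst P + image_mset snd P"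

definition pair_cuts :: "(pos tree \<times> pos tree) multiset \<Rightarrow> link multiset" where
  "pair_cuts P = image_mset (\<lambda>(t, u). Cut (root t) (root u)) P"

definition pair_links :: "(pos tree \<times> pos tree) multiset \<Rightarrow> pos list multiset \<Rightarrow> link multiset" where
  "pair_links P D = \<Sum>\<^sub># (image_mset tree_links (pair_trees P)) + image_mset Daimon D"

text \<open>The shape kept throughout the reduction of an interaction: each cut joins the roots of
  two trees, no conclusion is left, and \<open>D\<close> collects the daimons of both sides.\<close>

definition pair_net :: "(pos tree \<times> pos tree) multiset \<Rightarrow> pos list multiset \<Rightarrow> net" where
  "pair_net P D = Net (pair_cuts P + pair_links P D) []"

abbreviation labels :: "(pos \<Rightarrow> 'b) \<Rightarrow> pos list multiset \<Rightarrow> 'b multiset multiset" where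
  "labels \<phi> D \<equiv> image_mset (\<lambda>d. image_mset \<phi> (mset d)) D"

text \<open>The labelling \<open>\<phi>\<close> identifies each leaf with the leaf that it will be cut against.\<close>

definition matched :: "(pos \<Rightarrow> 'b) \<Rightarrow> (pos tree \<times> pos tree) multiset \<Rightarrow> pos list multiset \<Rightarrow> bool" where
  "matched \<phi> P D \<longleftrightarrow>
     simple (\<Sum>\<^sub># (image_mset nodes (pair_trees P))) \<and>
     \<Sum>\<^sub># (vertices D) = \<Sum>\<^sub># (image_mset (\<lambda>t. mset (leaves t)) (pair_trees P)) \<and>
     (\<forall>(t, u)\<in>#P. similar True t u \<and> map \<phi> (leaves t) = map \<phi> (leaves u)) \<and>
     simple (\<Sum>\<^sub># (image_mset (\<lambda>(t, u). image_mset \<phi> (mset (leaves t))) P))"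

lemma image_mset_leaves: "map \<phi> (leaves t) = map \<phi> (leaves u) \<Longrightarrow>
    image_mset \<phi> (mset (leaves t)) = image_mset \<phi> (mset (leaves u))"
  by (metis mset_map)

lemma matched_swap: "matched \<phi> (add_mset (t, u) P) D \<Longrightarrow> matched \<phi> (add_mset (u, t) P) D"
  unfolding matched_def using similar_sym[of True t u]
  by (auto simp: ac_simps image_mset_leaves[of \<phi> t u])

lemma matched_node:
  assumes "matched \<phi> (add_mset (Node True p a b, Node False q a' b') P) D"
  shows "matched \<phi> (add_mset (a, a') (add_mset (b, b') P)) D"
proof -
  have "similar True a a'" "similar True b b'" "map \<phi> (leaves a @ leaves b) = map \<phi> (leaves a' @ leaves b')"
    using assms by (auto simp: matched_def)
  moreover from this have "map \<phi> (leaves a) = map \<phi> (leaves a')" "map \<phi> (leaves b) = map \<phi> (leaves b')"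
    using similar_length by fastforce+
  ultimately show ?thesis using assms unfolding matched_def
    by (auto simp: ac_simps simple_union)
qed

text \<open>Each label comes once from the left and once from the right tree of its pair. Through
  \<open>labels_count\<close> this yields the condition for contraction that an edge has no third
  end.\<close>

lemma labels_total:
  assumes "matched \<phi> P D"
  shows "\<Sum>\<^sub># (labels \<phi> D) = \<Sum>\<^sub># (image_mset (\<lambda>(t, u). image_mset \<phi> (mset (leaves t))) P) +
    \<Sum>\<^sub># (image_mset (\<lambda>(t, u). image_mset \<phi> (mset (leaves t))) P)"
proof -
  have "\<Sum>\<^sub># (labels \<phi> D) = image_mset \<phi> (\<Sum>\<^sub># (vertices D))"
    by (induction D) auto
  also have "\<dots> = image_mset \<phi> (\<Sum>\<^sub># (image_mset (\<lambda>t. mset (leaves t)) (pair_trees P)))"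
    using assms by (simp only: matched_def)
  also have "\<dots> = \<Sum>\<^sub># (image_mset (\<lambda>(t, u). image_mset \<phi> (mset (leaves t))) P) +
      \<Sum>\<^sub># (image_mset (\<lambda>(t, u). image_mset \<phi> (mset (leaves u))) P)"
    by (induction P) (auto simp: ac_simps)
  also have "image_mset (\<lambda>(t, u). image_mset \<phi> (mset (leaves u))) P =
      image_mset (\<lambda>(t, u). image_mset \<phi> (mset (leaves t))) P"
  proof (rule image_mset_cong, clarify)
    fix t u assume "(t, u) \<in># P"
    then have "map \<phi> (leaves t) = map \<phi> (leaves u)" using assms by (auto simp: matched_def)
    then show "image_mset \<phi> (mset (leaves u)) = image_mset \<phi> (mset (leaves t))"
      by (rule image_mset_leaves[symmetric])
  qed
  finally show ?thesis .
qed

lemma labels_count: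
  assumes "matched \<phi> P D"
  shows "count (\<Sum>\<^sub># (labels \<phi> D)) x \<le> 2"
proof -
  have "simple (\<Sum>\<^sub># (image_mset (\<lambda>(t, u). image_mset \<phi> (mset (leaves t))) P))"
    using assms by (simp only: matched_def)
  then have "count (\<Sum>\<^sub># (image_mset (\<lambda>(t, u). image_mset \<phi> (mset (leaves t))) P)) x \<le> 1"
    by (simp only: simple_def)
  then show ?thesis unfolding labels_total[OF assms] count_union by linarith
qed

text \<open>The cut of \<open>p\<close> against \<open>q\<close> is the edge
  \<open>\<phi> p = \<phi> q\<close>, and the daimon/daimon step merges its two ends.\<close>

lemma matched_leaf:
  assumes M: "matched \<phi> (add_mset (Leaf p, Leaf q) P) ({#as @ [p] @ bs, as' @ [q] @ bs'#} + D)"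
  shows "matched \<phi> P (add_mset (as @ bs @ as' @ bs') D)"
    "tree_graph (labels \<phi> (add_mset (as @ bs @ as' @ bs') D)) \<longleftrightarrow>
     tree_graph (labels \<phi> ({#as @ [p] @ bs, as' @ [q] @ bs'#} + D))"
proof -
  show "matched \<phi> P (add_mset (as @ bs @ as' @ bs') D)"
    using M unfolding matched_def by (auto simp: ac_simps)
  define e where "e = \<phi> p"
  have e: "\<phi> q = e" using M by (auto simp: matched_def e_def)
  define v where "v = image_mset \<phi> (mset (as @ bs))"
  define w where "w = image_mset \<phi> (mset (as' @ bs'))"
  have G: "labels \<phi> ({#as @ [p] @ bs, as' @ [q] @ bs'#} + D) =
      add_mset (add_mset e v) (add_mset (add_mset e w) (labels \<phi> D))"
    by (simp add: v_def w_def e e_def)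
  have G': "labels \<phi> (add_mset (as @ bs @ as' @ bs') D) = add_mset (v + w) (labels \<phi> D)"
    by (simp add: v_def w_def ac_simps)
  have "count (\<Sum>\<^sub># (add_mset (add_mset e v) (add_mset (add_mset e w) (labels \<phi> D)))) e \<le> 2"
    using labels_count[OF M, of e] unfolding G .
  then have "e \<notin># v + w + \<Sum>\<^sub># (labels \<phi> D)"
    unfolding not_in_iff by simp
  from tree_graph_contract[OF this] show "tree_graph (labels \<phi> (add_mset (as @ bs @ as' @ bs') D)) \<longleftrightarrow>
     tree_graph (labels \<phi> ({#as @ [p] @ bs, as' @ [q] @ bs'#} + D))"
    unfolding G G' by simp
qed

lemma conn_link_inner: "conn_link k a b p \<in># tree_links t \<Longrightarrow> p \<in># inner t"
  by (induction t) auto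

lemma inner_nodes: "p \<in># inner t \<Longrightarrow> p \<in># nodes t" and leaves_nodes: "p \<in> set (leaves t) \<Longrightarrow> p \<in># nodes t"
  by (auto simp: nodes_def)

text \<open>As positions are not repeated, a link whose output is the root of \<open>t\<close>
  cannot belong to another tree, nor sit higher up in \<open>t\<close>.\<close>

lemma own_node:
  assumes "simple (\<Sum>\<^sub># (image_mset nodes T))" "t \<in># T" "conn_link k a b (root t) \<in># \<Sum>\<^sub># (image_mset tree_links T)"
  shows "\<exists>x y. t = Node k (root t) x y \<and> root x = a \<and> root y = b"
proof -
  obtain T' where T: "T = add_mset t T'" using assms(2) by (meson mset_add)
  have "root t \<notin># \<Sum>\<^sub># (image_mset nodes T')"
    using assms(1) root_in_nodes[of t] unfolding T by (auto simp: simple_union)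
  then have "conn_link k a b (root t) \<in># tree_links t"
    using assms(3) unfolding T by (auto dest: conn_link_inner inner_nodes)
  moreover have "simple (nodes t)" using assms(1) unfolding T by (simp add: simple_union)
  ultimately show ?thesis
    by (cases t) (auto dest: conn_link_inner inner_nodes)
qed

lemma own_leaf:
  assumes "simple (\<Sum>\<^sub># (image_mset nodes T))" "t \<in># T" "root t \<in># \<Sum>\<^sub># (image_mset (\<lambda>t. mset (leaves t)) T)"
  shows "t = Leaf (root t)"
proof -
  obtain T' where T: "T = add_mset t T'" using assms(2) by (meson mset_add)
  have "root t \<notin># \<Sum>\<^sub># (image_mset nodes T')"
    using assms(1) root_in_nodes[of t] unfolding T by (auto simp: simple_union)
  then have "root t \<in> set (leaves t)"
    using assms(3) unfolding T by (auto dest: leaves_nodes)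
  moreover have "simple (nodes t)" using assms(1) unfolding T by (simp add: simple_union)
  ultimately show ?thesis
    by (cases t) (auto dest: leaves_nodes)
qed

lemma pair_links_add:
  "pair_links (add_mset (t, u) P) D = tree_links t + tree_links u + pair_links P D"
  by (simp add: pair_links_def ac_simps)

text \<open>Only the cut is taken out; the two trees keep their links under
  \<open>add_mset (t, u) P'\<close>. Swapping the pair, if necessary, hides the orientation of the
  cut.\<close>

lemma pair_cutE:
  assumes "matched \<phi> P D" "c \<in> cut_on p q" "c \<in># pair_cuts P + pair_links P D"
  obtains t u P' where "root t = p" "root u = q" "matched \<phi> (add_mset (t, u) P') D"
    "pair_cuts P + pair_links P D = add_mset c (pair_cuts P' + pair_links (add_mset (t, u) P') D)"
proof -
  have "c \<notin># pair_links P D"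
    using assms(2) by (auto simp: cut_on_def pair_links_def dest!: tree_links_shape)
  then have "c \<in># pair_cuts P" using assms(3) by auto
  then obtain t u where tu: "(t, u) \<in># P" "c = Cut (root t) (root u)" by (auto simp: pair_cuts_def)
  then obtain P' where P: "P = add_mset (t, u) P'" by (meson mset_add)
  show ?thesis
  proof (cases "root t = p \<and> root u = q")
    case True
    then show ?thesis using that[of t u P'] assms(1) tu P by (auto simp: pair_cuts_def)
  next
    case False
    then have "root u = p" "root t = q" using tu assms(2) by (auto simp: cut_on_def)
    then show ?thesis using that[of u t P'] matched_swap[of \<phi> t u P' D] assms(1) tu P
      by (auto simp: pair_cuts_def pair_links_add add.commute)
  qed
qed

lemma pair_links_conn:
  assumes "matched \<phi> P D" "conn_link k a b (root t) \<in># pair_links P D" "t \<in># pair_trees P"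
  shows "\<exists>x y. t = Node k (root t) x y \<and> root x = a \<and> root y = b"
proof (rule own_node[OF _ assms(3)])
  show "simple (\<Sum>\<^sub># (image_mset nodes (pair_trees P)))" using assms(1) by (simp only: matched_def)
  show "conn_link k a b (root t) \<in># \<Sum>\<^sub># (image_mset tree_links (pair_trees P))"
    using assms(2) unfolding pair_links_def by auto
qed

lemma pair_links_daimon:
  assumes "matched \<phi> P D" "Daimon d \<in># pair_links P D" "root t \<in> set d" "t \<in># pair_trees P"
  shows "t = Leaf (root t)"
proof (rule own_leaf[OF _ assms(4)])
  show "simple (\<Sum>\<^sub># (image_mset nodes (pair_trees P)))" using assms(1) by (simp only: matched_def)
  have "Daimon d \<in># image_mset Daimon D"
    using assms(2) unfolding pair_links_def by (auto dest!: tree_links_shape)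
  then have "root t \<in># \<Sum>\<^sub># (vertices D)" using assms(3) by auto
  then show "root t \<in># \<Sum>\<^sub># (image_mset (\<lambda>t. mset (leaves t)) (pair_trees P))"
    using assms(1) by (simp only: matched_def)
qed

lemma filter_mset_eq_empty: "filter_mset Q M = {#} \<longleftrightarrow> (\<forall>x\<in>#M. \<not> Q x)"
  by (induction M) auto

lemma filter_daimons:
  "filter_mset (\<lambda>l. \<exists>d. l = Daimon d) (pair_cuts P + pair_links P' D) = image_mset Daimon D"
proof -
  have "filter_mset (\<lambda>l. \<exists>d. l = Daimon d) (pair_cuts P) = {#}"
    by (auto simp: pair_cuts_def filter_mset_eq_empty)
  moreover have "filter_mset (\<lambda>l. \<exists>d. l = Daimon d) (\<Sum>\<^sub># (image_mset tree_links (pair_trees P'))) = {#}"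
    by (auto simp: filter_mset_eq_empty dest!: tree_links_shape)
  moreover have "filter_mset (\<lambda>l. \<exists>d. l = Daimon d) (image_mset Daimon D) = image_mset Daimon D"
    by (induction D) auto
  ultimately show ?thesis by (simp only: pair_links_def filter_union_mset) simp
qed

text \<open>A rule for a connective link against a daimon would need a node paired with a leaf,
  contrary to the similarity of paired trees.\<close>

lemma matched_no_expansion:
  assumes M: "matched \<phi> P D" and c: "c \<in> cut_on p q" and q: "q \<in> set d"
    and eq: "pair_cuts P + pair_links P D = add_mset c (add_mset (conn_link k p1 p2 p) (add_mset (Daimon d) C))"
  shows False
proof -
  obtain t u P' where tu: "root t = p" "root u = q" "matched \<phi> (add_mset (t, u) P') D"
    "pair_cuts P + pair_links P D = add_mset c (pair_cuts P' + pair_links (add_mset (t, u) P') D)"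
    using pair_cutE[OF M c] unfolding eq by (metis union_single_eq_member)
  have eq': "pair_cuts P' + pair_links (add_mset (t, u) P') D = add_mset (conn_link k p1 p2 p) (add_mset (Daimon d) C)"
    using eq unfolding tu(4) by simp
  have nc: "conn_link k p1 p2 p \<notin># pair_cuts P'" "Daimon d \<notin># pair_cuts P'" by (auto simp: pair_cuts_def)
  have "conn_link k p1 p2 (root t) \<in># pair_links (add_mset (t, u) P') D"
    using eq' nc(1) unfolding tu(1) by (metis union_iff union_single_eq_member)
  from pair_links_conn[OF tu(3) this] obtain a b where t: "t = Node k p a b"
    using tu(1) by auto
  have "Daimon d \<in># pair_links (add_mset (t, u) P') D"
    using eq' nc(2) by (metis union_iff union_single_eq_member insert_iff set_mset_add_mset_insert)
  from pair_links_daimon[OF tu(3) this, of u] have "u = Leaf q" using tu(2) q by simp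
  then show False using tu(3) t by (auto simp: matched_def)
qed

text \<open>All four rules are examined. Par against tensor splits a pair and keeps the graph,
  daimon against daimon contracts an edge, and the two expansions are impossible.\<close>

lemma pair_net_step:
  assumes M: "matched \<phi> P D" and step: "cut_step (pair_net P D) N"
  shows "\<exists>P' D'. N = pair_net P' D' \<and> matched \<phi> P' D' \<and>
    (tree_graph (labels \<phi> D') \<longrightarrow> tree_graph (labels \<phi> D))"
  using step
proof (cases rule: cut_step.cases)
  case (par_tensor c p q p1 p2 q1 q2 C cs)
  then have eq: "pair_cuts P + pair_links P D = add_mset c (add_mset (Par p1 p2 p) (add_mset (Tensor q1 q2 q) C))"
    and cs: "cs = []" by (auto simp: pair_net_def add_mset_commute)
  obtain t u P' where tu: "root t = p" "root u = q" "matched \<phi> (add_mset (t, u) P') D"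
    "pair_cuts P + pair_links P D = add_mset c (pair_cuts P' + pair_links (add_mset (t, u) P') D)"
    using pair_cutE[OF M par_tensor(3)] unfolding eq by (metis union_single_eq_member)
  have eq': "pair_cuts P' + pair_links (add_mset (t, u) P') D = add_mset (Par p1 p2 p) (add_mset (Tensor q1 q2 q) C)"
    using eq unfolding tu(4) by simp
  have nc: "conn_link k a b r \<notin># pair_cuts P'" for k a b r by (auto simp: pair_cuts_def)
  have "conn_link True p1 p2 (root t) \<in># pair_links (add_mset (t, u) P') D"
    using eq' nc[of True p1 p2 p] tu(1) unfolding conn_link_def
    by (metis (full_types) union_iff union_single_eq_member)
  from pair_links_conn[OF tu(3) this] obtain a b where t: "t = Node True p a b" "root a = p1" "root b = p2"
    using tu(1) by auto
  have "conn_link False q1 q2 (root u) \<in># pair_links (add_mset (t, u) P') D"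
    using eq' nc[of False q1 q2 q] tu(2) unfolding conn_link_def
    by (metis (full_types) union_iff union_single_eq_member insert_iff set_mset_add_mset_insert)
  from pair_links_conn[OF tu(3) this] obtain a' b' where u: "u = Node False q a' b'" "root a' = q1" "root b' = q2"
    using tu(2) by auto
  have "C = pair_cuts P' + (tree_links a + tree_links b + (tree_links a' + tree_links b') + pair_links P' D)"
    using eq'[symmetric] by (simp add: t u pair_links_add conn_link_def add.assoc)
  then have "N = pair_net (add_mset (a, a') (add_mset (b, b') P')) D"
    using par_tensor(2) t u by (simp add: pair_net_def cs pair_links_add pair_cuts_def ac_simps)
  moreover have "matched \<phi> (add_mset (a, a') (add_mset (b, b') P')) D"
    using matched_node tu(3) unfolding t u by blast
  ultimately show ?thesis by blast
next
  case (daimon_daimon c p q as bs as' bs' C cs)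
  let ?d = "as @ [p] @ bs" and ?d' = "as' @ [q] @ bs'"
  have eq: "pair_cuts P + pair_links P D = add_mset c (add_mset (Daimon ?d) (add_mset (Daimon ?d') C))"
    and cs: "cs = []" using daimon_daimon(1) by (auto simp: pair_net_def add_mset_commute)
  obtain t u P' where tu: "root t = p" "root u = q" "matched \<phi> (add_mset (t, u) P') D"
    "pair_cuts P + pair_links P D = add_mset c (pair_cuts P' + pair_links (add_mset (t, u) P') D)"
    using pair_cutE[OF M daimon_daimon(3)] unfolding eq by (metis union_single_eq_member)
  have eq': "pair_cuts P' + pair_links (add_mset (t, u) P') D = add_mset (Daimon ?d) (add_mset (Daimon ?d') C)"
    using eq unfolding tu(4) by simp
  have "image_mset Daimon D = add_mset (Daimon ?d) (add_mset (Daimon ?d') (filter_mset (\<lambda>l. \<exists>d. l = Daimon d) C))"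
    using filter_daimons[of P' "add_mset (t, u) P'" D] unfolding eq' by simp
  then obtain D' where D: "D = {#?d, ?d'#} + D'"
    by (auto dest!: msed_map_invR)
  have "t = Leaf p" "u = Leaf q"
    using pair_links_daimon[OF tu(3), of ?d t] pair_links_daimon[OF tu(3), of ?d' u] tu(1,2)
    by (auto simp: pair_links_def D)
  with eq' have "C = pair_cuts P' + pair_links P' D'"
    by (simp add: pair_links_def D)
  then have "N = pair_net P' (add_mset (as @ bs @ as' @ bs') D')"
    using daimon_daimon(2) by (simp add: pair_net_def cs pair_links_def)
  moreover have "matched \<phi> (add_mset (Leaf p, Leaf q) P') ({#?d, ?d'#} + D')"
    using tu(3) unfolding D \<open>t = Leaf p\<close> \<open>u = Leaf q\<close> .
  ultimately show ?thesis using matched_leaf unfolding D by blast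
next
  case (tensor_daimon c p q p1 p2 as bs C cs r1 r2)
  then show ?thesis
    using matched_no_expansion[OF M tensor_daimon(2), of "as @ [q] @ bs" False p1 p2 C]
    by (simp add: pair_net_def conn_link_def add_mset_commute)
next
  case (par_daimon c p q p1 p2 as bs C cs r1 r2)
  then show ?thesis
    using matched_no_expansion[OF M par_daimon(2), of "as @ [q] @ bs" True p1 p2 C]
    by (simp add: pair_net_def conn_link_def add_mset_commute)
qed

text \<open>The reduction is read backwards from \<open>daimon0\<close>, whose graph is one vertex
  without edges.\<close>

lemma pair_net_reduces_only_if:
  assumes "cut_step\<^sup>*\<^sup>* N daimon0" "N = pair_net P D" "matched \<phi> P D"
  shows "tree_graph (labels \<phi> D)"
  using assms
proof (induction arbitrary: P D rule: converse_rtranclp_induct)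
  case base
  then have "pair_cuts P + pair_links P D = {#Daimon []#}" by (simp add: pair_net_def daimon0_def)
  from filter_daimons[of P P D, unfolded this] have "image_mset Daimon D = {#Daimon []#}" by simp
  then have "D = {#[]#}" by (auto dest!: msed_map_invR)
  then show ?case by (simp add: tree_graph_single)
next
  case (step N N')
  then show ?case using pair_net_step[of \<phi> P D N'] by blast
qed

text \<open>Each step lowers the number of links. Nodes are reduced first. Among leaves, the tree
  condition keeps the two ends of an edge on different daimons, and once no pair is left it admits
  just one daimon, without outputs.\<close>

lemma pair_net_reduces_if:
  assumes "matched \<phi> P D" "tree_graph (labels \<phi> D)"
  shows "cut_step\<^sup>*\<^sup>* (pair_net P D) daimon0"
  using assms
proof (induction "size (links (pair_net P D))" arbitrary: P D rule: less_induct)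
  case less
  have sim: "similar True t u" if "(t, u) \<in># P" for t u
    using less.prems(1) that by (auto simp: matched_def)
  have reduce: ?case if "cut_step (pair_net P D) (pair_net P' D')" "matched \<phi> P' D'" "tree_graph (labels \<phi> D')"
    "size (links (pair_net P' D')) < size (links (pair_net P D))" for P' D'
    using less.hyps[OF that(4,2,3)] that(1) by (rule converse_rtranclp_into_rtranclp[rotated])
  show ?case
  proof (cases "\<exists>(t, u)\<in>#P. t \<noteq> Leaf (root t)")
    case True
    then obtain t u where "(t, u) \<in># P" "t \<noteq> Leaf (root t)" by blast
    then obtain k p a b where tu: "(Node k p a b, u) \<in># P" by (cases t) auto
    with sim obtain q a' b' where u: "u = Node (\<not> k) q a' b'" by (cases u) fastforce+
    obtain P' where P: "P = add_mset (Node k p a b, u) P'" using tu by (meson mset_add)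
    show ?thesis
    proof (cases k)
      case True
      show ?thesis
      proof (rule reduce)
        show "matched \<phi> (add_mset (a, a') (add_mset (b, b') P')) D"
          using less.prems(1) P u True matched_node by auto
        show "cut_step (pair_net P D) (pair_net (add_mset (a, a') (add_mset (b, b') P')) D)"
          using cut_step.par_tensor[of "Cut p q" p q "root a" "root b" "root a'" "root b'"
              "pair_cuts P' + (tree_links a + tree_links b + (tree_links a' + tree_links b') + pair_links P' D)" "[]"]
          by (simp add: pair_net_def pair_links_add pair_cuts_def cut_on_def P u True conn_link_def ac_simps add_mset_commute)
      qed (use less.prems(2) in \<open>auto simp: pair_net_def pair_links_add pair_cuts_def P u\<close>)
    next
      case False
      show ?thesis
      proof (rule reduce)
        show "matched \<phi> (add_mset (a', a) (add_mset (b', b) P')) D"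
          using matched_node[OF matched_swap] less.prems(1) P u False by simp
        show "cut_step (pair_net P D) (pair_net (add_mset (a', a) (add_mset (b', b) P')) D)"
          using cut_step.par_tensor[of "Cut p q" q p "root a'" "root b'" "root a" "root b"
              "pair_cuts P' + (tree_links a + tree_links b + (tree_links a' + tree_links b') + pair_links P' D)" "[]"]
          by (simp add: pair_net_def pair_links_add pair_cuts_def cut_on_def P u False conn_link_def ac_simps add_mset_commute)
      qed (use less.prems(2) in \<open>auto simp: pair_net_def pair_links_add pair_cuts_def P u\<close>)
    qed
  next
    case False
    show ?thesis
    proof (cases "P = {#}")
      case True
      with less.prems(1) have "\<Sum>\<^sub># (vertices D) = {#}" by (simp add: matched_def)
      then have "\<forall>d\<in>#D. d = []" by simp
      moreover from this have "\<Sum>\<^sub># (labels \<phi> D) = {#}" by simp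
      with less.prems(2) have "size D = 1" by (simp add: tree_graph_def)
      then obtain d where "D = {#d#}" using size_1_singleton_mset by blast
      ultimately have "D = {#[]#}" by simp
      with True show ?thesis by (simp add: pair_net_def pair_cuts_def pair_links_def daimon0_def)
    next
      case ne: False
      then obtain t u P' where P: "P = add_mset (t, u) P'" by (metis multiset_cases old.prod.exhaust)
      with False sim obtain p q where t: "t = Leaf p" and u: "u = Leaf q"
        by (cases t; cases u) fastforce+
      have "p \<noteq> q" using less.prems(1) by (auto simp: matched_def P t u simple_union)
      have "\<phi> p = \<phi> q" using less.prems(1) by (auto simp: matched_def P t u)
      have "p \<in># \<Sum>\<^sub># (vertices D)" "q \<in># \<Sum>\<^sub># (vertices D)"
        using less.prems(1) by (auto simp: matched_def P t u)
      then obtain d d' where d: "d \<in># D" "p \<in> set d" "d' \<in># D" "q \<in> set d'" by auto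
      have "d \<noteq> d'"
      proof
        assume "d = d'"
        then obtain e where e: "mset d = add_mset p (add_mset q e)"
          using d \<open>p \<noteq> q\<close> by (metis insert_noteq_member mset_add set_mset_mset)
        obtain D0 where D0: "D = add_mset d D0" using d(1) by (meson mset_add)
        have G: "labels \<phi> D = add_mset (add_mset (\<phi> p) (add_mset (\<phi> p) (image_mset \<phi> e))) (labels \<phi> D0)"
          by (simp add: D0 e \<open>\<phi> p = \<phi> q\<close>)
        show False
          using tree_graph_no_loop[of "\<phi> p" "image_mset \<phi> e" "labels \<phi> D0"]
            less.prems(2) labels_count[OF less.prems(1)] unfolding G by blast
      qed
      obtain D1 where D1: "D = add_mset d D1" using d(1) by (meson mset_add)
      then have "d' \<in># D1" using d(3) \<open>d \<noteq> d'\<close> by auto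
      then obtain D' where "D1 = add_mset d' D'" by (meson mset_add)
      moreover obtain as bs where "d = as @ [p] @ bs" using d(2) by (metis append_Cons append_Nil split_list)
      moreover obtain as' bs' where "d' = as' @ [q] @ bs'" using d(4) by (metis append_Cons append_Nil split_list)
      ultimately have D: "D = {#as @ [p] @ bs, as' @ [q] @ bs'#} + D'" using D1 by simp
      note M = less.prems(1)[unfolded P t u D]
      show ?thesis
      proof (rule reduce)
        show "matched \<phi> P' (add_mset (as @ bs @ as' @ bs') D')" by (rule matched_leaf(1)[OF M])
        show "tree_graph (labels \<phi> (add_mset (as @ bs @ as' @ bs') D'))"
          using less.prems(2) unfolding D matched_leaf(2)[OF M] .
        show "cut_step (pair_net P D) (pair_net P' (add_mset (as @ bs @ as' @ bs') D'))"
          using cut_step.daimon_daimon[of "Cut p q" p q as bs as' bs' "pair_cuts P' + pair_links P' D'" "[]"]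
          by (simp add: pair_net_def pair_links_def pair_cuts_def cut_on_def P t u D ac_simps add_mset_commute)
      qed (auto simp: pair_net_def pair_links_def pair_cuts_def P t u D)
    qed
  qed
qed

lemma matched_forests:
  assumes "list_all2 (similar d) ts us" "map \<phi> (concat (map leaves us)) = concat (map leaves ts)"
  shows "list_all2 (\<lambda>t u. similar d t u \<and> map \<phi> (leaves u) = leaves t) ts us"
  using assms by (induction rule: list_all2_induct) (auto dest: similar_length)

lemma interaction_forest_net:
  assumes ts: "wf_forest ts D" and us: "wf_forest us E" and sim: "list_all2 (similar True) ts us"
    and \<phi>: "map \<phi> (concat (map leaves us)) = concat (map leaves ts)"
  shows "forest_net ts D \<bottom>\<bottom> forest_net us E \<longleftrightarrow> tree_graph (vertices D + labels \<phi> E)"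
proof -
  define A where "A = map (map_tree even_pos) ts"
  define B where "B = map (map_tree odd_pos) us"
  define D' where "D' = image_mset (map even_pos) D + image_mset (map odd_pos) E"
  define P where "P = mset (zip A B)"
  \<comment> \<open>Even positions come from \<open>ts\<close> and recover their names; odd ones
    come from \<open>us\<close> and are sent by \<open>\<phi>\<close> to the leaf of
    \<open>ts\<close> that they will meet. Thus the leaves of \<open>ts\<close> name all
    edges.\<close>
  define \<psi> where "\<psi> n = (if even n then n div 2 else \<phi> (n div 2))" for n
  have len: "length ts = length us" using sim by (rule list_all2_lengthD)
  then have lenAB: "length A = length B" by (simp add: A_def B_def)
  have lenB: "length B = length us" by (simp add: B_def)
  have "interaction (forest_net ts D) (forest_net us E) = pair_net P D'"
  proof -
    have "pair_cuts P = mset (map (\<lambda>(p, q). Cut p q) (zip (map root A) (map root B)))"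
      by (simp add: pair_cuts_def P_def zip_map_map case_prod_unfold comp_def flip: mset_map)
    moreover have "pair_links P D' = sum_list (map tree_links A) + sum_list (map tree_links B) + image_mset Daimon D'"
      using lenAB by (simp add: pair_links_def P_def sum_mset_sum_list flip: mset_map)
    ultimately show ?thesis
      using len lenAB lenB unfolding interaction_def even_copy_def odd_copy_def rename_forest_net
        A_def[symmetric] B_def[symmetric] Let_def
      by (simp add: pair_net_def D'_def add.assoc add.left_commute add.commute)
  qed
  moreover have "matched \<psi> P D'"
  proof -
    have sum: "\<Sum>\<^sub># (image_mset f (pair_trees P)) = sum_list (map f A) + sum_list (map f B)"
      for f :: "pos tree \<Rightarrow> pos multiset"
      using lenAB by (simp add: P_def sum_mset_sum_list flip: mset_map)
    have wf: "wf_forest (A @ B) D'"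
      unfolding A_def B_def D'_def by (rule wf_forest_juxtapose[OF ts us])
    have "list_all2 (\<lambda>t u. similar True t u \<and> map \<phi> (leaves u) = leaves t) ts us"
      by (rule matched_forests[OF sim \<phi>])
    then have "list_all2 (\<lambda>t u. similar True t u \<and> map \<psi> (leaves t) = map \<psi> (leaves u)) A B"
      unfolding A_def B_def list_all2_map1 list_all2_map2
      by (rule list_all2_mono) (auto simp: \<psi>_def comp_def)
    then have pairs: "\<forall>(t, u)\<in>#P. similar True t u \<and> map \<psi> (leaves t) = map \<psi> (leaves u)"
      unfolding P_def list_all2_iff by auto
    have "image_mset (\<lambda>(t, u). image_mset \<psi> (mset (leaves t))) P =
        image_mset (\<lambda>t. image_mset \<psi> (mset (leaves t))) (mset A)"
    proof -
      have "mset A = image_mset fst P" using lenAB by (simp add: P_def flip: mset_map)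
      then show ?thesis by (simp add: multiset.map_comp comp_def case_prod_unfold)
    qed
    also have "\<Sum>\<^sub># \<dots> = forest_leaves ts"
      unfolding A_def by (induction ts) (auto simp: \<psi>_def multiset.map_comp comp_def)
    finally have "simple (\<Sum>\<^sub># (image_mset (\<lambda>(t, u). image_mset \<psi> (mset (leaves t))) P))"
      using wf_forest_simple[OF ts] by simp
    with wf pairs show ?thesis unfolding matched_def wf_forest_def sum by simp
  qed
  moreover have "labels \<psi> D' = vertices D + labels \<phi> E"
    by (simp add: D'_def \<psi>_def multiset.map_comp comp_def)
  ultimately show ?thesis
    unfolding orthogonal_def using pair_net_reduces_if pair_net_reduces_only_if by metis
qed

section \<open>Orthogonality and juxtaposition\<close>

text \<open>Exchanging the two nets of an interaction reverses its cut links, and the constructor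
  \<open>Cut\<close> is ordered; sorting the inputs removes the difference.\<close>

fun unorient :: "link \<Rightarrow> link" where
  "unorient (Cut p q) = Cut (min p q) (max p q)"
| "unorient l = l"

definition same_net :: "net \<Rightarrow> net \<Rightarrow> bool" where
  "same_net N M \<longleftrightarrow> concl N = concl M \<and> image_mset unorient (links N) = image_mset unorient (links M)"

lemma unorient_eq:
  "unorient l = Par p1 p2 p \<longleftrightarrow> l = Par p1 p2 p"
  "unorient l = Tensor p1 p2 p \<longleftrightarrow> l = Tensor p1 p2 p"
  "unorient l = Daimon ps \<longleftrightarrow> l = Daimon ps"
  by (cases l; auto)+

lemma unorient_cut_on: "c \<in> cut_on p q \<Longrightarrow> unorient c' = unorient c \<Longrightarrow> c' \<in> cut_on p q"
  by (cases c') (auto simp: cut_on_def min_def max_def split: if_splits)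

lemma unorient_ends: "set (source (unorient l)) = set (source l)" "target (unorient l) = target l"
  by (cases l; auto simp: min_def max_def)+

lemma same_net_positions: "same_net N M \<Longrightarrow> positions N = positions M"
proof -
  have "positions N = (\<Union>l\<in>set_mset (image_mset unorient (links N)). set (source l) \<union> set (target l))" for N
    by (simp add: positions_def unorient_ends)
  then show "same_net N M \<Longrightarrow> positions N = positions M" by (simp only: same_net_def)
qed

text \<open>Through \<open>cut_on\<close> all rules accept a cut in both orientations, so a step on
  one net can be copied on the other.\<close>

lemma same_net_step:
  assumes "cut_step N N'" "same_net N M"
  shows "\<exists>M'. cut_step M M' \<and> same_net N' M'"
  using assms(1)
proof cases
  case (par_tensor c p q p1 p2 q1 q2 C cs)
  with assms(2) have "image_mset unorient (links M) =
      add_mset (Par p1 p2 p) (add_mset (unorient c) (add_mset (Tensor q1 q2 q) (image_mset unorient C)))"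
    and cs: "concl M = cs" by (auto simp: same_net_def)
  then obtain c' C' where "links M = {#Par p1 p2 p, c', Tensor q1 q2 q#} + C'"
    and C': "unorient c' = unorient c" "image_mset unorient C' = image_mset unorient C"
    by (auto dest!: msed_map_invR simp: unorient_eq)
  then have M: "M = Net ({#Par p1 p2 p, c', Tensor q1 q2 q#} + C') cs"
    using cs by (metis net.collapse)
  show ?thesis unfolding M par_tensor(2)
    by (intro exI conjI, rule cut_step.par_tensor[OF unorient_cut_on[OF par_tensor(3) C'(1)]])
      (simp add: same_net_def C')
next
  case (daimon_daimon c p q as bs as' bs' C cs)
  with assms(2) have "image_mset unorient (links M) =
      add_mset (Daimon (as @ [p] @ bs)) (add_mset (unorient c) (add_mset (Daimon (as' @ [q] @ bs')) (image_mset unorient C)))"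
    and cs: "concl M = cs" by (auto simp: same_net_def)
  then obtain c' C' where "links M = {#Daimon (as @ [p] @ bs), c', Daimon (as' @ [q] @ bs')#} + C'"
    and C': "unorient c' = unorient c" "image_mset unorient C' = image_mset unorient C"
    by (auto dest!: msed_map_invR simp: unorient_eq)
  then have M: "M = Net ({#Daimon (as @ [p] @ bs), c', Daimon (as' @ [q] @ bs')#} + C') cs"
    using cs by (metis net.collapse)
  show ?thesis unfolding M daimon_daimon(2)
    by (intro exI conjI, rule cut_step.daimon_daimon[OF unorient_cut_on[OF daimon_daimon(3) C'(1)]])
      (simp add: same_net_def C')
next
  case (tensor_daimon c p q p1 p2 as bs C cs r1 r2)
  with assms(2) have "image_mset unorient (links M) =
      add_mset (Tensor p1 p2 p) (add_mset (unorient c) (add_mset (Daimon (as @ [q] @ bs)) (image_mset unorient C)))"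
    and cs: "concl M = cs" by (auto simp: same_net_def)
  then obtain c' C' where "links M = {#Tensor p1 p2 p, c', Daimon (as @ [q] @ bs)#} + C'"
    and C': "unorient c' = unorient c" "image_mset unorient C' = image_mset unorient C"
    by (auto dest!: msed_map_invR simp: unorient_eq)
  then have M: "M = Net ({#Tensor p1 p2 p, c', Daimon (as @ [q] @ bs)#} + C') cs"
    using cs by (metis net.collapse)
  have pos: "positions M = positions N" using same_net_positions[OF assms(2)] ..
  show ?thesis unfolding tensor_daimon(1)
    by (intro exI conjI, rule cut_step.tensor_daimon[OF unorient_cut_on[OF tensor_daimon(2) C'(1)] M])
      (use tensor_daimon pos in \<open>simp_all add: same_net_def C'\<close>)
next
  case (par_daimon c q p q1 q2 as bs C cs r1 r2 as' as'' bs' bs'')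
  with assms(2) have "image_mset unorient (links M) =
      add_mset (Par q1 q2 q) (add_mset (unorient c) (add_mset (Daimon (as @ [p] @ bs)) (image_mset unorient C)))"
    and cs: "concl M = cs" by (auto simp: same_net_def)
  then obtain c' C' where "links M = {#Par q1 q2 q, c', Daimon (as @ [p] @ bs)#} + C'"
    and C': "unorient c' = unorient c" "image_mset unorient C' = image_mset unorient C"
    by (auto dest!: msed_map_invR simp: unorient_eq)
  then have M: "M = Net ({#Par q1 q2 q, c', Daimon (as @ [p] @ bs)#} + C') cs"
    using cs by (metis net.collapse)
  have pos: "positions M = positions N" using same_net_positions[OF assms(2)] ..
  show ?thesis unfolding par_daimon(1)
    by (intro exI conjI, rule cut_step.par_daimon[OF unorient_cut_on[OF par_daimon(2) C'(1)] M _ _ par_daimon(6,7,8)])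
      (use par_daimon pos in \<open>simp_all add: same_net_def C'\<close>)
qed

lemma map_link_ends [simp]:
  "source (map_link f g l) = map f (source l)" "target (map_link f g l) = map g (target l)"
  by (cases l; simp)+

lemma positions_rename: "positions (rename f S) = f ` positions S"
  by (auto simp: positions_def rename_def)

lemma cut_on_map: "c \<in> cut_on p q \<Longrightarrow> map_link f f c \<in> cut_on (f p) (f q)"
  by (auto simp: cut_on_def)

text \<open>Injectivity keeps the new positions of the expansion rules fresh and distinct.\<close>

lemma cut_step_rename:
  assumes "inj f" "cut_step N N'"
  shows "cut_step (rename f N) (rename f N')"
  using assms(2)
proof cases
  case (par_tensor c p q p1 p2 q1 q2 C cs)
  then show ?thesis
    using cut_step.par_tensor[OF cut_on_map[OF par_tensor(3), of f], of "f p1" "f p2" "f q1" "f q2"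
      "image_mset (map_link f f) C" "map f cs"] by (simp add: rename_def)
next
  case (daimon_daimon c p q as bs as' bs' C cs)
  then show ?thesis
    using cut_step.daimon_daimon[OF cut_on_map[OF daimon_daimon(3), of f], of "map f as" "map f bs" "map f as'" "map f bs'"
      "image_mset (map_link f f) C" "map f cs"] by (simp add: rename_def)
next
  case (tensor_daimon c p q p1 p2 as bs C cs r1 r2)
  have "f r1 \<notin> positions (rename f N)" "f r2 \<notin> positions (rename f N)" "f r1 \<noteq> f r2"
    using tensor_daimon assms(1) by (auto simp: positions_rename inj_image_mem_iff dest: injD)
  then show ?thesis
    using cut_step.tensor_daimon[OF cut_on_map[OF tensor_daimon(2), of f], of "rename f N" "f p1" "f p2" "map f as" "map f bs"
      "image_mset (map_link f f) C" "map f cs"] tensor_daimon(1,3) by (simp add: rename_def)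
next
  case (par_daimon c q p q1 q2 as bs C cs r1 r2 as' as'' bs' bs'')
  have "f r1 \<notin> positions (rename f N)" "f r2 \<notin> positions (rename f N)" "f r1 \<noteq> f r2"
    using par_daimon assms(1) by (auto simp: positions_rename inj_image_mem_iff dest: injD)
  moreover have "mset (map f as') + mset (map f as'') = mset (map f as)"
    "mset (map f bs') + mset (map f bs'') = mset (map f bs)"
    using par_daimon by (metis image_mset_union mset_map)+
  ultimately show ?thesis
    using cut_step.par_daimon[OF cut_on_map[OF par_daimon(2), of f], of "rename f N" "f q1" "f q2" "map f as" "map f bs"
      "image_mset (map_link f f) C" "map f cs" "f r1" "f r2" "map f as'" "map f as''" "map f bs'" "map f bs''"]
      par_daimon(1,3) by (simp add: rename_def)
qed

lemma reduces_rename: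
  assumes "cut_step\<^sup>*\<^sup>* N daimon0" "inj f"
  shows "cut_step\<^sup>*\<^sup>* (rename f N) daimon0"
  using assms(1)
proof (induction rule: converse_rtranclp_induct)
  case base
  have "rename f daimon0 = daimon0" by (simp add: rename_def daimon0_def)
  then show ?case by simp
next
  case (step N N')
  then show ?case using cut_step_rename[OF assms(2)] by (meson converse_rtranclp_into_rtranclp)
qed

lemma reduces_same_net:
  assumes "cut_step\<^sup>*\<^sup>* N daimon0" "same_net N M"
  shows "cut_step\<^sup>*\<^sup>* M daimon0"
  using assms
proof (induction arbitrary: M rule: converse_rtranclp_induct)
  case base
  then have "image_mset unorient (links M) = {#Daimon []#}" "concl M = []"
    by (simp_all add: same_net_def daimon0_def)
  then have "links M = {#Daimon []#}"
    by (auto dest!: msed_map_invR simp: unorient_eq)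
  with \<open>concl M = []\<close> have "M = daimon0" unfolding daimon0_def by (metis net.collapse)
  then show ?case by simp
next
  case (step N N')
  then show ?case using same_net_step by (meson converse_rtranclp_into_rtranclp)
qed

lemma reduces_concl: "cut_step\<^sup>*\<^sup>* N N' \<Longrightarrow> concl N = concl N'"
proof (induction rule: rtranclp_induct)
  case (step y z)
  from step(2) have "concl y = concl z" by cases auto
  with step show ?case by simp
qed simp

text \<open>Reduction preserves the conclusions and \<open>daimon0\<close> has none, so no
  conclusion of either net can be left uncut.\<close>

lemma orthogonal_length: "S \<bottom>\<bottom> T \<Longrightarrow> length (concl S) = length (concl T)"
  unfolding orthogonal_def
  by (drule reduces_concl) (auto simp: interaction_def Let_def daimon0_def even_copy_def odd_copy_def rename_def)

lemma map_link_comp: "map_link f f (map_link g g l) = map_link (f \<circ> g) (f \<circ> g) l"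
  by (cases l) auto

lemma rename_comp: "rename f (rename g S) = rename (f \<circ> g) S"
  by (simp add: rename_def multiset.map_comp map_link_comp comp_def[of "map_link f f"])

lemma interaction_eq:
  "length (concl S) = length (concl T) \<Longrightarrow> interaction S T =
    Net (links (even_copy S) + links (odd_copy T) +
      mset (map (\<lambda>(p, q). Cut p q) (zip (concl (even_copy S)) (concl (odd_copy T))))) []"
  by (simp add: interaction_def Let_def even_copy_def odd_copy_def rename_def)

lemma unorient_zip:
  "image_mset unorient (mset (map (\<lambda>(p, q). Cut p q) (zip xs ys))) =
   image_mset unorient (mset (map (\<lambda>(p, q). Cut p q) (zip ys xs)))"
  by (induction xs ys rule: list_induct2') (auto simp: min.commute max.commute)

lemma map_Cut_zip: "map (map_link f f) (map (\<lambda>(p, q). Cut p q) (zip xs ys)) =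
    map (\<lambda>(p, q). Cut p q) (zip (map f xs) (map f ys))"
  by (simp add: zip_map_map case_prod_unfold)

lemma orthogonal_sym:
  assumes "S \<bottom>\<bottom> T"
  shows "T \<bottom>\<bottom> S"
proof -
  \<comment> \<open>Exchanges 2n and 2n + 1, hence the even and the odd copies.\<close>
  define f :: "pos \<Rightarrow> pos" where "f n = (if even n then n + 1 else n - 1)" for n
  have "f (f n) = n" for n by (auto simp: f_def)
  then have "inj f" by (metis injI)
  have f: "f \<circ> even_pos = odd_pos" "f \<circ> odd_pos = even_pos" by (auto simp: f_def)
  have len: "length (concl S) = length (concl T)" using assms by (rule orthogonal_length)
  have copies: "rename f (even_copy S) = odd_copy S" "rename f (odd_copy T) = even_copy T"
    unfolding even_copy_def odd_copy_def rename_comp f by simp_all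
  have concl: "map f (concl (even_copy S)) = concl (odd_copy S)" "map f (concl (odd_copy T)) = concl (even_copy T)"
    and links: "image_mset (map_link f f) (links (even_copy S)) = links (odd_copy S)"
      "image_mset (map_link f f) (links (odd_copy T)) = links (even_copy T)"
    unfolding copies[symmetric] by (simp_all add: rename_def)
  have "rename f (interaction S T) = Net (links (odd_copy S) + links (even_copy T) +
      mset (map (\<lambda>(p, q). Cut p q) (zip (concl (odd_copy S)) (concl (even_copy T))))) []"
    unfolding interaction_eq[OF len] rename_def net.sel image_mset_union links mset_map[symmetric] map_Cut_zip concl
    by simp
  then have "same_net (rename f (interaction S T)) (interaction T S)"
    unfolding interaction_eq[OF len[symmetric]] same_net_def net.sel image_mset_union
    using unorient_zip by (simp add: add.commute)
  moreover have "cut_step\<^sup>*\<^sup>* (rename f (interaction S T)) daimon0"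
    using assms \<open>inj f\<close> unfolding orthogonal_def by (rule reduces_rename)
  ultimately show ?thesis unfolding orthogonal_def using reduces_same_net by blast
qed

lemma targets_rename: "targets (links (rename f S)) = image_mset f (targets (links S))"
  by (simp add: rename_def targets_def multiset.map_comp comp_def sum_image_image[symmetric])

lemma sources_rename: "sources (links (rename f S)) = image_mset f (sources (links S))"
  by (simp add: rename_def sources_def multiset.map_comp comp_def sum_image_image[symmetric])

lemma is_net_rename:
  assumes "inj f" "is_net S"
  shows "is_net (rename f S)"
proof -
  have "distinct (source l) \<and> set (source l) \<inter> set (target l) = {}" if l: "l \<in># links (rename f S)" for l
  proof -
    obtain l' where l': "l' \<in># links S" "l = map_link f f l'" using l by (auto simp: rename_def)
    with assms(2) have "distinct (source l') \<and> set (source l') \<inter> set (target l') = {}" by (auto simp: is_net_iff)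
    then show ?thesis using assms(1) unfolding l'(2)
      by (auto simp: distinct_map inj_on_subset[of f UNIV] dest: injD)
  qed
  moreover have "mset (concl (rename f S)) + sources (links (rename f S)) = targets (links (rename f S))"
    using assms(2) unfolding targets_rename sources_rename is_net_iff
    by (metis image_mset_union mset_map net.sel(2) rename_def)
  moreover have "simple (targets (links (rename f S)))"
    using assms by (simp add: targets_rename simple_image is_net_iff)
  ultimately show ?thesis unfolding is_net_iff by blast
qed

lemma targets_even_odd:
  "is_net S \<Longrightarrow> is_net T \<Longrightarrow> simple (targets (links (even_copy S)) + targets (links (odd_copy T)))"
  using even_odd_disjoint inj_even_odd unfolding even_copy_def odd_copy_def targets_rename
  by (simp only: simple_union is_net_iff simple_image) blast

lemma is_net_juxtapose:
  assumes "is_net S" "is_net T"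
  shows "is_net (juxtapose S T)"
proof -
  have "is_net (even_copy S)" "is_net (odd_copy T)"
    unfolding even_copy_def odd_copy_def using assms inj_even_odd is_net_rename by blast+
  then show ?thesis using targets_even_odd[OF assms]
    unfolding is_net_iff juxtapose_def by (auto simp: ac_simps simple_union)
qed

text \<open>Partial application of \<open>Q\<close> to \<open>T\<close>, used to peel the last
  component off a juxtaposition. It is meant for \<open>Q\<close> with a conclusion and
  \<open>T\<close> with exactly one, so that \<open>last\<close> and \<open>hd\<close> are proper
  values.\<close>

definition cut_last :: "net \<Rightarrow> net \<Rightarrow> net" where
  "cut_last Q T = Net (links (even_copy Q) + links (odd_copy T) +
      {#Cut (last (concl (even_copy Q))) (hd (concl (odd_copy T)))#}) (butlast (concl (even_copy Q)))"

lemma is_net_cut_last: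
  assumes "is_net Q" "is_net T" "concl Q \<noteq> []" "length (concl T) = 1"
  shows "is_net (cut_last Q T)"
proof -
  have nets: "is_net (even_copy Q)" "is_net (odd_copy T)"
    unfolding even_copy_def odd_copy_def using assms inj_even_odd is_net_rename by blast+
  obtain qs q where q: "concl Q = qs @ [q]" using assms(3) by (metis rev_exhaust)
  obtain t where t: "concl T = [t]" using assms(4) by (auto simp: length_Suc_conv)
  have c: "concl (even_copy Q) = map even_pos qs @ [even_pos q]" "concl (odd_copy T) = [odd_pos t]"
    by (simp_all add: even_copy_def odd_copy_def rename_def q t)
  have "even_pos q \<noteq> odd_pos t" by presburger
  then show ?thesis
    using nets targets_even_odd[OF assms(1,2)]
    unfolding is_net_iff cut_last_def c by (auto simp: ac_simps simple_union)
qed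

text \<open>Both interactions consist of the same links and cuts; they differ in the encoding of
  positions only.\<close>

lemma orthogonal_juxtapose:
  assumes "concl Q = qs @ [q]" "concl T = [t]" "length qs = length (concl P)"
  shows "Q \<bottom>\<bottom> juxtapose P T \<longleftrightarrow> cut_last Q T \<bottom>\<bottom> P"
proof -
  \<comment> \<open>In the first interaction \<open>Q\<close>, \<open>P\<close> and \<open>T\<close>
    occupy the positions 2n, 4n + 1 and 4n + 3, in the second 4n, 2n + 1 and 4n + 2. The function
    \<open>f\<close> translates, and \<open>g\<close> is its inverse.\<close>
  define f :: "pos \<Rightarrow> pos" where
    "f n = (if even n then 2 * n else if n mod 4 = 1 then (n + 1) div 2 else n - 1)" for n
  define g :: "pos \<Rightarrow> pos" where
    "g n = (if odd n then 2 * n - 1 else if n mod 4 = 0 then n div 2 else n + 1)" for n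
  have mods: "(2 * (2 * n)) mod 4 = 0" "(2 * (2 * n) + 1) mod 4 = 1" "(2 * (2 * n + 1)) mod 4 = 2"
    "(2 * (2 * n + 1) + 1) mod 4 = 3" for n :: nat by presburger+
  have f': "f (2 * n) = 2 * (2 * n)" "f (2 * (2 * n) + 1) = 2 * n + 1"
    "f (2 * (2 * n + 1) + 1) = 2 * (2 * n + 1)" for n
    using mods[of n] by (simp_all add: f_def)
  have g': "g (2 * (2 * n)) = 2 * n" "g (2 * n + 1) = 2 * (2 * n) + 1"
    "g (2 * (2 * n + 1)) = 2 * (2 * n + 1) + 1" for n
    using mods[of n] by (simp_all add: g_def)
  have "g (f n) = n" for n
  proof -
    have "\<exists>a. n = 2 * a \<or> n = 2 * (2 * a) + 1 \<or> n = 2 * (2 * a + 1) + 1" by presburger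
    then obtain a where "n = 2 * a \<or> n = 2 * (2 * a) + 1 \<or> n = 2 * (2 * a + 1) + 1" by blast
    then show ?thesis using f'[of a] g'[of a] by presburger
  qed
  then have "inj f" by (metis injI)
  have "f (g n) = n" for n
  proof -
    have "\<exists>a. n = 2 * (2 * a) \<or> n = 2 * a + 1 \<or> n = 2 * (2 * a + 1)" by presburger
    then obtain a where "n = 2 * (2 * a) \<or> n = 2 * a + 1 \<or> n = 2 * (2 * a + 1)" by blast
    then show ?thesis using f'[of a] g'[of a] by presburger
  qed
  then have "surj f" by (metis surjI)
  have f: "f \<circ> even_pos = even_pos \<circ> even_pos" "f \<circ> (odd_pos \<circ> even_pos) = odd_pos"
    "f \<circ> (odd_pos \<circ> odd_pos) = even_pos \<circ> odd_pos"
    using f' by (auto simp: fun_eq_iff)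
  define N where "N = interaction Q (juxtapose P T)"
  have rN: "rename f N = interaction (cut_last Q T) P"
  proof -
    have len: "length (concl Q) = length (concl (juxtapose P T))" "length (concl (cut_last Q T)) = length (concl P)"
      using assms by (simp_all add: juxtapose_def cut_last_def even_copy_def odd_copy_def rename_def)
    have even_cut: "even_copy (cut_last Q T) = Net (links (even_copy (even_copy Q)) + links (even_copy (odd_copy T)) +
        {#Cut (2 * (2 * q)) (2 * (2 * t + 1))#}) (map even_pos (map even_pos qs))"
      by (simp add: cut_last_def even_copy_def odd_copy_def rename_def assms(1,2))
    have odd_juxt: "odd_copy (juxtapose P T) = Net (links (odd_copy (even_copy P)) + links (odd_copy (odd_copy T)))
        (map odd_pos (map even_pos (concl P)) @ [2 * (2 * t + 1) + 1])"
      by (simp add: juxtapose_def even_copy_def odd_copy_def rename_def assms(2))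
    have "rename f (even_copy Q) = even_copy (even_copy Q)" "rename f (odd_copy (even_copy P)) = odd_copy P"
      "rename f (odd_copy (odd_copy T)) = even_copy (odd_copy T)"
      unfolding even_copy_def odd_copy_def rename_comp f by simp_all
    then have links_f: "image_mset (map_link f f) (links (even_copy Q)) = links (even_copy (even_copy Q))"
      "image_mset (map_link f f) (links (odd_copy (even_copy P))) = links (odd_copy P)"
      "image_mset (map_link f f) (links (odd_copy (odd_copy T))) = links (even_copy (odd_copy T))"
      by (metis rename_def net.sel(1))+
    have concl: "concl (even_copy Q) = map even_pos qs @ [2 * q]" "concl (odd_copy P) = map odd_pos (concl P)"
      by (simp_all add: even_copy_def odd_copy_def rename_def assms(1))
    have zip: "zip (map f (concl (even_copy Q))) (map f (map odd_pos (map even_pos (concl P)) @ [2 * (2 * t + 1) + 1])) =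
        zip (map even_pos (map even_pos qs)) (concl (odd_copy P)) @ [(2 * (2 * q), 2 * (2 * t + 1))]"
    proof -
      have 1: "map f (concl (even_copy Q)) = map even_pos (map even_pos qs) @ [2 * (2 * q)]"
        unfolding concl by (simp only: map_append list.map map_map f f' comp_def)
      have 2: "map f (map odd_pos (map even_pos (concl P)) @ [2 * (2 * t + 1) + 1]) =
          concl (odd_copy P) @ [2 * (2 * t + 1)]"
        unfolding concl by (simp only: map_append list.map map_map f' comp_def)
      show ?thesis
        unfolding 1 2 by (subst zip_append) (simp_all add: assms(3) concl)
    qed
    show ?thesis
      unfolding N_def interaction_eq[OF len(1)] interaction_eq[OF len(2)] odd_juxt even_cut
      unfolding rename_def net.sel image_mset_union links_f mset_map[symmetric] map_Cut_zip zip
      by (simp only: map_append mset_append list.map prod.case mset.simps add.commute add.left_commute add.assoc)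
  qed
  have "rename (inv f) (rename f N) = N"
  proof -
    have "inv f \<circ> f = id" using \<open>inj f\<close> by simp
    moreover have "map_link id id l = l" for l by (cases l) auto
    then have "map_link id id = id" by (simp add: fun_eq_iff)
    then have "rename id N = N" by (simp add: rename_def)
    ultimately show ?thesis by (simp add: rename_comp)
  qed
  moreover have "inj (inv f)" using \<open>surj f\<close> by (rule surj_imp_inj_inv)
  ultimately have "cut_step\<^sup>*\<^sup>* N daimon0 \<longleftrightarrow> cut_step\<^sup>*\<^sup>* (rename f N) daimon0"
    using reduces_rename \<open>inj f\<close> by metis
  then show ?thesis unfolding orthogonal_def rN unfolding N_def .
qed

section \<open>Biorthogonals of juxtapositions\<close>

lemma orth_orth_subset:
  assumes "\<And>S. S \<in> X \<Longrightarrow> is_net S"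
  shows "X \<subseteq> orth (orth X)"
  using assms orthogonal_sym by (auto simp: orth_def orthogonal_set_def)

text \<open>The triple orthogonal agrees with the single one: \<open>Q\<close> lies in
  \<open>orth X\<close>, every element of the biorthogonal is orthogonal to it, and orthogonality is
  symmetric.\<close>

lemma orthogonal_orth_orth:
  assumes "is_net Q" "orthogonal_set Q X"
  shows "orthogonal_set Q (orth (orth X))"
  using assms orthogonal_sym unfolding orth_def orthogonal_set_def by blast

fun juxtapositions :: "net list \<Rightarrow> net" where
  "juxtapositions [] = empty_net"
| "juxtapositions (T # Ts) = foldl juxtapose T Ts"

lemma foldl_par_set_nets:
  assumes "\<And>T. T \<in> X \<Longrightarrow> is_net T" "T \<in> foldl par_set X Xs"
  shows "is_net T"
  using assms by (cases Xs rule: rev_cases) (auto simp: par_set_def orth_def)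

lemma foldl_juxtapose_in:
  assumes "\<forall>X\<in>set (X # Xs). \<forall>T\<in>X. is_net T" "T \<in> X" "list_all2 (\<in>) Ts Xs"
  shows "foldl juxtapose T Ts \<in> foldl par_set X Xs"
  using assms(3,1)
proof (induction Xs arbitrary: Ts rule: rev_induct)
  case Nil
  then show ?case using assms(2) by simp
next
  case (snoc Y Xs)
  then obtain Ts' U where Ts: "Ts = Ts' @ [U]" "list_all2 (\<in>) Ts' Xs" "U \<in> Y"
    by (auto simp: list_all2_append2 list_all2_Cons2)
  let ?G = "{juxtapose S T |S T. S \<in> foldl par_set X Xs \<and> T \<in> Y}"
  have "is_net S" if "S \<in> ?G" for S
    using that snoc.prems(2) foldl_par_set_nets[of X _ Xs] by (auto intro!: is_net_juxtapose)
  then have "?G \<subseteq> orth (orth ?G)" by (rule orth_orth_subset)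
  moreover have "foldl juxtapose T Ts' \<in> foldl par_set X Xs" using snoc.IH[OF Ts(2)] snoc.prems(2) by simp
  ultimately show ?case using Ts unfolding Ts(1) foldl_append by (auto simp: par_set_def)
qed

text \<open>By \<open>orthogonal_orth_orth\<close> it is enough to consider
  \<open>juxtapose P T\<close>, but \<open>P\<close> still ranges over a biorthogonal. Moving
  \<open>T\<close> to the other side makes \<open>cut_last Q T\<close> the net for the induction
  hypothesis; hence \<open>Q\<close> is generalised to arbitrary nets, possibly with cuts.\<close>

lemma orthogonal_foldl_par_set:
  assumes "\<forall>X\<in>set (X # Xs). \<forall>T\<in>X. is_net T \<and> length (concl T) = 1"
    "is_net Q" "length (concl Q) = Suc (length Xs)"
    "\<And>T Ts. T \<in> X \<Longrightarrow> list_all2 (\<in>) Ts Xs \<Longrightarrow> Q \<bottom>\<bottom> foldl juxtapose T Ts"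
  shows "orthogonal_set Q (foldl par_set X Xs)"
  using assms
proof (induction Xs arbitrary: Q rule: rev_induct)
  case Nil
  then show ?case by (auto simp: orthogonal_set_def)
next
  case (snoc Y Xs)
  let ?G = "{juxtapose S T |S T. S \<in> foldl par_set X Xs \<and> T \<in> Y}"
  have "Q \<bottom>\<bottom> juxtapose P T" if P: "P \<in> foldl par_set X Xs" and T: "T \<in> Y" for P T
  proof -
    have T': "is_net T" "length (concl T) = 1" using snoc.prems(1) T by auto
    then obtain t where t: "concl T = [t]" by (auto simp: length_Suc_conv)
    obtain qs q where q: "concl Q = qs @ [q]" using snoc.prems(3) by (metis length_Suc_conv_rev)
    then have qs: "length qs = Suc (length Xs)" using snoc.prems(3) by simp
    have len: "length (concl (cut_last Q T)) = length qs"
      by (simp add: cut_last_def even_copy_def rename_def q)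
    have "orthogonal_set (cut_last Q T) (foldl par_set X Xs)"
    proof (rule snoc.IH)
      show "is_net (cut_last Q T)" using snoc.prems(2) T' q by (intro is_net_cut_last) auto
      show "length (concl (cut_last Q T)) = Suc (length Xs)" using len qs by simp
      show "cut_last Q T \<bottom>\<bottom> foldl juxtapose U Us" if U: "U \<in> X" "list_all2 (\<in>) Us Xs" for U Us
      proof -
        have "Q \<bottom>\<bottom> foldl juxtapose U (Us @ [T])"
          using snoc.prems(4)[OF U(1), of "Us @ [T]"] list_all2_appendI[OF U(2), of "[T]" "[Y]"] T by simp
        then have Q: "Q \<bottom>\<bottom> juxtapose (foldl juxtapose U Us) T" by simp
        from orthogonal_length[OF this] have "length qs = length (concl (foldl juxtapose U Us))"
          by (simp add: q t juxtapose_def even_copy_def odd_copy_def rename_def)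
        with Q q t show ?thesis by (simp add: orthogonal_juxtapose)
      qed
    qed (use snoc.prems(1) in auto)
    then have P': "cut_last Q T \<bottom>\<bottom> P" using P by (simp add: orthogonal_set_def)
    \<comment> \<open>Membership of \<open>P\<close> in a biorthogonal does not display its number
      of conclusions; orthogonality to \<open>cut_last Q T\<close> provides it.\<close>
    from orthogonal_length[OF this] len have "length qs = length (concl P)" by simp
    with P' q t show ?thesis by (simp add: orthogonal_juxtapose)
  qed
  then have "orthogonal_set Q ?G" by (auto simp: orthogonal_set_def)
  moreover have "foldl par_set X (Xs @ [Y]) = orth (orth ?G)"
    by (simp add: par_set_def[of "foldl par_set X Xs" Y])
  ultimately show ?case using orthogonal_orth_orth[OF snoc.prems(2)] by simp
qed

theorem orthogonal_par_sets:
  assumes "\<forall>X\<in>set Xs. \<forall>T\<in>X. is_net T \<and> length (concl T) = 1"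
    "is_net Q" "length (concl Q) = length Xs"
  shows "orthogonal_set Q (par_sets Xs) \<longleftrightarrow>
    (\<forall>Ts. list_all2 (\<in>) Ts Xs \<longrightarrow> Q \<bottom>\<bottom> juxtapositions Ts)"
proof (cases Xs)
  case Nil
  have "is_net empty_net" by (simp add: is_net_iff empty_net_def)
  then have "empty_net \<in> orth (orth {empty_net})" using orth_orth_subset[of "{empty_net}"] by blast
  then show ?thesis
    using Nil orthogonal_orth_orth[OF assms(2), of "{empty_net}"] by (auto simp: orthogonal_set_def)
next
  case (Cons X Xs')
  show ?thesis
  proof
    assume Q: "orthogonal_set Q (par_sets Xs)"
    show "\<forall>Ts. list_all2 (\<in>) Ts Xs \<longrightarrow> Q \<bottom>\<bottom> juxtapositions Ts"
    proof (intro allI impI)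
      fix Ts assume "list_all2 (\<in>) Ts Xs"
      then obtain T Ts' where "Ts = T # Ts'" "T \<in> X" "list_all2 (\<in>) Ts' Xs'"
        unfolding Cons by (auto simp: list_all2_Cons2)
      then show "Q \<bottom>\<bottom> juxtapositions Ts"
        using Q foldl_juxtapose_in[of X Xs' T Ts'] assms(1) by (auto simp: Cons orthogonal_set_def)
    qed
  next
    assume Q: "\<forall>Ts. list_all2 (\<in>) Ts Xs \<longrightarrow> Q \<bottom>\<bottom> juxtapositions Ts"
    have "Q \<bottom>\<bottom> foldl juxtapose T Ts" if "T \<in> X" "list_all2 (\<in>) Ts Xs'" for T Ts
      using Q[rule_format, of "T # Ts"] that Cons by simp
    then show "orthogonal_set Q (par_sets Xs)"
      using orthogonal_foldl_par_set[of X Xs' Q] assms unfolding Cons by simp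
  qed
qed

section \<open>Switchings of nets\<close>

lemma subtree_context: "subtree s t \<Longrightarrow> \<exists>c. tree_context c \<and> t = c s"
  using replace_exists replace_context by metis

lemma conn_link_subtree:
  "conn_link k p1 p2 p \<in># tree_links t \<Longrightarrow> \<exists>a b. subtree (Node k p a b) t \<and> root a = p1 \<and> root b = p2"
  by (induction t) auto

lemma pars_subtree: "pars t > 0 \<Longrightarrow> \<exists>p a b. subtree (Node True p a b) t"
proof (induction t)
  case (Node k p a b)
  then show ?case by (cases k) auto
qed simp

text \<open>What a switching step makes of the kept premise: its root takes the name
  \<open>p\<close> of the deleted par.\<close>

fun reroot :: "'a \<Rightarrow> 'a tree \<Rightarrow> 'a tree" where
  "reroot p (Leaf x) = Leaf p"
| "reroot p (Node k q a b) = Node k p a b"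

lemma root_reroot [simp]: "root (reroot p t) = p"
  by (cases t) auto

lemma similar_reroot: "similar False t (reroot p t)"
proof -
  have "similar False u u" for u :: "'a tree" by (induction u) auto
  then show ?thesis by (cases t) auto
qed

lemma fun_upd_image_mset: "z \<notin># M \<Longrightarrow> image_mset (id(z := p)) M = M"
  by (induction M) auto

lemma fun_upd_map: "z \<notin> set xs \<Longrightarrow> map (id(z := p)) xs = xs"
  by (induction xs) auto

lemma leaves_reroot:
  assumes "simple (nodes t)"
  shows "leaves (reroot p t) = map (id(root t := p)) (leaves t)"
proof (cases t)
  case (Node k q a b)
  with assms have "q \<notin> set (leaves a @ leaves b)" using leaves_nodes[of q a] leaves_nodes[of q b] by auto
  from fun_upd_map[OF this] show ?thesis by (simp add: Node)
qed simp

lemma nodes_reroot: "add_mset (root t) (nodes (reroot p t)) = add_mset p (nodes t)"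
  by (cases t) (auto simp: add_mset_commute)

lemma links_fun_upd: "z \<notin># targets L \<Longrightarrow> image_mset (map_link id (id(z := p))) L = L"
proof (induction L)
  case (add l L)
  then have "map_link id (id(z := p)) l = l" by (cases l) (auto simp: fun_upd_map)
  moreover have "z \<notin># targets L" using add.prems by simp
  note add.IH[OF this]
  ultimately show ?case by (simp only: image_mset_add_mset)
qed simp

lemma tree_links_reroot:
  assumes "simple (nodes t)"
  shows "tree_links (reroot p t) = image_mset (map_link id (id(root t := p))) (tree_links t)"
proof (cases t)
  case (Node k q a b)
  with assms have "q \<notin># targets (tree_links a + tree_links b)" using inner_nodes[of q a] inner_nodes[of q b] by auto
  from links_fun_upd[OF this] show ?thesis by (simp add: Node)
qed simp

text \<open>Renaming the root affects a leaf only when the tree is a leaf. As \<open>p\<close> is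
  new, the renaming can be undone, which gives both directions.\<close>

lemma sw_reroot:
  assumes "simple (nodes t)" "p \<notin># nodes t"
  shows "sw (reroot p t) r' M' \<longleftrightarrow>
    (\<exists>r M. sw t r M \<and> r' = image_mset (id(root t := p)) r \<and> M' = image_mset (image_mset (id(root t := p))) M)"
    (is "_ = (\<exists>r M. _ \<and> _ = image_mset ?f r \<and> _)")
proof
  assume "\<exists>r M. sw t r M \<and> r' = image_mset ?f r \<and> M' = image_mset (image_mset ?f) M"
  then show "sw (reroot p t) r' M'"
    by (elim exE conjE) (simp only:, rule sw_similar[OF _ similar_reroot leaves_reroot[OF assms(1), symmetric]])
next
  assume sw: "sw (reroot p t) r' M'"
  let ?g = "id(p := root t)"
  have p: "p \<notin> set (leaves t)" using assms(2) leaves_nodes by metis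
  then have g: "map ?g (leaves (reroot p t)) = leaves t"
    unfolding leaves_reroot[OF assms(1)] map_map by (intro map_idI) auto
  have "similar False (reroot p t) t"
    using similar_reroot[of t p] similar_sym[of False t "reroot p t"] by simp
  from sw_similar[OF sw this g] have t: "sw t (image_mset ?g r') (image_mset (image_mset ?g) M')" .
  have "root t \<notin># mset (leaves (reroot p t))"
  proof -
    have "root t \<noteq> p" using assms(2) root_in_nodes[of t] by metis
    then show ?thesis unfolding leaves_reroot[OF assms(1)] by auto
  qed
  then have "root t \<notin># r' + \<Sum>\<^sub># M'" unfolding sw_union[OF sw] .
  then have nt: "root t \<notin># r'" "\<And>m. m \<in># M' \<Longrightarrow> root t \<notin># m" by auto
  have gf: "image_mset ?f (image_mset ?g m) = m" if "root t \<notin># m" for m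
    using that by (induction m) auto
  have "image_mset (image_mset ?f) (image_mset (image_mset ?g) M') = M'"
    using nt(2) gf by (induction M') auto
  then show "\<exists>r M. sw t r M \<and> r' = image_mset ?f r \<and> M' = image_mset (image_mset ?f) M"
    using t gf[OF nt(1)] by metis
qed

text \<open>A switching step detaches the subtree \<open>b\<close> from the par \<open>p\<close> and moves the output of \<open>a\<close> to \<open>p\<close>.\<close>

locale switch_par =
  fixes us vs :: "pos tree list" and c :: "pos tree \<Rightarrow> pos tree" and p :: pos and s a b :: "pos tree"
    and D :: "pos list multiset"
  assumes wf: "wf_forest (us @ c s # vs) D" and ctx: "tree_context c"
    and s: "s = Node True p a b \<or> s = Node True p b a"
begin

abbreviation "f \<equiv> id(root a := p)"
abbreviation "ts \<equiv> us @ c s # vs"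
abbreviation "ts' \<equiv> us @ c (reroot p a) # vs @ [b]"
abbreviation "D' \<equiv> image_mset (map f) D"

text \<open>\<open>s\<close> allows both orders of the premises, so the locale serves left and right
  steps alike: \<open>a\<close> is always the kept premise.\<close>

lemma s_sw: "sw a r Ma \<Longrightarrow> sw b q Mb \<Longrightarrow> sw s r (add_mset q (Ma + Mb))"
  using s sw_left[of a r Ma b q Mb p] sw_right[of b q Mb a r Ma p] by (auto simp: add.commute)

lemma nodes_s: "nodes s = add_mset p (nodes a + nodes b)"
  using s by (auto simp: add.commute)

lemma inner_s: "inner s = add_mset p (inner a + inner b)"
  using s by (auto simp: add.commute)

lemma leaves_s: "mset (leaves s) = mset (leaves a) + mset (leaves b)"
  using s by auto

lemma root_c: "root (c (reroot p a)) = root (c s)"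
  using replace_root[OF context_replace[OF ctx], of "reroot p a" s] s by auto

lemma ex_context: "\<exists>K L Ls. inner (c s) = inner s + K \<and> inner (c (reroot p a)) = inner (reroot p a) + K \<and>
    mset (leaves (c s)) = mset (leaves s) + L \<and> mset (leaves (c (reroot p a))) = mset (leaves (reroot p a)) + L \<and>
    tree_links (c s) = tree_links s + Ls \<and> tree_links (c (reroot p a)) = tree_links (reroot p a) + Ls"
  using replace_inner_leaves[OF context_replace[OF ctx], of s "reroot p a"]
    replace_links[OF context_replace[OF ctx], of s "reroot p a"] s by auto

lemma simple_s: "simple (nodes (c s))" "simple (nodes a)" "simple (nodes b)" "p \<notin># nodes a"
  "p \<notin># nodes b" "root a \<notin># nodes b"
proof -
  show c: "simple (nodes (c s))" using wf by (auto simp: wf_forest_def simple_union)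
  obtain K L where "inner (c s) = inner s + K" "mset (leaves (c s)) = mset (leaves s) + L"
    using ex_context by blast
  then have "nodes (c s) = nodes s + (K + L)" by (simp add: nodes_def ac_simps)
  with c have "simple (nodes s)" by (simp add: simple_union)
  then show "simple (nodes a)" "simple (nodes b)" "p \<notin># nodes a" "p \<notin># nodes b"  "root a \<notin># nodes b"
    using root_in_nodes[of a] by (auto simp: nodes_s simple_union)
qed

lemma nodes_ts: "add_mset (root a) (forest_nodes ts') = forest_nodes ts"
proof -
  obtain K L where KL: "inner (c s) = inner s + K" "inner (c (reroot p a)) = inner (reroot p a) + K"
    "mset (leaves (c s)) = mset (leaves s) + L" "mset (leaves (c (reroot p a))) = mset (leaves (reroot p a)) + L"
    using ex_context by blast
  have "nodes (c s) = add_mset p (nodes a) + (nodes b + (K + L))"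
    using nodes_s by (simp add: KL nodes_def ac_simps)
  moreover have "add_mset (root a) (nodes (c (reroot p a))) = add_mset (root a) (nodes (reroot p a)) + (K + L)"
    by (simp add: KL nodes_def ac_simps)
  ultimately have "add_mset (root a) (nodes (c (reroot p a))) + nodes b = nodes (c s)"
    by (simp add: nodes_reroot ac_simps)
  then show ?thesis by (simp add: ac_simps)
qed

lemma leaves_ts: "forest_leaves ts' = image_mset f (forest_leaves ts)"
proof -
  obtain L where L: "mset (leaves (c s)) = mset (leaves s) + L"
    "mset (leaves (c (reroot p a))) = mset (leaves (reroot p a)) + L"
    using ex_context by blast
  have "simple (forest_nodes ts)" using wf by (simp add: wf_forest_def)
  have ts: "forest_leaves ts = mset (leaves a) + (forest_leaves us + forest_leaves vs + L + mset (leaves b))"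
    by (simp add: L leaves_s ac_simps)
  have "root a \<notin># forest_leaves us + forest_leaves vs + L + mset (leaves b)"
  proof
    assume r: "root a \<in># forest_leaves us + forest_leaves vs + L + mset (leaves b)"
    then have "root a \<in># forest_leaves ts'" by (auto simp: L)
    then have "root a \<in># forest_nodes ts'"
      unfolding forest_nodes_leaves[of ts'] union_iff by (rule disjI2)
    then show False using \<open>simple (forest_nodes ts)\<close> nodes_ts by (metis simple_add_mset)
  qed
  from fun_upd_image_mset[OF this] show ?thesis
    unfolding ts using leaves_reroot[OF simple_s(2)] by (simp add: L ac_simps)
qed

lemma root_a: "root a \<notin># forest_nodes ts'" "p \<notin># forest_leaves ts"
proof -
  have "simple (forest_nodes ts)" using wf by (simp add: wf_forest_def)
  then show "root a \<notin># forest_nodes ts'" using nodes_ts by (metis simple_add_mset)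
  obtain K where "inner (c s) = inner s + K" using ex_context by blast
  then have "p \<in># sum_list (map inner ts)" by (simp add: inner_s)
  with \<open>simple (forest_nodes ts)\<close> show "p \<notin># forest_leaves ts"
    unfolding forest_nodes_leaves[of ts] simple_union by blast
qed

lemma wf': "wf_forest ts' D'"
  unfolding wf_forest_def
proof
  show "simple (forest_nodes ts')" using wf nodes_ts unfolding wf_forest_def by (metis simple_add_mset)
  have "\<Sum>\<^sub># (vertices D') = image_mset f (\<Sum>\<^sub># (vertices D))" by (simp only: vertices_map sum_image_image)
  also have "\<dots> = image_mset f (forest_leaves ts)" using wf by (simp only: wf_forest_def)
  finally show "\<Sum>\<^sub># (vertices D') = forest_leaves ts'" by (simp only: leaves_ts)
qed

lemma inj: "inj_on f (set_mset (forest_leaves ts))"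
proof (rule inj_onI)
  fix x y assume "x \<in># forest_leaves ts" "y \<in># forest_leaves ts" "f x = f y"
  then show "x = y" using root_a(2) by (auto split: if_splits)
qed

lemma links': "links (forest_net ts D) = add_mset (Par p1 p2 p) L \<Longrightarrow>
    s = Node True p x y \<Longrightarrow> p1 = root x \<Longrightarrow> p2 = root y \<Longrightarrow>
    links (forest_net ts' D') = image_mset (map_link id f) L"
proof -
  assume L: "links (forest_net ts D) = add_mset (Par p1 p2 p) L" "s = Node True p x y" "p1 = root x" "p2 = root y"
  obtain Ls where Ls: "tree_links (c s) = tree_links s + Ls"
    "tree_links (c (reroot p a)) = tree_links (reroot p a) + Ls"
    using ex_context by blast
  have "tree_links s = add_mset (Par p1 p2 p) (tree_links a + tree_links b)"
    using s L(2,3,4) by (auto simp: conn_link_def add.commute)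
  then have eq: "L = tree_links a + (sum_list (map tree_links us) + sum_list (map tree_links vs) + Ls + tree_links b) + image_mset Daimon D"
    using L(1) by (simp add: Ls ac_simps)
  have "root a \<notin># targets (sum_list (map tree_links us) + sum_list (map tree_links vs) + Ls + tree_links b)"
  proof
    assume "root a \<in># targets (sum_list (map tree_links us) + sum_list (map tree_links vs) + Ls + tree_links b)"
    then have "root a \<in># targets (sum_list (map tree_links ts'))" by (auto simp: Ls)
    then have "root a \<in># targets (links (forest_net ts' D'))"
      unfolding forest_net_simps targets_simps union_iff by (rule disjI1)
    then show False using root_a(1) unfolding targets_wf_forest[OF wf'] by blast
  qed
  from links_fun_upd[OF this, of p] show ?thesis
    unfolding eq image_mset_union tree_links_reroot[OF simple_s(2), symmetric]
    by (simp add: Ls multiset.map_comp comp_def ac_simps)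
qed

lemma step_net:
  assumes "links (forest_net ts D) = add_mset (Par p1 p2 p) L" "s = Node True p x y" "p1 = root x" "p2 = root y"
  shows "Net (image_mset (map_link id f) L) (map root ts @ [root b]) = forest_net ts' D'"
  using links'[OF assms] root_c by (simp add: forest_net_def)

lemma step: "switch_step (forest_net ts D) f (forest_net ts' D')"
proof -
  obtain Ls where Ls: "tree_links (c s) = tree_links s + Ls" using ex_context by blast
  from s show ?thesis
  proof
    assume s': "s = Node True p a b"
    then obtain L where L: "links (forest_net ts D) = add_mset (Par (root a) (root b) p) L"
      using Ls by (simp add: conn_link_def)
    then have "forest_net ts D = Net (L + {#Par (root a) (root b) p#}) (map root ts)" by (simp add: forest_net_def)
    then show ?thesis
      using step_net[OF L s' refl refl] switch_step.left[of f "root a" p L "root b" "map root ts"] by simp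
  next
    assume s': "s = Node True p b a"
    then obtain L where L: "links (forest_net ts D) = add_mset (Par (root b) (root a) p) L"
      using Ls by (simp add: conn_link_def)
    then have "forest_net ts D = Net (L + {#Par (root b) (root a) p#}) (map root ts)" by (simp add: forest_net_def)
    then show ?thesis
      using step_net[OF L s' refl refl] switch_step.right[of f "root a" p L "root b" "map root ts"] by simp
  qed
qed

text \<open>The renaming moves only the root of \<open>a\<close> among the leaves concerned, and
  that position occurs in no class formed outside \<open>a\<close>.\<close>

lemma image_labels:
  assumes "forest_switched us A" "forest_switched vs B" "switched b Cb" "sw a r M" "switched (c s) (add_mset (r + r\<^sub>0) (M + Cb + K))"
  shows "image_mset (image_mset f) A = A" "image_mset (image_mset f) B = B" "image_mset (image_mset f) Cb = Cb"
    "image_mset f r\<^sub>0 = r\<^sub>0" "image_mset (image_mset f) K = K"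
proof -
  obtain L where L: "mset (leaves (c s)) = mset (leaves s) + L"
    "mset (leaves (c (reroot p a))) = mset (leaves (reroot p a)) + L"
    using ex_context by blast
  have "r + r\<^sub>0 + \<Sum>\<^sub># (M + Cb + K) = mset (leaves (c s))"
    using switched_union[OF assms(5)] by simp
  then have "(r + \<Sum>\<^sub># M) + \<Sum>\<^sub># Cb + (r\<^sub>0 + \<Sum>\<^sub># K) = mset (leaves s) + L" by (simp add: L ac_simps)
  then have rK: "r\<^sub>0 + \<Sum>\<^sub># K = L"
    unfolding sw_union[OF assms(4)] switched_union[OF assms(3)] leaves_s by simp
  have "root a \<notin># forest_leaves ts'" using root_a(1) unfolding forest_nodes_leaves by simp
  then have no: "root a \<notin># \<Sum>\<^sub># A" "root a \<notin># \<Sum>\<^sub># B" "root a \<notin># \<Sum>\<^sub># Cb" "root a \<notin># r\<^sub>0" "root a \<notin># \<Sum>\<^sub># K"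
    unfolding forest_switched_labels[OF assms(1)] forest_switched_labels[OF assms(2)] switched_union[OF assms(3)]
    by (auto simp: L rK[symmetric])
  have id: "image_mset (image_mset f) X = X" if "root a \<notin># \<Sum>\<^sub># X" for X
    using that by (induction X) (simp_all add: fun_upd_image_mset)
  show "image_mset (image_mset f) A = A" "image_mset (image_mset f) B = B" "image_mset (image_mset f) Cb = Cb"
    "image_mset (image_mset f) K = K" using no id by simp_all
  show "image_mset f r\<^sub>0 = r\<^sub>0" by (rule fun_upd_image_mset[OF no(4)])
qed

lemma switched_forth:
  assumes "forest_switched us A" "forest_switched vs B" "sw a \<rho> M" "sw b q N"
    and fill: "\<And>s \<rho> N. sw s \<rho> N \<Longrightarrow> switched (c s) (add_mset (\<rho> + r\<^sub>0) (N + K))"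
  shows "forest_switched ts' (image_mset (image_mset f) (A + (add_mset (\<rho> + r\<^sub>0) (add_mset q (M + N) + K) + B)))"
proof -
  have b: "switched b (add_mset q N)" using assms(4) by (auto simp: switched_def)
  have "switched (c s) (add_mset (\<rho> + r\<^sub>0) (M + add_mset q N + K))"
    using fill[OF s_sw[OF assms(3,4)]] by simp
  note id = image_labels[OF assms(1,2) b assms(3) this]
  have "sw (reroot p a) (image_mset f \<rho>) (image_mset (image_mset f) M)"
    using sw_reroot[OF simple_s(2,4)] assms(3) by blast
  from fill[OF this] have fs: "forest_switched ts'
      (A + (add_mset (image_mset f \<rho> + r\<^sub>0) (image_mset (image_mset f) M + K) + (B + add_mset q N)))"
    unfolding forest_switched_append forest_switched_Cons
    using b assms(1,2) by (metis add.right_neutral forest_switched_Nil)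
  have eq: "A + (add_mset (image_mset f \<rho> + r\<^sub>0) (image_mset (image_mset f) M + K) + (B + add_mset q N)) =
      image_mset (image_mset f) (A + (add_mset (\<rho> + r\<^sub>0) (add_mset q (M + N) + K) + B))"
    using id by (simp add: ac_simps)
  show ?thesis using fs unfolding eq .
qed

text \<open>A switching of the result becomes one of the original forest by letting the par
  \<open>p\<close> keep \<open>a\<close> and detach \<open>b\<close>.\<close>

lemma switched_back:
  assumes "forest_switched ts' C'"
  shows "\<exists>C. forest_switched ts C \<and> C' = image_mset (image_mset f) C"
proof -
  obtain A X B Y where C': "forest_switched us A" "switched (c (reroot p a)) X" "forest_switched vs B"
    "switched b Y" "C' = A + (X + (B + Y))"
    using assms by (auto simp: forest_switched_append forest_switched_Cons)
  obtain \<rho> N r\<^sub>0 K where X: "sw (reroot p a) \<rho> N" "X = add_mset (\<rho> + r\<^sub>0) (N + K)"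
    "\<And>s \<rho> N. sw s \<rho> N \<Longrightarrow> switched (c s) (add_mset (\<rho> + r\<^sub>0) (N + K))"
    using switched_context[OF ctx C'(2)] by blast
  obtain r M where r: "sw a r M" "\<rho> = image_mset f r" "N = image_mset (image_mset f) M"
    using X(1) sw_reroot[OF simple_s(2,4)] by blast
  obtain q Mb where q: "sw b q Mb" "Y = add_mset q Mb" using C'(4) by (auto simp: switched_def)
  have "switched (c s) (add_mset (r + r\<^sub>0) (add_mset q (M + Mb) + K))"
    by (rule X(3)[OF s_sw[OF r(1) q(1)]])
  then have sc: "switched (c s) (add_mset (r + r\<^sub>0) (M + Y + K))" by (simp add: q ac_simps)
  note id = image_labels[OF C'(1,3,4) r(1) sc]
  have "forest_switched ts (A + (add_mset (r + r\<^sub>0) (M + Y + K) + B))"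
    unfolding forest_switched_append forest_switched_Cons using C' sc by blast
  moreover have "C' = image_mset (image_mset f) (A + (add_mset (r + r\<^sub>0) (M + Y + K) + B))"
    by (simp add: C' X r id ac_simps)
  ultimately show ?thesis by blast
qed

end

section \<open>Switching steps and the partitions they produce\<close>

lemma par_contextE:
  assumes "links (forest_net ts D) = L + {#Par p1 p2 p#}"
  obtains us vs c a b where "ts = us @ c (Node True p a b) # vs" "tree_context c" "p1 = root a" "p2 = root b"
proof -
  have "Par p1 p2 p \<in># links (forest_net ts D)" using assms by simp
  then have "conn_link True p1 p2 p \<in># sum_list (map tree_links ts)" by (auto simp: conn_link_def)
  then obtain t where t: "t \<in> set ts" "conn_link True p1 p2 p \<in># tree_links t" by (auto simp: in_sum_list)
  then obtain a b where ab: "subtree (Node True p a b) t" "root a = p1" "root b = p2"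
    using conn_link_subtree by blast
  then obtain c where c: "tree_context c" "t = c (Node True p a b)" using subtree_context by blast
  obtain us vs where "ts = us @ t # vs" using t(1) by (meson split_list)
  with ab c show ?thesis by (intro that[of us c a b vs]) simp_all
qed

lemma switch_step_forest:
  assumes wf: "wf_forest ts D" and step: "switch_step (forest_net ts D) f N"
  shows "\<exists>ts' D'. N = forest_net ts' D' \<and> wf_forest ts' D' \<and> forest_leaves ts' = image_mset f (forest_leaves ts) \<and>
    inj_on f (set_mset (forest_leaves ts)) \<and>
    (\<forall>C'. forest_switched ts' C' \<longrightarrow> (\<exists>C. forest_switched ts C \<and> C' = image_mset (image_mset f) C))"
proof -
  from step show ?thesis
  proof cases
    case (left p1 p L p2 cs)
    have L: "links (forest_net ts D) = L + {#Par p1 p2 p#}" by (subst left(1)) simp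
    have "concl (forest_net ts D) = cs" by (subst left(1)) simp
    then have cs: "cs = map root ts" by simp
    obtain us vs c a b where ts: "ts = us @ c (Node True p a b) # vs" "tree_context c"
      and ab: "p1 = root a" "p2 = root b" by (rule par_contextE[OF L])
    interpret switch_par us vs c p "Node True p a b" a b D
      by unfold_locales (use wf ts in auto)
    have f: "f = id(root a := p)" using left(3) ab by simp
    have "links (forest_net (us @ c (Node True p a b) # vs) D) = add_mset (Par p1 p2 p) L" using L ts by simp
    then have "N = forest_net ts' D'"
      using step_net[of p1 p2 L a b] left(2) by (simp add: cs ts ab f)
    then show ?thesis using wf' leaves_ts inj switched_back unfolding f ts by blast
  next
    case (right p2 p L p1 cs)
    have L: "links (forest_net ts D) = L + {#Par p1 p2 p#}" by (subst right(1)) simp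
    have "concl (forest_net ts D) = cs" by (subst right(1)) simp
    then have cs: "cs = map root ts" by simp
    obtain us vs c a b where ts: "ts = us @ c (Node True p a b) # vs" "tree_context c"
      and ab: "p1 = root a" "p2 = root b" by (rule par_contextE[OF L])
    interpret switch_par us vs c p "Node True p a b" b a D
      by unfold_locales (use wf ts in auto)
    have f: "f = id(root b := p)" using right(3) ab by simp
    have "links (forest_net (us @ c (Node True p a b) # vs) D) = add_mset (Par p1 p2 p) L" using L ts by simp
    then have "N = forest_net ts' D'"
      using step_net[of p1 p2 L a b] right(2) by (simp add: cs ts ab f)
    then show ?thesis using wf' leaves_ts inj switched_back unfolding f ts by blast
  qed
qed

text \<open>The given switching \<open>C\<close> decides at some par which premise is kept; this
  step is performed, and \<open>C\<close> remains a switching of the result up to renaming.\<close>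

lemma switch_step_exists:
  assumes wf: "wf_forest ts D" and C: "forest_switched ts C" and par: "t \<in> set ts" "pars t > 0"
  shows "\<exists>f ts' D' C'. switch_step (forest_net ts D) f (forest_net ts' D') \<and> wf_forest ts' D' \<and>
    forest_leaves ts' = image_mset f (forest_leaves ts) \<and> inj_on f (set_mset (forest_leaves ts)) \<and>
    forest_switched ts' C' \<and> C' = image_mset (image_mset f) C"
proof -
  obtain us vs where ts: "ts = us @ t # vs" using par(1) by (meson split_list)
  obtain p a b where "subtree (Node True p a b) t" using pars_subtree par(2) by blast
  then obtain c where c: "tree_context c" "t = c (Node True p a b)" using subtree_context by blast
  obtain A X B where X: "forest_switched us A" "switched (c (Node True p a b)) X" "forest_switched vs B" "C = A + (X + B)"
    using C unfolding ts c(2) by (auto simp: forest_switched_append forest_switched_Cons)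
  obtain \<rho> N r\<^sub>0 K where N: "sw (Node True p a b) \<rho> N" "X = add_mset (\<rho> + r\<^sub>0) (N + K)"
    and fill: "\<And>s \<rho> N. sw s \<rho> N \<Longrightarrow> switched (c s) (add_mset (\<rho> + r\<^sub>0) (N + K))"
    using switched_context[OF c(1) X(2)] by blast
  show ?thesis
    using N(1)
  proof cases
    case (sw_left M q N')
    interpret switch_par us vs c p "Node True p a b" a b D
      by unfold_locales (use wf ts c in auto)
    have "forest_switched ts' (image_mset (image_mset f) C)"
      using switched_forth[OF X(1,3) sw_left(2,3) fill] by (simp add: X N sw_left)
    then show ?thesis using step wf' leaves_ts inj unfolding ts c by metis
  next
    case (sw_right q M N')
    interpret switch_par us vs c p "Node True p a b" b a D
      by unfold_locales (use wf ts c in auto)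
    have "forest_switched ts' (image_mset (image_mset f) C)"
      using switched_forth[OF X(1,3) sw_right(3,2) fill] by (simp add: X N sw_right add.commute)
    then show ?thesis using step wf' leaves_ts inj unfolding ts c by metis
  qed simp
qed

lemma simple_forest_unique:
  "simple (forest_nodes ts) \<Longrightarrow> t \<in> set ts \<Longrightarrow> u \<in> set ts \<Longrightarrow> z \<in># nodes t \<Longrightarrow> z \<in># nodes u \<Longrightarrow> t = u"
proof (induction ts)
  case (Cons v ts)
  have "z \<in># forest_nodes ts" if "w \<in> set ts" "z \<in># nodes w" for w
    using that by (auto simp: in_sum_list)
  moreover have "simple (forest_nodes ts)" "z \<in># nodes v \<Longrightarrow> z \<notin># forest_nodes ts"
    using Cons.prems(1) by (auto simp: simple_union in_sum_list)
  ultimately show ?case using Cons by (metis set_ConsD)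
qed simp

lemma down_forest:
  assumes "wf_forest ts D" "(x, y) \<in> (down (forest_net ts D))\<^sup>*" "t \<in> set ts" "x \<in># nodes t"
  shows "y \<in># nodes t"
  using assms(2,4)
proof (induction rule: rtrancl_induct)
  case (step y z)
  then obtain l where l: "l \<in># links (forest_net ts D)" "y \<in> set (source l)" "z \<in> set (target l)"
    by (auto simp: down_def)
  then have "l \<in># sum_list (map tree_links ts)" by auto
  then obtain u where u: "u \<in> set ts" "l \<in># tree_links u" by (auto simp: in_sum_list)
  have "y \<in># sources (tree_links u)" "z \<in># targets (tree_links u)"
    using u l by (auto simp: in_sources in_targets simp del: targets_tree_links)
  then have "y \<in># nodes u" "z \<in># nodes u"
    using sources_tree_links[of u] by (metis insert_iff set_mset_add_mset_insert, auto intro: inner_nodes)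
  moreover have "simple (forest_nodes ts)" using assms(1) by (simp add: wf_forest_def)
  ultimately show ?case using simple_forest_unique[OF _ assms(3) u(1)] step by blast
qed simp

lemma tree_down:
  "\<forall>l\<in>#tree_links t. l \<in># links S \<Longrightarrow> x \<in> set (leaves t) \<Longrightarrow> (x, root t) \<in> (down S)\<^sup>*"
proof (induction t)
  case (Node k p a b)
  then have l: "conn_link k (root a) (root b) p \<in># links S" by simp
  have "(root a, p) \<in> down S" "(root b, p) \<in> down S"
    using l unfolding down_def by force+
  moreover have "(x, root a) \<in> (down S)\<^sup>* \<or> (x, root b) \<in> (down S)\<^sup>*" using Node by auto
  ultimately show ?case by (auto intro: rtrancl_into_rtrancl)
qed simp

lemma forest_switched_no_pars:
  assumes "\<forall>t\<in>set ts. pars t = 0" "forest_switched ts C"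
  shows "C = mset (map (\<lambda>t. mset (leaves t)) ts)"
  using assms
proof (induction ts arbitrary: C)
  case (Cons t ts)
  then obtain r M B where B: "sw t r M" "forest_switched ts B" "C = add_mset r M + B"
    by (auto simp: forest_switched_Cons switched_def)
  have "M = {#}" using sw_size[OF B(1)] Cons.prems(1) by simp
  moreover from this have "r = mset (leaves t)" using sw_union[OF B(1)] by simp
  ultimately show ?case using Cons B by simp
qed simp

text \<open>Without pars each tree forms one class, the leaves above its root. Pulled back along
  \<open>f\<close>, which is injective on the initial positions, these are the classes of
  \<open>C\<close>.\<close>

lemma up_partition_forest:
  assumes wf: "wf_forest ts D" "wf_forest ts' D'" and leaves: "forest_leaves ts' = image_mset f (forest_leaves ts)"
    and inj: "inj_on f (set_mset (forest_leaves ts))" and np: "\<forall>t\<in>set ts'. pars t = 0"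
    and C': "forest_switched ts' (image_mset (image_mset f) C)" and C: "forest_switched ts C"
  shows "up_partition (forest_net ts D) f (forest_net ts' D') = set_mset ` set_mset C"
proof -
  define F where "F t = {x \<in> set_mset (forest_leaves ts). f x \<in> set (leaves t)}" for t
  have eq: "image_mset (image_mset f) C = mset (map (\<lambda>t. mset (leaves t)) ts')"
    by (rule forest_switched_no_pars[OF np C'])
  have F: "F t = set_mset c" if "c \<in># C" "image_mset f c = mset (leaves t)" for c t
  proof -
    have "set_mset c \<subseteq> set_mset (forest_leaves ts)"
      using that(1) unfolding forest_switched_labels[OF C, symmetric] by auto
    moreover have "set (leaves t) = f ` set_mset c" using that(2) by (metis set_image_mset set_mset_mset)
    ultimately show ?thesis unfolding F_def using inj by (auto dest: inj_onD)
  qed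
  have "up_partition (forest_net ts D) f (forest_net ts' D') = F ` set ts'"
  proof -
    have "(f x, root t) \<in> (down (forest_net ts' D'))\<^sup>* \<longleftrightarrow> f x \<in> set (leaves t)"
      if t: "t \<in> set ts'" and x: "x \<in># forest_leaves ts" for x t
    proof
      assume *: "(f x, root t) \<in> (down (forest_net ts' D'))\<^sup>*"
      have "f x \<in># forest_leaves ts'" using x unfolding leaves by simp
      then obtain u where u: "u \<in> set ts'" "f x \<in> set (leaves u)" by (auto simp: in_sum_list)
      then have "f x \<in># nodes u" by (intro leaves_nodes)
      from down_forest[OF wf(2) * u(1) this] have "root t \<in># nodes u" .
      then have "t = u" using simple_forest_unique[of ts' t u "root t"] t u(1) wf(2) by (simp add: wf_forest_def)
      with u show "f x \<in> set (leaves t)" by simp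
    next
      assume "f x \<in> set (leaves t)"
      then show "(f x, root t) \<in> (down (forest_net ts' D'))\<^sup>*"
        using t by (intro tree_down) (auto simp: in_sum_list)
    qed
    then have "{x \<in> set_mset (forest_leaves ts). (f x, root t) \<in> (down (forest_net ts' D'))\<^sup>*} = F t"
      if "t \<in> set ts'" for t
      using that unfolding F_def by blast
    then have "(\<lambda>t. {x \<in> set_mset (forest_leaves ts). (f x, root t) \<in> (down (forest_net ts' D'))\<^sup>*}) ` set ts' = F ` set ts'"
      by (intro image_cong) simp_all
    then show ?thesis
      unfolding up_partition_def initial_positions_forest_net[OF wf(1)] Setcompr_eq_image
      by (simp add: image_image)
  qed
  also have "\<dots> = set_mset ` set_mset C"
  proof (intro subset_antisym subsetI)
    fix X assume "X \<in> F ` set ts'"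
    then obtain t where t: "t \<in> set ts'" "X = F t" by blast
    then have "mset (leaves t) \<in># image_mset (image_mset f) C" unfolding eq by simp
    then obtain c where "c \<in># C" "image_mset f c = mset (leaves t)" by auto
    then show "X \<in> set_mset ` set_mset C" using F t by blast
  next
    fix X assume "X \<in> set_mset ` set_mset C"
    then obtain c where c: "c \<in># C" "X = set_mset c" by blast
    then have "image_mset f c \<in># image_mset (image_mset f) C" by simp
    then obtain t where "t \<in> set ts'" "image_mset f c = mset (leaves t)" unfolding eq by auto
    then show "X \<in> F ` set ts'" using F c by blast
  qed
  finally show ?thesis .
qed

lemma switch_steps_forest:
  assumes "switch_steps S f N" "S = forest_net ts D" "wf_forest ts D"
  shows "\<exists>ts' D'. N = forest_net ts' D' \<and> wf_forest ts' D' \<and> forest_leaves ts' = image_mset f (forest_leaves ts) \<and>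
    inj_on f (set_mset (forest_leaves ts)) \<and>
    (\<forall>C'. forest_switched ts' C' \<longrightarrow> (\<exists>C. forest_switched ts C \<and> C' = image_mset (image_mset f) C))"
  using assms
proof (induction rule: switch_steps.induct)
  case (1 S)
  then show ?case by (intro exI[of _ ts] exI[of _ D]) auto
next
  case (2 S g S' f S'')
  then obtain ts' D' where S': "S' = forest_net ts' D'" "wf_forest ts' D'" "forest_leaves ts' = image_mset g (forest_leaves ts)"
    "inj_on g (set_mset (forest_leaves ts))"
    "\<And>C'. forest_switched ts' C' \<Longrightarrow> \<exists>C. forest_switched ts C \<and> C' = image_mset (image_mset g) C"
    by blast
  then obtain us E where us: "S'' = forest_net us E" "wf_forest us E" "forest_leaves us = image_mset f (forest_leaves ts')"
    "inj_on f (set_mset (forest_leaves ts'))"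
    "\<And>C'. forest_switched us C' \<Longrightarrow> \<exists>C. forest_switched ts' C \<and> C' = image_mset (image_mset f) C"
    using switch_step_forest 2(2) by blast
  have "image_mset (image_mset f) (image_mset (image_mset g) X) = image_mset (image_mset (f \<circ> g)) X" for X
    by (simp add: multiset.map_comp comp_def)
  then have "\<exists>C. forest_switched ts C \<and> C' = image_mset (image_mset (f \<circ> g)) C" if "forest_switched us C'" for C'
    using us(5)[OF that] S'(5) by metis
  moreover have "forest_leaves us = image_mset (f \<circ> g) (forest_leaves ts)"
    unfolding us(3) S'(3) by (simp add: multiset.map_comp)
  moreover have "inj_on (f \<circ> g) (set_mset (forest_leaves ts))"
    using S'(4) us(4) unfolding S'(3) set_image_mset by (rule comp_inj_on)
  ultimately show ?case using us(1,2) by blast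
qed

lemma par_link_pars: "conn_link True p1 p2 p \<in># tree_links t \<Longrightarrow> pars t > 0"
  by (induction t) auto

lemma no_switch_step:
  assumes "wf_forest ts D"
  shows "(\<nexists>g N. switch_step (forest_net ts D) g N) \<longleftrightarrow> (\<forall>t\<in>set ts. pars t = 0)"
proof
  assume *: "\<nexists>g N. switch_step (forest_net ts D) g N"
  obtain C where "forest_switched ts C" using forest_switched_exists by blast
  then show "\<forall>t\<in>set ts. pars t = 0" using * switch_step_exists[OF assms] by blast
next
  assume np: "\<forall>t\<in>set ts. pars t = 0"
  show "\<nexists>g N. switch_step (forest_net ts D) g N"
  proof (intro notI, elim exE)
    fix g N assume "switch_step (forest_net ts D) g N"
    then obtain L p1 p2 p where "links (forest_net ts D) = L + {#Par p1 p2 p#}"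
      by cases (metis net.sel(1))+
    then have "Par p1 p2 p \<in># links (forest_net ts D)" by simp
    then have "conn_link True p1 p2 p \<in># sum_list (map tree_links ts)" by (auto simp: conn_link_def)
    then obtain t where t: "t \<in> set ts" "conn_link True p1 p2 p \<in># tree_links t" by (auto simp: in_sum_list)
    then have "pars t > 0" using par_link_pars by blast
    with np t(1) show False by auto
  qed
qed

lemma switching_up_partition:
  assumes "wf_forest ts D" "switching (forest_net ts D) f N"
  shows "\<exists>C. forest_switched ts C \<and> up_partition (forest_net ts D) f N = set_mset ` set_mset C"
proof -
  obtain ts' D' where ts': "N = forest_net ts' D'" "wf_forest ts' D'" "forest_leaves ts' = image_mset f (forest_leaves ts)"
    "inj_on f (set_mset (forest_leaves ts))"
    "\<And>C'. forest_switched ts' C' \<Longrightarrow> \<exists>C. forest_switched ts C \<and> C' = image_mset (image_mset f) C"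
    using switch_steps_forest[OF _ refl assms(1)] assms(2) unfolding switching_def by blast
  have np: "\<forall>t\<in>set ts'. pars t = 0"
    using no_switch_step[OF ts'(2)] assms(2) unfolding switching_def ts'(1) by blast
  obtain C' where C': "forest_switched ts' C'" using forest_switched_exists by blast
  with ts'(5) obtain C where "forest_switched ts C" "C' = image_mset (image_mset f) C" by blast
  with up_partition_forest[OF assms(1) ts'(2,3,4) np] C' show ?thesis unfolding ts'(1) by blast
qed

lemma switching_exists:
  assumes "wf_forest ts D" "forest_switched ts C"
  shows "\<exists>f N. switching (forest_net ts D) f N \<and> up_partition (forest_net ts D) f N = set_mset ` set_mset C"
proof -
  have "\<exists>f N. switching (forest_net ts D) f N \<and> up_partition (forest_net ts D) f N = set_mset ` set_mset C"
    if "switch_steps (forest_net ts D) g (forest_net us E)" "wf_forest us E"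
      "forest_leaves us = image_mset g (forest_leaves ts)" "inj_on g (set_mset (forest_leaves ts))"
      "forest_switched us (image_mset (image_mset g) C)" for g us E
    using that
  proof (induction "sum_list (map pars us)" arbitrary: g us E rule: less_induct)
    case less
    show ?case
    proof (cases "\<forall>t\<in>set us. pars t = 0")
      case True
      then have "switching (forest_net ts D) g (forest_net us E)"
        using less.prems(1) no_switch_step[OF less.prems(2)] by (simp add: switching_def)
      then show ?thesis using up_partition_forest[OF assms(1) less.prems(2-4) True less.prems(5) assms(2)] by blast
    next
      case False
      then obtain t where "t \<in> set us" "pars t > 0" by auto
      from switch_step_exists[OF less.prems(2,5) this] obtain f us' E' C' where
        us': "switch_step (forest_net us E) f (forest_net us' E')" "wf_forest us' E'"
          "forest_leaves us' = image_mset f (forest_leaves us)" "inj_on f (set_mset (forest_leaves us))"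
          "forest_switched us' C'" "C' = image_mset (image_mset f) (image_mset (image_mset g) C)"
        by blast
      show ?thesis
      proof (rule less.hyps)
        show "switch_steps (forest_net ts D) (f \<circ> g) (forest_net us' E')"
          using less.prems(1) us'(1) by (rule switch_steps.intros)
        show "forest_leaves us' = image_mset (f \<circ> g) (forest_leaves ts)"
          unfolding us'(3) less.prems(3) by (simp add: multiset.map_comp)
        show "inj_on (f \<circ> g) (set_mset (forest_leaves ts))"
          using less.prems(4) us'(4) unfolding less.prems(3) set_image_mset by (rule comp_inj_on)
        show "forest_switched us' (image_mset (image_mset (f \<circ> g)) C)"
          using us'(5,6) by (simp add: multiset.map_comp comp_def)
        have size: "size X = sum_list (map pars vs) + length vs" if "forest_switched vs X" for vs :: "pos tree list" and X
          using that forest_switched_size unfolding forest_switched_def by blast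
        have "size (links (forest_net us E)) = Suc (size (links (forest_net us' E')))"
          using us'(1) by cases simp_all
        \<comment> \<open>The number of classes is unchanged while the step adds a tree, so the
          number of pars drops.\<close>
        have "length us' = Suc (length us)"
        proof -
          have "length (concl (forest_net us' E')) = Suc (length (concl (forest_net us E)))"
            using us'(1) by cases simp_all
          then show ?thesis by simp
        qed
        then show "sum_list (map pars us') < sum_list (map pars us)"
          using size[OF us'(5)] size[OF less.prems(5)] us'(6) by simp
      qed fact
    qed
  qed
  from this[OF switch_steps.intros(1) assms(1)] assms(2) show ?thesis by simp
qed

section \<open>Natural positions\<close>

fun addresses :: "'a tree \<Rightarrow> (bool list \<times> 'a) list" where
  "addresses (Leaf x) = [([], x)]"
| "addresses (Node k p a b) =
     map (\<lambda>(w, x). (False # w, x)) (addresses a) @ map (\<lambda>(w, x). (True # w, x)) (addresses b)"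

lemma map_snd_addresses: "map snd (addresses t) = leaves t"
  by (induction t) (auto simp: comp_def case_prod_unfold)

text \<open>The left premise is listed first and its addresses begin with \<open>False\<close>, so
  the order of the list is the lexicographic one.\<close>

lemma sorted_addresses: "sorted_wrt (\<lambda>x y. (fst x, fst y) \<in> lexord {(False, True)}) (addresses t)"
  by (induction t) (auto simp: sorted_wrt_append sorted_wrt_map case_prod_unfold)

lemma addresses_address:
  "\<forall>l\<in>#tree_links t. l \<in># links S \<Longrightarrow> (w, x) \<in> set (addresses t) \<Longrightarrow> address S (root t) w x"
proof (induction t arbitrary: w)
  case (Node k p a b)
  have l: "Par (root a) (root b) p \<in># links S \<or> Tensor (root a) (root b) p \<in># links S"
    using Node.prems(1) by (cases k) (auto simp: conn_link_def)
  from Node.prems(2) consider v where "w = False # v" "(v, x) \<in> set (addresses a)"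
    | v where "w = True # v" "(v, x) \<in> set (addresses b)" by auto
  then show ?case
    using address.intros(2)[OF l] address.intros(3)[OF l] Node by cases auto
qed (auto intro: address.intros)

text \<open>Guarantees that a path climbing from the root through links of the net cannot leave
  \<open>t\<close>.\<close>

definition rooted :: "pos tree \<Rightarrow> net \<Rightarrow> bool" where
  "rooted t S \<longleftrightarrow> simple (nodes t) \<and>
    (\<forall>k a b p. p \<in># nodes t \<longrightarrow> conn_link k a b p \<in># links S \<longrightarrow> conn_link k a b p \<in># tree_links t)"

lemma rooted_child:
  assumes "rooted (Node k p a b) S"
  shows "rooted a S" "rooted b S"
proof -
  have s: "simple (nodes a)" "simple (nodes b)" "p \<notin># nodes a" "p \<notin># nodes b"
    "\<And>x. x \<in># nodes a \<Longrightarrow> x \<notin># nodes b"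
    using assms by (auto simp: rooted_def simple_union)
  have l: "q = p \<or> conn_link k' x y q \<in># tree_links a \<or> conn_link k' x y q \<in># tree_links b"
    if "q \<in># nodes a \<or> q \<in># nodes b" "conn_link k' x y q \<in># links S" for k' x y q
    using assms that unfolding rooted_def by auto
  show "rooted a S" "rooted b S"
    unfolding rooted_def using s l conn_link_inner inner_nodes by (metis, metis)
qed

lemma ex_conn_link:
  assumes "Par p1 p2 q \<in># L \<or> Tensor p1 p2 q \<in># L"
  shows "\<exists>k. conn_link k p1 p2 q \<in># L"
  using assms
proof
  assume "Par p1 p2 q \<in># L"
  then show ?thesis by (intro exI[of _ True]) (simp add: conn_link_def)
next
  assume "Tensor p1 p2 q \<in># L"
  then show ?thesis by (intro exI[of _ False]) (simp add: conn_link_def)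
qed

lemma address_addresses:
  assumes "address S q w x" "q = root t" "rooted t S" "x \<notin># inner t"
  shows "(w, x) \<in> set (addresses t)"
  using assms
proof (induction arbitrary: t rule: address.induct)
  case (1 q)
  then show ?case by (cases t) auto
next
  case (2 p1 p2 q w p)
  then obtain k where "conn_link k p1 p2 (root t) \<in># links S" using ex_conn_link by metis
  with 2(5) have l: "conn_link k p1 p2 (root t) \<in># tree_links t" by (simp add: rooted_def)
  then obtain k' r a b where t: "t = Node k' r a b" by (cases t) auto
  have "r \<notin># nodes a" "r \<notin># nodes b" using 2(5) by (auto simp: t rooted_def)
  with l have "p1 = root a" using conn_link_inner inner_nodes by (fastforce simp: t)
  with 2(3)[of a] 2(5,6) rooted_child(1) have "(w, p) \<in> set (addresses a)" by (auto simp: t)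
  then show ?case by (force simp: t)
next
  case (3 p1 p2 q w p)
  then obtain k where "conn_link k p1 p2 (root t) \<in># links S" using ex_conn_link by metis
  with 3(5) have l: "conn_link k p1 p2 (root t) \<in># tree_links t" by (simp add: rooted_def)
  then obtain k' r a b where t: "t = Node k' r a b" by (cases t) auto
  have "r \<notin># nodes a" "r \<notin># nodes b" using 3(5) by (auto simp: t rooted_def)
  with l have "p2 = root b" using conn_link_inner inner_nodes by (fastforce simp: t)
  with 3(3)[of b] 3(5,6) rooted_child(2) have "(w, p) \<in> set (addresses b)" by (auto simp: t)
  then show ?case by (force simp: t)
qed

text \<open>With a single conclusion only addresses are compared, and they are sorted like the list
  of leaves. The added 1 converts a place counted from 0 into one counted from 1.\<close>

lemma natural_index_forest:
  assumes wf: "wf_forest [t] D" and j: "j < length (leaves t)"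
  shows "natural_index (forest_net [t] D) (leaves t ! j) = j + 1"
proof -
  let ?S = "forest_net [t] D"
  let ?r = "lexord {(False, True)}"
  have simp: "simple (nodes t)" using wf by (simp add: wf_forest_def)
  have rooted: "rooted t ?S" using simp by (auto simp: rooted_def)
  have disj: "x \<notin># inner t" if "x \<in> set (leaves t)" for x
    using simp that by (auto simp: nodes_def simple_union)
  have loc: "located ?S iw x \<longleftrightarrow> fst iw = 0 \<and> (snd iw, x) \<in> set (addresses t)" if "x \<in> set (leaves t)" for iw x
    unfolding located_def
    using address_addresses[OF _ refl rooted disj[OF that]] addresses_address[of t ?S] by auto
  have dist: "distinct (leaves t)" using wf_forest_simple[OF wf] by simp
  have len: "length (addresses t) = length (leaves t)" using map_snd_addresses by (metis length_map)
  have nth: "snd (addresses t ! i) = leaves t ! i" if "i < length (leaves t)" for i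
    using map_snd_addresses[of t] that len by (metis nth_map)
  have addr: "(w, leaves t ! i) \<in> set (addresses t) \<longleftrightarrow> w = fst (addresses t ! i)" if i: "i < length (leaves t)" for w i
  proof
    assume "(w, leaves t ! i) \<in> set (addresses t)"
    then obtain i' where i': "i' < length (leaves t)" "addresses t ! i' = (w, leaves t ! i)"
      unfolding in_set_conv_nth len by blast
    with nth[of i'] have "leaves t ! i' = leaves t ! i" by simp
    with dist i i' have "i' = i" by (simp add: nth_eq_iff_index_eq)
    with i' show "w = fst (addresses t ! i)" by simp
  next
    assume "w = fst (addresses t ! i)"
    then have "(w, leaves t ! i) = addresses t ! i" using nth[OF i] by (simp add: prod_eq_iff)
    then show "(w, leaves t ! i) \<in> set (addresses t)" using i len by simp
  qed
  have asym: "(v, w) \<in> ?r \<Longrightarrow> (w, v) \<notin> ?r" for v w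
    by (rule lexord_asymmetric) (auto intro!: asymI)
  have lex: "(fst (addresses t ! i), fst (addresses t ! i')) \<in> ?r \<longleftrightarrow> i < i'"
    if "i < length (leaves t)" "i' < length (leaves t)" for i i'
    using that sorted_addresses[of t] asym unfolding sorted_wrt_iff_nth_less len
    by (metis linorder_neqE_nat)
  have less: "natural_less ?S (leaves t ! i) (leaves t ! i') \<longleftrightarrow> i < i'"
    if "i < length (leaves t)" "i' < length (leaves t)" for i i'
  proof -
    have "natural_less ?S (leaves t ! i) (leaves t ! i') \<longleftrightarrow>
        (\<exists>w v. (w, leaves t ! i) \<in> set (addresses t) \<and> (v, leaves t ! i') \<in> set (addresses t) \<and> (w, v) \<in> ?r)"
      unfolding natural_less_def using loc that by (auto simp: lex_prod_def)
    also have "\<dots> \<longleftrightarrow> i < i'" using addr that lex by auto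
    finally show ?thesis .
  qed
  have "set (leaves t) = (!) (leaves t) ` {..<length (leaves t)}" by (auto simp: set_conv_nth)
  then have "{q \<in> initial_positions ?S. natural_less ?S q (leaves t ! j)} =
      (!) (leaves t) ` {i \<in> {..<length (leaves t)}. natural_less ?S (leaves t ! i) (leaves t ! j)}"
    unfolding initial_positions_forest_net[OF wf] by auto
  also have "{i \<in> {..<length (leaves t)}. natural_less ?S (leaves t ! i) (leaves t ! j)} = {..<j}"
    using less j by auto
  finally have "{q \<in> initial_positions ?S. natural_less ?S q (leaves t ! j)} = (!) (leaves t) ` {..<j}" .
  moreover have "inj_on ((!) (leaves t)) {..<j}"
    using dist j by (auto simp: inj_on_def nth_eq_iff_index_eq)
  ultimately show ?thesis by (simp add: natural_index_def card_image)
qed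

section \<open>Tests\<close>

lemma simple_mset_set: "simple M \<Longrightarrow> mset_set (set_mset M) = M"
  by (induction M) auto

text \<open>Disjoint non-empty classes differ from each other, so passing to the set of their
  underlying sets forgets no multiplicity.\<close>

lemma partition_determined:
  assumes "simple (\<Sum>\<^sub># G)" "{#} \<notin># G"
  shows "G = image_mset mset_set (mset_set (set_mset ` set_mset G))"
  using assms
proof (induction G)
  case (add m G)
  have m: "simple m" and G: "simple (\<Sum>\<^sub># G)" and disj: "\<And>x. x \<in># m \<Longrightarrow> x \<notin># \<Sum>\<^sub># G"
    using add.prems(1) by (auto simp: simple_union)
  obtain x where x: "x \<in># m" using add.prems(2) by (metis multiset_nonemptyE union_single_eq_member)
  have "set_mset m \<notin> set_mset ` set_mset G"
  proof
    assume "set_mset m \<in> set_mset ` set_mset G"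
    then obtain n where n: "n \<in># G" "set_mset m = set_mset n" by blast
    then have "x \<in># \<Sum>\<^sub># G" using x by auto
    with disj x show False by blast
  qed
  then have "mset_set (set_mset ` set_mset (add_mset m G)) = add_mset (set_mset m) (mset_set (set_mset ` set_mset G))"
    by simp
  then show ?case using add.IH G add.prems(2) simple_mset_set[OF m] by simp
qed simp

text \<open>An empty class is visible in the set of sets, so if one side has none, neither has the
  other. For tests this rules out daimons without outputs, in whatever number.\<close>

lemma partition_eqI:
  assumes "simple (\<Sum>\<^sub># G)" "simple (\<Sum>\<^sub># H)" "{#} \<notin># H" "set_mset ` set_mset G = set_mset ` set_mset H"
  shows "G = H"
proof -
  have "{#} \<notin># G"
  proof
    assume "{#} \<in># G"
    then have "set_mset {#} \<in> set_mset ` set_mset H" unfolding assms(4)[symmetric] by (rule imageI)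
    then obtain h where h: "set_mset {#} = set_mset h" "h \<in># H" by (rule imageE)
    then have "h = {#}" using set_mset_eq_empty_iff[of h] by simp
    with h(2) assms(3) show False by simp
  qed
  with assms partition_determined[of G] partition_determined[of H] show ?thesis by simp
qed

lemma daimon_partition_forest: "daimon_partition (forest_net ts E) = set_mset ` set_mset (vertices E)"
proof -
  have "Daimon ps \<in># links (forest_net ts E) \<longleftrightarrow> ps \<in># E" for ps
    by (auto dest!: tree_links_shape)
  then have "daimon_partition (forest_net ts E) = set ` set_mset E" by (auto simp: daimon_partition_def)
  also have "\<dots> = set_mset ` set_mset (vertices E)" by (simp add: image_image)
  finally show ?thesis .
qed

lemma natural_indices:
  assumes "wf_forest [t] D"
  shows "map (natural_index (forest_net [t] D)) (leaves t) = map Suc [0..<length (leaves t)]"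
  using natural_index_forest[OF assms] by (intro nth_equalityI) auto

lemma forest_switched_single: "forest_switched [t] C \<longleftrightarrow> switched t C"
  by (simp add: forest_switched_Cons)

text \<open>Natural indices number the leaves of every tree for \<open>A\<close> from left to right.
  Equality of natural partitions thus turns the daimons on \<open>u\<close> into the classes of a
  switching of the witness tree \<open>v\<close>, which is similar to \<open>t\<close>.\<close>

lemma test_switched:
  assumes "is_test d T A" "fits t A"
  obtains u E \<phi> where "T = forest_net [u] E" "wf_forest [u] E" "similar True t u"
    "map \<phi> (leaves u) = leaves t" "switched t (labels \<phi> E)"
proof -
  obtain us E \<tau> where "wf_forest us E" "T = forest_net us E" "\<And>u. u \<in> set us \<Longrightarrow> labelled \<tau> u"
    "[neg d A] = map (\<lambda>u. \<tau> (root u)) us"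
    using assms(1) unfolding is_test_def by (metis atomically_testable_forest)
  then obtain u where T: "T = forest_net [u] E" "wf_forest [u] E" and u: "labelled \<tau> u" "\<tau> (root u) = neg d A"
    by (auto simp: Cons_eq_map_conv)
  from assms(1) obtain S f N where S: "atomically_testable S [A]" and sw: "switching S f N"
    and nat: "natural_partition T (daimon_partition T) = natural_partition S (up_partition S f N)"
    unfolding is_test_def by blast
  obtain vs D \<sigma> where "wf_forest vs D" "S = forest_net vs D" "\<And>v. v \<in> set vs \<Longrightarrow> labelled \<sigma> v"
    "[A] = map (\<lambda>v. \<sigma> (root v)) vs"
    using S by (metis atomically_testable_forest)
  then obtain v where S: "S = forest_net [v] D" "wf_forest [v] D" and v: "labelled \<sigma> v" "\<sigma> (root v) = A"
    by (auto simp: Cons_eq_map_conv)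
  have "fits u (neg d A)" "fits v A" using labelled_fits u v by metis+
  then have tu: "similar True t u" and vt: "similar False v t"
    using fits_neg_similar[OF assms(2)] fits_similar assms(2) by blast+
  obtain C where C: "switched v C" "up_partition S f N = set_mset ` set_mset C"
    using switching_up_partition[OF S(2), of f N] sw unfolding S(1) forest_switched_single by blast
  let ?i = "natural_index T" and ?j = "natural_index S"
  let ?G = "image_mset (image_mset ?i) (vertices E)" and ?H = "image_mset (image_mset ?j) C"
  define n where "n = length (leaves t)"
  have len: "length (leaves u) = n" "length (leaves v) = n"
    using similar_length tu vt by (metis n_def)+
  have i: "map ?i (leaves u) = map Suc [0..<n]" using natural_indices[OF T(2)] by (simp add: T len)
  have j: "map ?j (leaves v) = map Suc [0..<n]" using natural_indices[OF S(2)] by (simp add: S len)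
  have "\<Sum>\<^sub># ?G = image_mset ?i (mset (leaves u))"
    unfolding sum_image_image using T(2) by (simp add: wf_forest_def)
  also have "\<dots> = mset (map Suc [0..<n])" by (simp only: mset_map[symmetric] i)
  finally have G: "simple (\<Sum>\<^sub># ?G)" by (simp only: simple_mset) (simp add: distinct_map)
  have "\<Sum>\<^sub># ?H = image_mset ?j (mset (leaves v))"
    unfolding sum_image_image switched_union[OF C(1)] ..
  also have "\<dots> = mset (map Suc [0..<n])" by (simp only: mset_map[symmetric] j)
  finally have H: "simple (\<Sum>\<^sub># ?H)" by (simp only: simple_mset) (simp add: distinct_map)
  have "?G = ?H"
  proof (rule partition_eqI[OF G H])
    show "{#} \<notin># ?H" using switched_nonempty[OF C(1)] by auto
    have "set_mset ` set_mset ?G = (\<lambda>c. ?i ` c) ` (set_mset ` set_mset (vertices E))" by (simp add: image_image)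
    also have "\<dots> = (\<lambda>c. ?j ` c) ` (set_mset ` set_mset C)"
      using nat unfolding natural_partition_def C(2) by (simp add: T(1) daimon_partition_forest)
    also have "\<dots> = set_mset ` set_mset ?H" by (simp add: image_image)
    finally show "set_mset ` set_mset ?G = set_mset ` set_mset ?H" .
  qed
  \<comment> \<open>Sends a natural index, counted from 1, back to the corresponding leaf of
    \<open>t\<close>.\<close>
  define h where "h k = leaves t ! (k - 1)" for k
  have h: "map h (map Suc [0..<n]) = leaves t"
    by (intro nth_equalityI) (simp_all add: n_def h_def)
  show ?thesis
  proof (rule that[OF T tu])
    show "map (h \<circ> ?i) (leaves u) = leaves t" unfolding map_map[symmetric] i h ..
    have "labels (h \<circ> ?i) E = image_mset (image_mset h) ?G" by (simp add: multiset.map_comp comp_def)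
    also have "\<dots> = image_mset (image_mset (h \<circ> ?j)) C"
      unfolding \<open>?G = ?H\<close> by (simp add: multiset.map_comp comp_def)
    finally have eq: "labels (h \<circ> ?i) E = image_mset (image_mset (h \<circ> ?j)) C" .
    have "map (h \<circ> ?j) (leaves v) = leaves t" unfolding map_map[symmetric] j h ..
    then show "switched t (labels (h \<circ> ?i) E)"
      using C(1) sw_similar[OF _ vt] unfolding eq switched_def by fastforce
  qed
qed

text \<open>Keeps all positions, so a net on \<open>t\<close> and a test on the dual tree give each
  leaf the same natural index.\<close>

fun dual_tree :: "'a tree \<Rightarrow> 'a tree" where
  "dual_tree (Leaf x) = Leaf x"
| "dual_tree (Node k p a b) = Node (\<not> k) p (dual_tree a) (dual_tree b)"

lemma dual_tree_simps [simp]: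
  "root (dual_tree t) = root t" "leaves (dual_tree t) = leaves t" "inner (dual_tree t) = inner t"
  "similar True t (dual_tree t)"
proof -
  show "root (dual_tree t) = root t" by (cases t) auto
  show "leaves (dual_tree t) = leaves t" "inner (dual_tree t) = inner t" "similar True t (dual_tree t)"
    by (induction t) auto
qed

lemma labelled_dual: "labelled \<tau> t \<Longrightarrow> labelled (neg d \<circ> \<tau>) (dual_tree t)"
  by (induction t) auto

lemma test_exists:
  assumes "simple (nodes t)" "labelled \<tau> t" "switched t C"
  obtains T u E where "is_test d T (\<tau> (root t))" "T = forest_net [u] E" "wf_forest [u] E"
    "similar True t u" "leaves u = leaves t" "vertices E = C"
proof -
  \<comment> \<open>A daimon lists its outputs in some order; any enumeration of the class will
    do.\<close>
  define E where "E = image_mset (\<lambda>c. SOME xs. mset xs = c) C"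
  have "mset (SOME xs. mset xs = c) = c" for c :: "pos multiset"
    by (rule someI_ex) (rule ex_mset)
  then have E: "vertices E = C" by (simp add: E_def multiset.map_comp comp_def)
  let ?u = "dual_tree t"
  have nodes: "nodes ?u = nodes t" by (simp add: nodes_def)
  have wfT: "wf_forest [?u] E"
    unfolding wf_forest_def E using assms(1) switched_union[OF assms(3)] by (simp add: nodes)
  \<comment> \<open>The witness net has to carry the tree \<open>t\<close>; one daimon on all leaves
    completes it.\<close>
  define S where "S = forest_net [t] {#leaves t#}"
  have wfS: "wf_forest [t] {#leaves t#}" using assms(1) by (simp add: wf_forest_def)
  define T where "T = forest_net [?u] E"
  have "atomically_testable T (map (\<lambda>u. (neg d \<circ> \<tau>) (root u)) [?u])"
    unfolding T_def using labelled_dual[OF assms(2), of d]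
    by (intro forest_atomically_testable[OF wfT, of "neg d \<circ> \<tau>"]) simp
  then have at_T: "atomically_testable T [neg d (\<tau> (root t))]" by simp
  have "atomically_testable S (map (\<lambda>u. \<tau> (root u)) [t])"
    unfolding S_def using assms(2) by (intro forest_atomically_testable wfS) simp
  then have at_S: "atomically_testable S [\<tau> (root t)]" by simp
  obtain f N where sw: "switching S f N" "up_partition S f N = set_mset ` set_mset C"
    using switching_exists[OF wfS] assms(3) unfolding S_def forest_switched_single by blast
  have "natural_index T x = natural_index S x" if x: "x \<in> set (leaves t)" for x
  proof -
    obtain i where "i < length (leaves t)" "x = leaves t ! i" using x by (auto simp: in_set_conv_nth)
    then show ?thesis using natural_index_forest[OF wfT, of i] natural_index_forest[OF wfS, of i]
      by (simp add: T_def S_def)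
  qed
  moreover have "c \<subseteq> set (leaves t)" if "c \<in> set_mset ` set_mset C" for c
  proof -
    have "x \<in># \<Sum>\<^sub># C" if "x \<in> c" for x using that \<open>c \<in> set_mset ` set_mset C\<close> by auto
    then show ?thesis unfolding switched_union[OF assms(3)] by auto
  qed
  ultimately have "natural_index T ` c = natural_index S ` c" if "c \<in> set_mset ` set_mset C" for c
    using that by (intro image_cong refl) blast
  then have "natural_partition T (set_mset ` set_mset C) = natural_partition S (set_mset ` set_mset C)"
    unfolding natural_partition_def by (rule image_cong[OF refl])
  moreover have "daimon_partition T = set_mset ` set_mset C"
    unfolding T_def daimon_partition_forest E ..
  ultimately have "is_test d T (\<tau> (root t))"
    unfolding is_test_def using at_T at_S sw by metis
  then show ?thesis using that T_def wfT E by simp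
qed

text \<open>Against the forest \<open>ts\<close>, the net \<open>T\<close> acts as the classes
  \<open>C\<close>: its trees are dual to \<open>ts\<close>, and \<open>\<phi>\<close> names the
  outputs of its daimons by the leaves of \<open>ts\<close> that they meet. This hides the renamings
  caused by juxtaposition.\<close>

definition depicts :: "net \<Rightarrow> pos tree list \<Rightarrow> pos multiset multiset \<Rightarrow> bool" where
  "depicts T ts C \<longleftrightarrow> (\<exists>us E \<phi>. T = forest_net us E \<and> wf_forest us E \<and> list_all2 (similar True) ts us \<and>
     map \<phi> (concat (map leaves us)) = concat (map leaves ts) \<and> labels \<phi> E = C)"

lemma depicts_single:
  assumes "T = forest_net [u] E" "wf_forest [u] E" "similar True t u" "map \<phi> (leaves u) = leaves t"
  shows "depicts T [t] (labels \<phi> E)"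
  unfolding depicts_def using assms by (intro exI[of _ "[u]"] exI[of _ E] exI[of _ \<phi>]) simp

lemma depicts_juxtapose:
  assumes "depicts T ts C" "depicts T' ts' C'"
  shows "depicts (juxtapose T T') (ts @ ts') (C + C')"
proof -
  obtain us E \<phi> where T: "T = forest_net us E" "wf_forest us E" "list_all2 (similar True) ts us"
    "map \<phi> (concat (map leaves us)) = concat (map leaves ts)" "labels \<phi> E = C"
    using assms(1) by (auto simp: depicts_def)
  obtain us' E' \<phi>' where T': "T' = forest_net us' E'" "wf_forest us' E'" "list_all2 (similar True) ts' us'"
    "map \<phi>' (concat (map leaves us')) = concat (map leaves ts')" "labels \<phi>' E' = C'"
    using assms(2) by (auto simp: depicts_def)
  define \<psi> where "\<psi> n = (if even n then \<phi> (n div 2) else \<phi>' (n div 2))" for n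
  let ?us = "map (map_tree even_pos) us @ map (map_tree odd_pos) us'"
  let ?E = "image_mset (map even_pos) E + image_mset (map odd_pos) E'"
  have "juxtapose T T' = forest_net ?us ?E" unfolding T(1) T'(1) by (rule juxtapose_forest_net)
  moreover have "wf_forest ?us ?E" using T(2) T'(2) by (rule wf_forest_juxtapose)
  moreover have "list_all2 (similar True) (ts @ ts') ?us"
    using T(3) T'(3) by (intro list_all2_appendI) (simp_all add: list_all2_map2)
  moreover have "map \<psi> (concat (map leaves ?us)) = concat (map leaves (ts @ ts'))"
  proof -
    have "map \<psi> (concat (map leaves (map (map_tree even_pos) us))) = map \<phi> (concat (map leaves us))"
      by (induction us) (auto simp: \<psi>_def)
    moreover have "map \<psi> (concat (map leaves (map (map_tree odd_pos) us'))) = map \<phi>' (concat (map leaves us'))"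
      by (induction us') (auto simp: \<psi>_def)
    ultimately show ?thesis using T(4) T'(4) by simp
  qed
  moreover have "labels \<psi> ?E = C + C'"
    unfolding T(5)[symmetric] T'(5)[symmetric] by (simp add: \<psi>_def multiset.map_comp comp_def)
  ultimately show ?thesis unfolding depicts_def by blast
qed

lemma depicts_foldl:
  assumes "depicts T ts\<^sub>0 C\<^sub>0" "list_all2 (\<lambda>T x. depicts T [fst x] (snd x)) Ts xs"
  shows "depicts (foldl juxtapose T Ts) (ts\<^sub>0 @ map fst xs) (C\<^sub>0 + sum_list (map snd xs))"
  using assms(2,1)
proof (induction arbitrary: T ts\<^sub>0 C\<^sub>0 rule: list_all2_induct)
  case (Cons U Us x xs)
  from Cons.IH[OF depicts_juxtapose[OF Cons.prems Cons.hyps(1)]] show ?case by (simp add: add.assoc)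
qed simp

lemma depicts_juxtapositions:
  assumes "list_all2 (\<lambda>T x. depicts T [fst x] (snd x)) Ts xs"
  shows "depicts (juxtapositions Ts) (map fst xs) (sum_list (map snd xs))"
proof (cases Ts)
  case Nil
  have "empty_net = forest_net [] {#}" "wf_forest [] {#}"
    by (simp_all add: empty_net_def forest_net_def wf_forest_def)
  then have "depicts empty_net [] {#}" unfolding depicts_def by fastforce
  with Nil assms show ?thesis by simp
next
  case (Cons T Ts')
  then obtain x xs' where "xs = x # xs'" "depicts T [fst x] (snd x)"
    "list_all2 (\<lambda>T x. depicts T [fst x] (snd x)) Ts' xs'"
    using assms by (auto simp: list_all2_Cons1)
  with depicts_foldl[of T "[fst x]" "snd x" Ts' xs'] Cons show ?thesis by simp
qed

lemma orthogonal_depicts: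
  assumes "wf_forest ts D" "depicts T ts C"
  shows "forest_net ts D \<bottom>\<bottom> T \<longleftrightarrow> tree_graph (vertices D + C)"
  using assms interaction_forest_net[OF assms(1)] unfolding depicts_def by blast

lemma test_net:
  assumes "T \<in> tests d A"
  shows "is_net T \<and> length (concl T) = 1"
proof -
  from assms have "atomically_testable T [neg d A]" by (simp add: tests_def is_test_def)
  then show ?thesis unfolding atomically_testable_def
    by (metis One_nat_def length_Cons length_map list.size(3))
qed

lemma correct_iff_orthogonal:
  fixes \<tau> :: "pos \<Rightarrow> 'v form"
  assumes wf: "wf_forest ts D" and lab: "\<And>t. t \<in> set ts \<Longrightarrow> labelled \<tau> t"
  shows "correct ts D \<longleftrightarrow>
    orthogonal_set (forest_net ts D) (par_sets (map (tests d) (map (\<lambda>t. \<tau> (root t)) ts)))"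
proof -
  let ?As = "map (\<lambda>t. \<tau> (root t)) ts"
  have "orthogonal_set (forest_net ts D) (par_sets (map (tests d) ?As)) \<longleftrightarrow>
      (\<forall>Ts. list_all2 (\<in>) Ts (map (tests d) ?As) \<longrightarrow> forest_net ts D \<bottom>\<bottom> juxtapositions Ts)"
    using is_net_forest_net[OF wf] test_net by (intro orthogonal_par_sets) auto
  also have "\<dots> \<longleftrightarrow> correct ts D"
  proof
    assume cor: "correct ts D"
    show "\<forall>Ts. list_all2 (\<in>) Ts (map (tests d) ?As) \<longrightarrow> forest_net ts D \<bottom>\<bottom> juxtapositions Ts"
    proof (intro allI impI)
      fix Ts assume Ts: "list_all2 (\<in>) Ts (map (tests d) ?As)"
      \<comment> \<open>Each test of the formula acts as some switching of the tree.\<close>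
      have "\<exists>C. switched t C \<and> depicts T [t] C" if "T \<in> tests d (\<tau> (root t))" "t \<in> set ts" for T t
      proof -
        have "is_test d T (\<tau> (root t))" using that(1) by (simp add: tests_def)
        moreover have "fits t (\<tau> (root t))" using labelled_fits lab that(2) by blast
        ultimately obtain u E \<phi> where "T = forest_net [u] E" "wf_forest [u] E" "similar True t u"
          "map \<phi> (leaves u) = leaves t" "switched t (labels \<phi> E)" by (rule test_switched)
        then show ?thesis using depicts_single by blast
      qed
      then have "list_all2 (\<lambda>T t. \<exists>C. switched t C \<and> depicts T [t] C) Ts ts"
        using Ts unfolding list_all2_map2 by (auto simp: list_all2_conv_all_nth)
      then have "\<exists>Cs. list_all2 switched ts Cs \<and> list_all2 (\<lambda>T x. depicts T [fst x] (snd x)) Ts (zip ts Cs) \<and>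
          length Cs = length ts"
      proof (induction rule: list_all2_induct)
        case (Cons T Ts t ts)
        then obtain C Cs where "switched t C" "depicts T [t] C" "list_all2 switched ts Cs"
          "list_all2 (\<lambda>T x. depicts T [fst x] (snd x)) Ts (zip ts Cs)" "length Cs = length ts" by blast
        then show ?case by (intro exI[of _ "C # Cs"]) simp
      qed simp
      then obtain Cs where Cs: "list_all2 switched ts Cs"
        "list_all2 (\<lambda>T x. depicts T [fst x] (snd x)) Ts (zip ts Cs)" "length Cs = length ts" by blast
      have "depicts (juxtapositions Ts) ts (sum_list Cs)"
        using depicts_juxtapositions[OF Cs(2)] Cs(3) by simp
      moreover have "tree_graph (vertices D + sum_list Cs)" using cor Cs(1) by (simp add: correct_def)
      ultimately show "forest_net ts D \<bottom>\<bottom> juxtapositions Ts" using orthogonal_depicts[OF wf] by blast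
    qed
  next
    assume orth: "\<forall>Ts. list_all2 (\<in>) Ts (map (tests d) ?As) \<longrightarrow> forest_net ts D \<bottom>\<bottom> juxtapositions Ts"
    show "correct ts D"
      unfolding correct_def
    proof (intro allI impI)
      fix Cs assume Cs: "list_all2 switched ts Cs"
      \<comment> \<open>Conversely, each switching of the tree is the action of some test.\<close>
      have "\<exists>T. T \<in> tests d (\<tau> (root t)) \<and> depicts T [t] C" if t: "t \<in> set ts" "switched t C" for t C
      proof -
        have "simple (nodes t)" using simple_in_forest wf t(1) by (auto simp: wf_forest_def)
        then obtain T u E where "is_test d T (\<tau> (root t))" "T = forest_net [u] E" "wf_forest [u] E"
          "similar True t u" "leaves u = leaves t" "vertices E = C"
          using test_exists lab[OF t(1)] t(2) by metis
        then show ?thesis using depicts_single[of T u E t "\<lambda>x. x"] by (auto simp: tests_def)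
      qed
      then have "list_all2 (\<lambda>t C. \<exists>T. T \<in> tests d (\<tau> (root t)) \<and> depicts T [t] C) ts Cs"
        using Cs by (auto simp: list_all2_conv_all_nth)
      then have "\<exists>Ts. list_all2 (\<lambda>T t. T \<in> tests d (\<tau> (root t))) Ts ts \<and>
          list_all2 (\<lambda>T x. depicts T [fst x] (snd x)) Ts (zip ts Cs) \<and> length Cs = length ts"
      proof (induction rule: list_all2_induct)
        case (Cons t ts C Cs)
        then obtain T Ts where "T \<in> tests d (\<tau> (root t))" "depicts T [t] C"
          "list_all2 (\<lambda>T t. T \<in> tests d (\<tau> (root t))) Ts ts"
          "list_all2 (\<lambda>T x. depicts T [fst x] (snd x)) Ts (zip ts Cs)" "length Cs = length ts" by blast
        then show ?case by (intro exI[of _ "T # Ts"]) simp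
      qed simp
      then obtain Ts where Ts: "list_all2 (\<lambda>T t. T \<in> tests d (\<tau> (root t))) Ts ts"
        "list_all2 (\<lambda>T x. depicts T [fst x] (snd x)) Ts (zip ts Cs)" "length Cs = length ts" by blast
      have "forest_net ts D \<bottom>\<bottom> juxtapositions Ts"
        using orth Ts(1) by (simp add: list_all2_map2)
      moreover have "depicts (juxtapositions Ts) ts (sum_list Cs)"
        using depicts_juxtapositions[OF Ts(2)] Ts(3) by simp
      ultimately show "tree_graph (vertices D + sum_list Cs)" using orthogonal_depicts[OF wf] by blast
    qed
  qed
  finally show ?thesis ..
qed

theorem theorem76:
  fixes dual :: "'v::countable \<Rightarrow> 'v"
    and S :: net
    and As :: "'v form list"
  assumes "\<And>X. dual (dual X) = X"
    and "is_net S"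
    and "cut_free S"
    and "atomically_testable S As"
  shows "derives dual S As \<longleftrightarrow> orthogonal_set S (par_sets (map (tests dual) As))"
proof
  assume "derives dual S As"
  then obtain \<pi> :: "'v mll_proof" where "represents S \<pi>" by (auto simp: derives_def)
  then obtain ts D where ts: "wf_forest ts D" "correct ts D" "S = forest_net ts D"
    using sequential_correct[OF represents_sequential[OF _ assms(3)]] by (metis net.collapse)
  \<comment> \<open>The forest comes from the proof, the labelling from testability; both belong to
    the same net, so the labels fit the trees.\<close>
  obtain \<tau> where \<tau>: "atomic_labelling S \<tau>" "map \<tau> (concl S) = As"
    using assms(4) by (auto simp: atomically_testable_def)
  then have "\<And>t. t \<in> set ts \<Longrightarrow> labelled \<tau> t" "As = map (\<lambda>t. \<tau> (root t)) ts"
    using atomic_labelling_forest_net[OF ts(1)] by (auto simp: ts(3))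
  then show "orthogonal_set S (par_sets (map (tests dual) As))"
    using correct_iff_orthogonal[OF ts(1)] ts(2,3) by blast
next
  assume orth: "orthogonal_set S (par_sets (map (tests dual) As))"
  obtain ts D \<tau> where ts: "wf_forest ts D" "S = forest_net ts D" "\<And>t. t \<in> set ts \<Longrightarrow> labelled \<tau> t"
    "As = map (\<lambda>t. \<tau> (root t)) ts"
    using atomically_testable_forest[OF assms(4)] by blast
  then have "correct ts D" using correct_iff_orthogonal[OF ts(1,3)] orth by blast
  then have "sequential (links S) (map root ts)" using correct_sequential[OF ts(1)] by (simp add: ts(2))
  moreover have "formula_labelling S \<tau>"
    using atomic_labelling_forest_net[OF ts(1)] ts(2,3) by (auto simp: atomic_labelling_def)
  moreover have "S = Net (links S) (map root ts)" by (simp add: ts(2) forest_net_def)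
  ultimately obtain \<pi> where "proof_of dual \<pi> (map \<tau> (map root ts))" "represents S \<pi>"
    using sequential_represents[of "links S" "map root ts" \<tau> dual] by metis
  then show "derives dual S As" by (auto simp: derives_def ts(4) comp_def)
qed

end
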